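(* Let $n\ge 4$ and let $\Gamma$ be a type IV quiver of mutation type $D_n$ with central cycle of length $m$ and $r$ spikes, where $r=m$, labelled by the type IV (Case 2) labelling procedure. Let $\Phi$ be the root system of type $D_n$ with simple system $\Pi=\{\alpha_1,\ldots,\alpha_n\}$, and identify vertices with their labels. Then the set $\{\beta_i : i\in\Gamma_0\}\subseteq\Phi$ given by $$\beta_i=\begin{cases}\alpha_i+\ldots+\alpha_{i+a} & \text{if } i \text{ is a primary vertex and } i+a \text{ is the complementary vertex corresponding to } i,\\ \alpha_{p_j}+\ldots+\alpha_{p_j+a_j} & \text{if } i=p_j \text{ for some } 1\le j\le r-1,\\ \alpha_1+\ldots+\alpha_{p_r-1}+2\alpha_{p_r}+\ldots+2\alpha_{n-2}+\alpha_{n-1}+\alpha_n & \text{if } i=p_r,\\ \alpha_1+\ldots+\alpha_{n-2}+\alpha_n & \text{if } i=n,\\ \alpha_i & \text{otherwise}\end{cases}$$ is a companion basis for $\Gamma$.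
   Context: **Mutation type.** For a simply-laced Dynkin diagram $\Delta$, a quiver is of mutation type $\Delta$ if it is obtained by a finite sequence of (Fomin--Zelevinsky) quiver mutations from a quiver whose underlying graph is $\Delta$. $\Gamma_0$ denotes the vertex set of $\Gamma$. **Root system.** $\Phi$ is the root system of type $D_n$, with inner product $(\cdot,\cdot)$ normalized so that $(\alpha,\alpha)=2$ for all roots $\alpha$; the simple roots are numbered so that the Dynkin diagram is the chain $1 - 2 - \cdots - (n-2)$ with $n-2$ additionally joined to both $n-1$ and $n$. In the formula for $\beta_{p_r}$, the coefficient of $\alpha_k$ is $1$ for $1\le k\le p_r-1$, $2$ for $p_r\le k\le n-2$, and $1$ for $k=n-1,n$ (if $p_r=n-1$ there are no terms with coefficient $2$). **Companion basis.** A companion basis for a quiver $\Gamma$ of mutation type $\Delta$ is a subset $\{\gamma_x : x\in\Gamma_0\}\subseteq\Phi$ (with $\Phi$ the root system of type $\Delta$) whose elements form a $\mathbb{Z}$-basis of the root lattice $\mathbb{Z}\Phi$ and such that for all distinct $x,y\in\Gamma_0$, $|(\gamma_x,\gamma_y)|$ equals the number of edges joining $x$ and $y$ in the underlying unoriented graph of $\Gamma$. **Structure of type $A$ quivers (known facts making the definitions below meaningful).** A quiver $Q$ of mutation type $A_k$ is connected; the only cycles in its underlying graph are 3-cycles, each of which is cyclically oriented in $Q$; every vertex has valency at most four and lies on at most two 3-cycles. An end vertex is a vertex that has valency zero, or valency one, or has valency two and belongs to a cyclically oriented 3-cycle; if $k\ge 2$ there are at least two end vertices. A string in $Q$ is a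 reduced walk in $Q$ that does not contain two consecutive arrows of any given 3-cycle; for any two vertices $i,j$ there is a unique string from $i$ to $j$ (trivial if $i=j$), and it visits no vertex twice. Let $p$ be a string from $i$ to $j$. For a 3-cycle with two vertices appearing in $p$, the first of these met when moving along $p$ from $i$ to $j$ is a primary vertex relative to $p$, the second is the secondary vertex corresponding to it relative to $p$, and the vertex of the 3-cycle not on $p$ is the complementary vertex corresponding to it relative to $p$. If $x,y,z$ are the vertices of a 3-cycle, the subquiver of $Q$ rooted at $x$ is the full subquiver on all vertices that can be reached on strings starting at $x$ which do not pass through $y$ or $z$; it is again a quiver of mutation type $A$, and $x$ is an end vertex of it. **Type $A$ labelling procedure.** The input is a quiver $Q$ of mutation type $A_k$ and an ordered pair of end vertices of $Q$, distinct if $k\ge 2$. If $k=1$, label the vertex $1$. If $k\ge 2$ with pair $(e,f)$, label $e$ by $1$ and let $p$ be the string from $e$ to $f$; move along $p$ from $e$ to $f$. If the current vertex has label $\ell$ and is not a primary vertex relative to $p$, label the next vertex of $p$ by $\ell+1$. If the current vertex has label $\ell$ and is a primary vertex relative to $p$ with corresponding complementary vertex $z$, let $Q'$ be the subquiver of $Q$ rooted at $z$ and let $a$ be its number of vertices; choose an end vertex $z'$ of $Q'$, distinct from $z$ if $a>1$; recursively label $Q'$ with $1,\ldots,a$ using the ordered pair $(z',z)$; add $\ell$ to each of these labels and assign the results to the corresponding vertices of $Q$; then label the next vertex on $p$ (the corresponding secondary vertex) by $\ell+a+1$. Continue until $f$ is labelled; it gets the label $k$. **Type IV quivers with $r=m$.**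 Let $m\ge 3$ and $r=m$. The skeleton $\Gamma^{(0)}$ consists of an oriented $m$-cycle (the central cycle, drawn so that its arrows point clockwise), together with $r=m$ additional vertices $c_1,\ldots,c_r$ corresponding to the arrows $p_1\to s_1,\ldots,p_r\to s_r$ of the central cycle, listed in clockwise order (so $s_i=p_{i+1}$ for $1\le i\le r-1$ and $s_r=p_1$, and $p_1,\ldots,p_r$ are precisely the vertices of the central cycle); for each $i$ there are arrows $s_i\to c_i$ and $c_i\to p_i$, so that $p_i\to s_i\to c_i\to p_i$ is an oriented 3-cycle, called a spike. There are no other arrows. $\Gamma$ is obtained from a disjoint union $\Gamma^{(0)}\sqcup\Gamma^{(1)}\sqcup\cdots\sqcup\Gamma^{(r)}$, where each $\Gamma^{(i)}$ ($1\le i\le r$) is a quiver of mutation type $A_{a_i}$ (so it has $a_i$ vertices), by identifying an end vertex $v_i$ of $\Gamma^{(i)}$ with $c_i$ for each $i$. One has $n=m+\sum_{i=1}^r a_i$. **Labelling in Case 2 ($r=m$).** For each $1\le i\le r$, label $p_i$ by $\sum_{j=1}^{i-1}a_j+i$ (so $p_1$ is labelled $1$); vertex names $p_i$ are identified with their labels. Then for each $1\le i\le r$: choose an ordered pair of end vertices (distinct if possible) of $\Gamma^{(i)}$ with $v_i$ the second vertex in the pair, apply the type $A$ labelling procedure to $\Gamma^{(i)}$, add $p_i$ to each label (giving labels $p_i+1,\ldots,p_i+a_i$, with $v_i$ labelled $p_i+a_i$), and assign these labels to the corresponding vertices of $\Gamma$. In particular $v_r$ gets the label $p_r+a_r=n$.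 **Vertex types in the labelled quiver.** If the vertices of a 3-cycle of some $\Gamma^{(t)}$, $1\le t\le r$, have labels $i<j<k$, then $i$ is called a primary vertex, $j$ a complementary vertex (the complementary vertex corresponding to $i$), and $k$ a secondary vertex. A vertex of $\Gamma$ is primary (resp. complementary, secondary) if it is so in $\Gamma^{(t)}$ for some $1\le t\le r$. *)

theory Defs
  imports "HOL-Analysis.Analysis"
begin

text \<open>
  A quiver without loops and oriented 2-cycles is given by its vertex set and the number
  \<open>arr Q x y\<close> of arrows from \<open>x\<close> to \<open>y\<close>.
\<close>

record 'v quiver =
  verts :: "'v set"
  arr :: "'v \<Rightarrow> 'v \<Rightarrow> nat"

definition is_quiver :: "'v quiver \<Rightarrow> bool" where
  "is_quiver Q \<longleftrightarrow>
     finite (verts Q) \<and>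
     (\<forall>x y. arr Q x y > 0 \<longrightarrow> x \<in> verts Q \<and> y \<in> verts Q) \<and>
     (\<forall>x. arr Q x x = 0) \<and>
     (\<forall>x y. arr Q x y = 0 \<or> arr Q y x = 0)"

definition edges :: "'v quiver \<Rightarrow> 'v \<Rightarrow> 'v \<Rightarrow> nat" where
  "edges Q x y = arr Q x y + arr Q y x"

text \<open>
  Fomin--Zelevinsky mutation at \<open>k\<close>: for every path \<open>i \<rightarrow> k \<rightarrow> j\<close> add an arrow \<open>i \<rightarrow> j\<close>,
  reverse the arrows at \<open>k\<close>, and cancel a maximal collection of 2-cycles. The cancellation
  is the truncated subtraction on \<^typ>\<open>nat\<close>.
\<close>

definition mutate :: "'v \<Rightarrow> 'v quiver \<Rightarrow> 'v quiver" where
  "mutate k Q = Q\<lparr>arr := (\<lambda>i j.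
     if i = k \<or> j = k then arr Q j i
     else (arr Q i j + arr Q i k * arr Q k j) - (arr Q j i + arr Q j k * arr Q k i))\<rparr>"

definition mutation_step :: "'v quiver \<Rightarrow> 'v quiver \<Rightarrow> bool" where
  "mutation_step Q Q' \<longleftrightarrow> (\<exists>k\<in>verts Q. Q' = mutate k Q)"

definition dynkin_A :: "nat \<Rightarrow> nat \<Rightarrow> bool" where
  "dynkin_A i j \<longleftrightarrow> j = i + 1 \<or> i = j + 1"

text \<open>
  On \<open>{1..n}\<close>, \<open>n \<ge> 4\<close>: the chain \<open>1 - 2 - \<dots> - (n-2)\<close>, with \<open>n-2\<close> also joined to
  \<open>n-1\<close> and to \<open>n\<close>.
\<close>

definition dynkin_D :: "nat \<Rightarrow> nat \<Rightarrow> nat \<Rightarrow> bool" where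
  "dynkin_D n i j \<longleftrightarrow>
     (j = i + 1 \<and> j \<le> n - 1) \<or> (i = j + 1 \<and> i \<le> n - 1) \<or>
     (i = n - 2 \<and> j = n) \<or> (i = n \<and> j = n - 2)"

definition has_underlying_graph :: "'v quiver \<Rightarrow> nat \<Rightarrow> (nat \<Rightarrow> nat \<Rightarrow> bool) \<Rightarrow> bool" where
  "has_underlying_graph Q n E \<longleftrightarrow>
     (\<exists>\<sigma>. bij_betw \<sigma> {1..n} (verts Q) \<and>
        (\<forall>i\<in>{1..n}. \<forall>j\<in>{1..n}. edges Q (\<sigma> i) (\<sigma> j) = (if E i j then 1 else 0)))"

definition mutation_type :: "nat \<Rightarrow> (nat \<Rightarrow> nat \<Rightarrow> bool) \<Rightarrow> 'v quiver \<Rightarrow> bool" where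
  "mutation_type n E Q \<longleftrightarrow>
     (\<exists>Q0. is_quiver Q0 \<and> has_underlying_graph Q0 n E \<and> mutation_step\<^sup>*\<^sup>* Q0 Q)"

abbreviation mutation_type_A :: "nat \<Rightarrow> 'v quiver \<Rightarrow> bool" where
  "mutation_type_A k \<equiv> mutation_type k dynkin_A"

abbreviation mutation_type_D :: "nat \<Rightarrow> 'v quiver \<Rightarrow> bool" where
  "mutation_type_D n \<equiv> mutation_type n (dynkin_D n)"


definition three_cycle :: "'v quiver \<Rightarrow> 'v \<Rightarrow> 'v \<Rightarrow> 'v \<Rightarrow> bool" where
  "three_cycle Q x y z \<longleftrightarrow>
     (arr Q x y > 0 \<and> arr Q y z > 0 \<and> arr Q z x > 0) \<or>
     (arr Q x z > 0 \<and> arr Q z y > 0 \<and> arr Q y x > 0)"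

definition valency :: "'v quiver \<Rightarrow> 'v \<Rightarrow> nat" where
  "valency Q x = (\<Sum>y\<in>verts Q. edges Q x y)"

definition end_vertex :: "'v quiver \<Rightarrow> 'v \<Rightarrow> bool" where
  "end_vertex Q x \<longleftrightarrow> x \<in> verts Q \<and>
     (valency Q x = 0 \<or> valency Q x = 1 \<or>
      (valency Q x = 2 \<and> (\<exists>y z. three_cycle Q x y z)))"

text \<open>
  Walks are recorded by the list of vertices visited; nothing is lost, because quivers of
  mutation type A have no multiple arrows. The last two clauses say that the walk is reduced
  and does not contain two consecutive arrows of a 3-cycle.
\<close>

definition string_in :: "'v quiver \<Rightarrow> 'v list \<Rightarrow> bool" where
  "string_in Q p \<longleftrightarrow>
     p \<noteq> [] \<and> set p \<subseteq> verts Q \<and>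
     (\<forall>i. i + 1 < length p \<longrightarrow> edges Q (p ! i) (p ! (i + 1)) > 0) \<and>
     (\<forall>i. i + 2 < length p \<longrightarrow> p ! i \<noteq> p ! (i + 2)) \<and>
     (\<forall>i. i + 2 < length p \<longrightarrow> \<not> three_cycle Q (p ! i) (p ! (i + 1)) (p ! (i + 2)))"

definition string_from_to :: "'v quiver \<Rightarrow> 'v list \<Rightarrow> 'v \<Rightarrow> 'v \<Rightarrow> bool" where
  "string_from_to Q p x y \<longleftrightarrow> string_in Q p \<and> hd p = x \<and> last p = y"

text \<open>
  \<open>u\<close> is a primary vertex relative to the string \<open>p\<close>, with corresponding secondary vertex \<open>s\<close>
  and complementary vertex \<open>z\<close>.
\<close>

definition primary_on :: "'v quiver \<Rightarrow> 'v list \<Rightarrow> 'v \<Rightarrow> 'v \<Rightarrow> 'v \<Rightarrow> bool" where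
  "primary_on Q p u s z \<longleftrightarrow>
     (\<exists>i j. i < j \<and> j < length p \<and> p ! i = u \<and> p ! j = s) \<and>
     z \<notin> set p \<and> three_cycle Q u s z"

definition full_subquiver :: "'v quiver \<Rightarrow> 'v set \<Rightarrow> 'v quiver" where
  "full_subquiver Q W =
     \<lparr>verts = verts Q \<inter> W, arr = (\<lambda>x y. if x \<in> W \<and> y \<in> W then arr Q x y else 0)\<rparr>"

text \<open>The subquiver rooted at the vertex \<open>x\<close> of the 3-cycle with vertices \<open>x, y, z\<close>.\<close>

definition rooted :: "'v quiver \<Rightarrow> 'v \<Rightarrow> 'v \<Rightarrow> 'v \<Rightarrow> 'v quiver" where
  "rooted Q x y z =
     full_subquiver Q {w. \<exists>p. string_from_to Q p x w \<and> y \<notin> set p \<and> z \<notin> set p}"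

text \<open>
  \<open>labelling_A Q e f L\<close>: on the vertices of \<open>Q\<close>, the function \<open>L\<close> is a possible outcome of the
  type A labelling procedure applied to \<open>Q\<close> with the ordered pair \<open>(e, f)\<close>. It is a
  relation because of the free choice of the end vertex \<open>z'\<close> at every recursive call. Values of
  \<open>L\<close> outside the vertex set are irrelevant.
\<close>

inductive labelling_A :: "'v quiver \<Rightarrow> 'v \<Rightarrow> 'v \<Rightarrow> ('v \<Rightarrow> nat) \<Rightarrow> bool" where
  single: "\<lbrakk>verts Q = {x}; L x = 1\<rbrakk> \<Longrightarrow> labelling_A Q x x L"
| walk: "\<lbrakk>card (verts Q) \<ge> 2; end_vertex Q e; end_vertex Q f; e \<noteq> f;
     string_from_to Q p e f;
     L e = 1;
     \<forall>i. i + 1 < length p \<longrightarrow> \<not> (\<exists>s z. primary_on Q p (p ! i) s z) \<longrightarrow>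
       L (p ! (i + 1)) = L (p ! i) + 1;
     \<forall>i s z. i + 1 < length p \<longrightarrow> primary_on Q p (p ! i) s z \<longrightarrow>
       (\<exists>z' L'.
          end_vertex (rooted Q z (p ! i) s) z' \<and>
          (card (verts (rooted Q z (p ! i) s)) > 1 \<longrightarrow> z' \<noteq> z) \<and>
          labelling_A (rooted Q z (p ! i) s) z' z L' \<and>
          (\<forall>w\<in>verts (rooted Q z (p ! i) s). L w = L' w + L (p ! i))) \<and>
       L (p ! (i + 1)) = L (p ! i) + card (verts (rooted Q z (p ! i) s)) + 1\<rbrakk>
   \<Longrightarrow> labelling_A Q e f L"


text \<open>
  \<open>P 1, \<dots>, P m\<close> are the vertices of the central cycle in clockwise order;
  \<open>succ_on_cycle m P i\<close> is the vertex following \<open>P i\<close>.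
\<close>

definition succ_on_cycle :: "nat \<Rightarrow> (nat \<Rightarrow> 'v) \<Rightarrow> nat \<Rightarrow> 'v" where
  "succ_on_cycle m P i = (if i = m then P 1 else P (i + 1))"

definition skeleton :: "nat \<Rightarrow> (nat \<Rightarrow> 'v) \<Rightarrow> (nat \<Rightarrow> 'v) \<Rightarrow> 'v quiver" where
  "skeleton m P c =
     \<lparr>verts = P ` {1..m} \<union> c ` {1..m},
      arr = (\<lambda>x y. if \<exists>i\<in>{1..m}. (x, y) \<in> {(P i, succ_on_cycle m P i),
                                            (succ_on_cycle m P i, c i),
                                            (c i, P i)}
                   then 1 else 0)\<rparr>"

text \<open>
  The identification of an end vertex of \<open>G i\<close> with the spike vertex \<open>c i\<close> is carried out by
  letting \<open>G i\<close> and the skeleton live on vertex sets meeting exactly in \<open>c i\<close>; thus \<open>c i\<close> also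
  denotes the vertex \<open>v\<^sub>i\<close> of \<open>G i\<close>. The glued quiver has the union of the vertex
  sets and the disjoint union of the arrows.
\<close>

definition type_IV_full ::
  "'v quiver \<Rightarrow> nat \<Rightarrow> (nat \<Rightarrow> 'v) \<Rightarrow> (nat \<Rightarrow> 'v) \<Rightarrow> (nat \<Rightarrow> 'v quiver) \<Rightarrow> bool" where
  "type_IV_full \<Gamma> m P c G \<longleftrightarrow>
     m \<ge> 3 \<and>
     inj_on P {1..m} \<and> inj_on c {1..m} \<and> P ` {1..m} \<inter> c ` {1..m} = {} \<and>
     (\<forall>i\<in>{1..m}. mutation_type_A (card (verts (G i))) (G i) \<and> end_vertex (G i) (c i)) \<and>
     (\<forall>i\<in>{1..m}. verts (G i) \<inter> verts (skeleton m P c) = {c i}) \<and>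
     (\<forall>i\<in>{1..m}. \<forall>j\<in>{1..m}. i \<noteq> j \<longrightarrow> verts (G i) \<inter> verts (G j) = {}) \<and>
     \<Gamma> = \<lparr>verts = verts (skeleton m P c) \<union> (\<Union>i\<in>{1..m}. verts (G i)),
          arr = (\<lambda>x y. arr (skeleton m P c) x y + (\<Sum>i=1..m. arr (G i) x y))\<rparr>"

text \<open>The label \<open>p\<^sub>i\<close> of the \<open>i\<close>-th vertex of the central cycle, where \<open>a j\<close> is
  the number of vertices of the \<open>j\<close>-th type A piece.\<close>

definition central_label :: "(nat \<Rightarrow> nat) \<Rightarrow> nat \<Rightarrow> nat" where
  "central_label a i = (\<Sum>j=1..<i. a j) + i"

definition labelling_IV_full ::
  "nat \<Rightarrow> (nat \<Rightarrow> 'v) \<Rightarrow> (nat \<Rightarrow> 'v) \<Rightarrow> (nat \<Rightarrow> 'v quiver) \<Rightarrow> ('v \<Rightarrow> nat) \<Rightarrow> bool" where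
  "labelling_IV_full m P c G L \<longleftrightarrow>
     (\<forall>i\<in>{1..m}. L (P i) = central_label (\<lambda>j. card (verts (G j))) i) \<and>
     (\<forall>i\<in>{1..m}. \<exists>e L'.
        end_vertex (G i) e \<and> (card (verts (G i)) > 1 \<longrightarrow> e \<noteq> c i) \<and>
        labelling_A (G i) e (c i) L' \<and>
        (\<forall>x\<in>verts (G i). L x = L' x + central_label (\<lambda>j. card (verts (G j))) i))"

text \<open>
  \<open>i\<close> is (the label of) a primary vertex and \<open>j\<close> is (the label of) the complementary vertex
  corresponding to it.
\<close>

definition complementary_to ::
  "nat \<Rightarrow> (nat \<Rightarrow> 'v quiver) \<Rightarrow> ('v \<Rightarrow> nat) \<Rightarrow> nat \<Rightarrow> nat \<Rightarrow> bool" where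
  "complementary_to m G L i j \<longleftrightarrow>
     (\<exists>t\<in>{1..m}. \<exists>x y z. three_cycle (G t) x y z \<and>
        L x = i \<and> L y = j \<and> i < j \<and> j < L z)"


definition root_system :: "'a::euclidean_space set \<Rightarrow> bool" where
  "root_system \<Phi> \<longleftrightarrow>
     finite \<Phi> \<and> 0 \<notin> \<Phi> \<and> span \<Phi> = UNIV \<and>
     (\<forall>a\<in>\<Phi>. \<forall>c. c *\<^sub>R a \<in> \<Phi> \<longrightarrow> c = 1 \<or> c = -1) \<and>
     (\<forall>a\<in>\<Phi>. \<forall>b\<in>\<Phi>. b - (2 * (b \<bullet> a) / (a \<bullet> a)) *\<^sub>R a \<in> \<Phi>) \<and>
     (\<forall>a\<in>\<Phi>. \<forall>b\<in>\<Phi>. 2 * (b \<bullet> a) / (a \<bullet> a) \<in> \<int>)"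

definition simple_system :: "'a::euclidean_space set \<Rightarrow> 'a set \<Rightarrow> bool" where
  "simple_system \<Phi> S \<longleftrightarrow>
     S \<subseteq> \<Phi> \<and> independent S \<and> span S = UNIV \<and>
     (\<forall>b\<in>\<Phi>. \<exists>k :: 'a \<Rightarrow> nat.
        b = (\<Sum>a\<in>S. real (k a) *\<^sub>R a) \<or> b = - (\<Sum>a\<in>S. real (k a) *\<^sub>R a))"

text \<open>
  \<open>\<Phi>\<close> is the root system of type \<open>D\<^sub>n\<close>, all roots having square length 2, with simple
  roots \<open>\<alpha> 1, \<dots>, \<alpha> n\<close> numbered as in \<^const>\<open>dynkin_D\<close>.
\<close>

definition root_system_D :: "nat \<Rightarrow> 'a::euclidean_space set \<Rightarrow> (nat \<Rightarrow> 'a) \<Rightarrow> bool" where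
  "root_system_D n \<Phi> \<alpha> \<longleftrightarrow>
     root_system \<Phi> \<and> (\<forall>a\<in>\<Phi>. a \<bullet> a = 2) \<and>
     inj_on \<alpha> {1..n} \<and> simple_system \<Phi> (\<alpha> ` {1..n}) \<and>
     (\<forall>i\<in>{1..n}. \<forall>j\<in>{1..n}. i \<noteq> j \<longrightarrow> \<alpha> i \<bullet> \<alpha> j = (if dynkin_D n i j then -1 else 0))"

definition zscale :: "int \<Rightarrow> 'a::real_vector \<Rightarrow> 'a" where
  "zscale k x = real_of_int k *\<^sub>R x"

interpretation zmod: module zscale
  by unfold_locales (simp_all add: zscale_def algebra_simps)

definition lattice_basis :: "'a::real_vector set \<Rightarrow> 'v set \<Rightarrow> ('v \<Rightarrow> 'a) \<Rightarrow> bool" where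
  "lattice_basis \<Lambda> I \<gamma> \<longleftrightarrow>
     inj_on \<gamma> I \<and> zmod.independent (\<gamma> ` I) \<and> zmod.span (\<gamma> ` I) = \<Lambda>"

definition companion_basis ::
  "'a::euclidean_space set \<Rightarrow> 'v quiver \<Rightarrow> ('v \<Rightarrow> 'a) \<Rightarrow> bool" where
  "companion_basis \<Phi> Q \<gamma> \<longleftrightarrow>
     (\<forall>x\<in>verts Q. \<gamma> x \<in> \<Phi>) \<and>
     lattice_basis (zmod.span \<Phi>) (verts Q) \<gamma> \<and>
     (\<forall>x\<in>verts Q. \<forall>y\<in>verts Q. x \<noteq> y \<longrightarrow> \<bar>\<gamma> x \<bullet> \<gamma> y\<bar> = real (edges Q x y))"

text \<open>
  The roots \<open>\<beta>\<^sub>i\<close>, where \<open>a j\<close> is the number of vertices of the \<open>j\<close>-th type A piece, \<open>r = m\<close>,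
  and \<open>C i j\<close> says that \<open>i\<close> is primary with complementary vertex \<open>j\<close>. For labels produced by
  the labelling procedure both descriptions are of unique objects and the cases are disjoint.
\<close>

definition beta ::
  "nat \<Rightarrow> (nat \<Rightarrow> 'a::real_vector) \<Rightarrow> nat \<Rightarrow> (nat \<Rightarrow> nat) \<Rightarrow> (nat \<Rightarrow> nat \<Rightarrow> bool) \<Rightarrow> nat \<Rightarrow> 'a"
where
  "beta n \<alpha> r a C i =
     (if \<exists>j. C i j then \<Sum>k = i..(THE j. C i j). \<alpha> k
      else if \<exists>j\<in>{1..r-1}. i = central_label a j
        then \<Sum>k = i..i + a (THE j. j \<in> {1..r-1} \<and> i = central_label a j). \<alpha> k
      else if i = central_label a r
        then (\<Sum>k = 1..i-1. \<alpha> k) + (\<Sum>k = i..n-2. 2 *\<^sub>R \<alpha> k) + \<alpha> (n-1) + \<alpha> n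
      else if i = n then (\<Sum>k = 1..n-2. \<alpha> k) + \<alpha> n
      else \<alpha> i)"

end

theory Submission
  imports Defs "HOL-Library.Tree"
begin

text \<open>
  Write the simple roots of type \<open>D\<^sub>n\<close> as \<open>\<alpha> i = e i - e (i + 1)\<close> for \<open>i < n\<close> and
  \<open>\<alpha> n = e (n - 1) + e n\<close> with \<open>e 1, \<dots>, e n\<close> orthonormal, and put \<open>e (n + 1) = - e 1\<close>, so that
  the indices wrap around just as the central cycle does. Then every \<open>\<beta> i\<close> has the form
  \<open>e i - e (\<sigma> i)\<close> with \<open>\<sigma> i > i\<close>: \<open>\<sigma>\<close> sends a primary vertex to the corresponding secondary
  vertex, each \<open>p\<^sub>j\<close> to \<open>p\<^sub>j\<^sub>+\<^sub>1\<close> (where \<open>p\<^sub>m\<^sub>+\<^sub>1 = n + 1\<close>), and any other \<open>i\<close> to \<open>i + 1\<close>.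
  Triangularity of \<open>\<sigma>\<close> gives the lattice basis, and two of these roots are non-orthogonal exactly if
  \<open>\<sigma>\<close> maps one label to the other or both labels to the same one (modulo the wrap-around). The
  labelling procedure is designed so that this is adjacency in the quiver: an edge \<open>i < j\<close>
  either has \<open>j = \<sigma> i\<close>, or is completed by \<open>\<sigma> i = \<sigma> j\<close> to a 3-cycle.

  To analyse the labelling procedure, quivers of mutation type A are represented by binary trees, the
  dual trees of triangulations of a polygon: the roots of the two subtrees of a node \<open>x\<close> span a
  3-cycle \<open>x \<rightarrow> left \<rightarrow> right \<rightarrow> x\<close> (an arrow, if one of the subtrees is empty), and mutation is
  the flip of a diagonal. An end vertex can be taken as the root of the tree, and the strings starting
  there are the descending paths.
\<close>

section \<open>Quivers of mutation type A as pairs of trees\<close>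

text \<open>A set with at most one element, so that the products in \<open>node_arrows\<close>
  vanish for an empty subtree: the 3-cycle at a node degenerates to an arrow or to nothing without
  case distinctions.\<close>

fun root_set :: "'v tree \<Rightarrow> 'v set" where
  "root_set Leaf = {}"
| "root_set (Node l x r) = {x}"

definition node_arrows :: "'v \<Rightarrow> 'v tree \<Rightarrow> 'v tree \<Rightarrow> ('v \<times> 'v) set" where
  "node_arrows x l r = {x} \<times> root_set l \<union> root_set l \<times> root_set r \<union> root_set r \<times> {x}"

fun tree_arrows :: "'v tree \<Rightarrow> ('v \<times> 'v) set" where
  "tree_arrows Leaf = {}"
| "tree_arrows (Node l x r) = node_arrows x l r \<union> tree_arrows l \<union> tree_arrows r"

definition quiver_of :: "'v set \<Rightarrow> ('v \<times> 'v) set \<Rightarrow> 'v quiver" where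
  "quiver_of V A = \<lparr>verts = V, arr = (\<lambda>x y. of_bool ((x, y) \<in> A))\<rparr>"

definition tree_quiver :: "'v tree \<Rightarrow> 'v quiver" where
  "tree_quiver t = quiver_of (set_tree t) (tree_arrows t)"

abbreviation distinct_tree :: "'v tree \<Rightarrow> bool" where
  "distinct_tree t \<equiv> distinct (inorder t)"

text \<open>
  A quiver seen from a vertex \<open>x\<close> inside it: two trees with root \<open>x\<close> glued at \<open>x\<close>. Going around
  \<open>x\<close>, the four subtrees are met in the cyclic order \<open>a, b, c, d\<close>, so that mutation at \<open>x\<close> shifts
  this order by one place.
\<close>

definition two_trees :: "'v quiver \<Rightarrow> 'v \<Rightarrow> 'v tree \<Rightarrow> 'v tree \<Rightarrow> 'v tree \<Rightarrow> 'v tree \<Rightarrow> bool" where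
  "two_trees Q x a b c d \<longleftrightarrow>
     distinct (x # inorder a @ inorder b @ inorder c @ inorder d) \<and>
     Q = quiver_of (insert x (set_tree a \<union> set_tree b \<union> set_tree c \<union> set_tree d))
           (tree_arrows (Node a x b) \<union> tree_arrows (Node c x d))"

definition type_A :: "'v quiver \<Rightarrow> bool" where
  "type_A Q \<longleftrightarrow> (\<exists>x a b c d. two_trees Q x a b c d)"

lemma quiver_of_simps [simp]:
  "verts (quiver_of V A) = V" "arr (quiver_of V A) x y = of_bool ((x, y) \<in> A)"
  by (simp_all add: quiver_of_def)

section \<open>Elementary facts about trees and their arrows\<close>

lemma quiver_eqI: "verts Q = verts Q' \<Longrightarrow> (\<And>x y. arr Q x y = arr Q' x y) \<Longrightarrow> (Q :: 'v quiver) = Q'"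
  by (cases Q; cases Q') (auto simp: fun_eq_iff)

lemma root_set_subset: "root_set t \<subseteq> set_tree t"
  by (cases t) auto

lemma root_set_in [dest]: "x \<in> root_set t \<Longrightarrow> x \<in> set_tree t"
  by (cases t) auto

lemma root_set_D: "x \<in> root_set t \<Longrightarrow> y \<in> root_set t \<Longrightarrow> x = y"
  by (cases t) auto

lemma tree_arrows_subset: "tree_arrows t \<subseteq> set_tree t \<times> set_tree t"
  by (induction t) (auto simp: node_arrows_def)

lemma tree_arrows_in: "(x, y) \<in> tree_arrows t \<Longrightarrow> x \<in> set_tree t \<and> y \<in> set_tree t"
  using tree_arrows_subset[of t] by auto

text \<open>Arrows contributed by different nodes join different pairs of vertices. Taking
  \<open>x = y\<close>, loops are excluded as well.\<close>

lemma tree_arrows_antisym: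
  "distinct_tree t \<Longrightarrow> (x, y) \<in> tree_arrows t \<Longrightarrow> (y, x) \<notin> tree_arrows t"
proof (induction t)
  case (Node l a r)
  have D: "a \<notin> set_tree l" "a \<notin> set_tree r" "set_tree l \<inter> set_tree r = {}"
    and IH: "(x, y) \<in> tree_arrows l \<Longrightarrow> (y, x) \<notin> tree_arrows l"
    "(x, y) \<in> tree_arrows r \<Longrightarrow> (y, x) \<notin> tree_arrows r"
    using Node by auto
  show ?case
    using Node.prems(2) D IH root_set_in[of x l] root_set_in[of x r] root_set_in[of y l] root_set_in[of y r]
      tree_arrows_in[of x y l] tree_arrows_in[of x y r] tree_arrows_in[of y x l] tree_arrows_in[of y x r]
    by (auto simp: node_arrows_def)
qed auto

section \<open>Changing the vertex from which a quiver is seen\<close>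

lemma two_trees_swap: "two_trees Q x a b c d \<Longrightarrow> two_trees Q x c d a b"
  unfolding two_trees_def by (auto simp: Un_ac)

text \<open>The 3-cycle through \<open>x\<close>, \<open>y\<close> and the root of \<open>b\<close>
  can be started at \<open>y\<close>, where its other two vertices are the roots of \<open>b\<close>
  and of \<open>Node c x d\<close>. The arrows stay the same; only the grouping into trees
  changes.\<close>

lemma two_trees_left:
  "two_trees Q x (Node a1 y a2) b c d \<Longrightarrow> two_trees Q y a1 a2 b (Node c x d)"
  unfolding two_trees_def
  by (auto simp: node_arrows_def intro!: arg_cong2[where f = quiver_of])

lemma two_trees_right:
  "two_trees Q x a (Node b1 y b2) c d \<Longrightarrow> two_trees Q y b1 b2 (Node c x d) a"
  unfolding two_trees_def
  by (auto simp: node_arrows_def intro!: arg_cong2[where f = quiver_of])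

text \<open>Re-rooting is repeated on the way down to \<open>y\<close>. The pair
  \<open>(c', d')\<close> is not empty because it holds the side from which \<open>y\<close> was
  reached; this later forces an end vertex below the root to be childless.\<close>

lemma two_trees_subtree:
  assumes "Node l y r \<in> subtrees t"
    and "two_trees Q x t b c d \<or> two_trees Q x b t c d"
  shows "\<exists>c' d'. two_trees Q y l r c' d' \<and> (c', d') \<noteq> (Leaf, Leaf)"
  using assms
proof (induction t arbitrary: x b c d)
  case (Node t1 z t2)
  obtain c' d' where **: "two_trees Q z t1 t2 c' d'" "(c', d') \<noteq> (Leaf, Leaf)"
    using Node.prems(2) by (auto dest: two_trees_left two_trees_right)
  show ?case
  proof (cases "Node l y r = Node t1 z t2")
    case True
    then show ?thesis using ** by auto
  next
    case False
    then have "Node l y r \<in> subtrees t1 \<or> Node l y r \<in> subtrees t2" using Node.prems by auto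
    then show ?thesis using Node.IH **(1) by blast
  qed
qed auto

lemma two_trees_at:
  assumes "type_A Q" "y \<in> verts Q"
  shows "\<exists>a b c d. two_trees Q y a b c d"
proof -
  obtain x a b c d where *: "two_trees Q x a b c d" using assms by (auto simp: type_A_def)
  then have "y = x \<or> y \<in> set_tree a \<or> y \<in> set_tree b \<or> y \<in> set_tree c \<or> y \<in> set_tree d"
    using assms(2) by (auto simp: two_trees_def)
  then show ?thesis
    using * two_trees_swap[OF *] by (metis set_treeE two_trees_subtree)
qed

text \<open>The arrows at \<open>x\<close> lead to the roots of \<open>a\<close>, \<open>c\<close>
  and come from those of \<open>b\<close>, \<open>d\<close>. So mutation reverses them, the new
  arrows from \<open>b\<close> to \<open>a\<close> and from \<open>d\<close> to \<open>c\<close>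
  cancel the old ones from \<open>a\<close> to \<open>b\<close> and from \<open>c\<close> to
  \<open>d\<close>, and those from \<open>b\<close> to \<open>c\<close> and from \<open>d\<close> to
  \<open>a\<close> survive. This is the same picture with the four subtrees rotated.\<close>

lemma mutate_two_trees:
  assumes "two_trees Q x a b c d"
  shows "two_trees (mutate x Q) x b c d a"
proof -
  let ?A = "tree_arrows (Node a x b) \<union> tree_arrows (Node c x d)"
  let ?B = "tree_arrows (Node b x c) \<union> tree_arrows (Node d x a)"
  \<comment> \<open>The arrows inside the four subtrees, which are left alone by the
    mutation.\<close>
  define R where "R = tree_arrows a \<union> tree_arrows b \<union> tree_arrows c \<union> tree_arrows d"
  have D: "x \<notin> set_tree a" "x \<notin> set_tree b" "x \<notin> set_tree c" "x \<notin> set_tree d"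
    "set_tree a \<inter> set_tree b = {}" "set_tree a \<inter> set_tree c = {}" "set_tree a \<inter> set_tree d = {}"
    "set_tree b \<inter> set_tree c = {}" "set_tree b \<inter> set_tree d = {}" "set_tree c \<inter> set_tree d = {}"
    "distinct_tree a" "distinct_tree b" "distinct_tree c" "distinct_tree d"
    using assms by (auto simp: two_trees_def)
  have Q: "Q = quiver_of (insert x (set_tree a \<union> set_tree b \<union> set_tree c \<union> set_tree d)) ?A"
    using assms by (auto simp: two_trees_def)
  have same: "s = t" if "s \<in> {a,b,c,d}" "t \<in> {a,b,c,d}" "i \<in> set_tree s" "i \<in> set_tree t" for s t i
    using that(1,2)
    using that(3,4) D(5-10) by (elim insertE emptyE) auto
  have Rin: "\<exists>t\<in>{a,b,c,d}. (i, j) \<in> tree_arrows t" if "(i, j) \<in> R" for i j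
    using that unfolding R_def by blast
  have Ranti: "(j, i) \<notin> R" if ij: "(i, j) \<in> R" for i j
  proof
    assume ji: "(j, i) \<in> R"
    obtain s t where st: "s \<in> {a,b,c,d}" "t \<in> {a,b,c,d}" "(i, j) \<in> tree_arrows s" "(j, i) \<in> tree_arrows t"
      using Rin[OF ij] Rin[OF ji] by blast
    from st have "s = t"
      using same[OF st(1,2)] tree_arrows_in[OF st(3)] tree_arrows_in[OF st(4)] by blast
    moreover have "distinct_tree s" using st(1) D(11-14) by auto
    ultimately show False using tree_arrows_antisym[of s i j] st(3,4) by simp
  qed
  have rx: "x \<notin> root_set a" "x \<notin> root_set b" "x \<notin> root_set c" "x \<notin> root_set d"
    using D(1-4) root_set_in by fast+
  have xR: "(x, v) \<notin> tree_arrows t" "(v, x) \<notin> tree_arrows t" if "t \<in> {a, b, c, d}" for t v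
    using that D(1-4) tree_arrows_in[of x v t] tree_arrows_in[of v x t] by auto
  have key: "arr (mutate x Q) i j = of_bool ((i, j) \<in> ?B)" for i j
  proof (cases "i = x \<or> j = x")
    case True
    have "(j, i) \<in> ?A \<longleftrightarrow> (i, j) \<in> ?B"
      using True
    proof
      assume [simp]: "i = x"
      show ?thesis using rx xR by (simp add: node_arrows_def; blast?)
    next
      assume [simp]: "j = x"
      show ?thesis using rx xR by (simp add: node_arrows_def; blast?)
    qed
    moreover have "arr (mutate x Q) i j = of_bool ((j, i) \<in> ?A)"
      using True unfolding Q mutate_def by (simp del: tree_arrows.simps)
    ultimately show ?thesis by (simp only:)
  next
    case False
    then have nx: "i \<noteq> x" "j \<noteq> x" by auto
    have A: "(u, v) \<in> ?A \<longleftrightarrow> (u, v) \<in> R \<or> u \<in> root_set a \<and> v \<in> root_set b \<or> u \<in> root_set c \<and> v \<in> root_set d"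
      and B: "(u, v) \<in> ?B \<longleftrightarrow> (u, v) \<in> R \<or> u \<in> root_set b \<and> v \<in> root_set c \<or> u \<in> root_set d \<and> v \<in> root_set a"
      if "u \<noteq> x" "v \<noteq> x" for u v
      using that by (simp_all add: node_arrows_def R_def) blast+
    have X: "(u, x) \<in> ?A \<longleftrightarrow> u \<in> root_set b \<union> root_set d"
            "(x, u) \<in> ?A \<longleftrightarrow> u \<in> root_set a \<union> root_set c" if "u \<noteq> x" for u
      using that rx xR by (simp_all add: node_arrows_def)
    have dis: "(i, j) \<notin> R \<and> (j, i) \<notin> R"
      if st: "s \<in> {a,b,c,d}" "t \<in> {a,b,c,d}" "set_tree s \<inter> set_tree t = {}" "i \<in> root_set s" "j \<in> root_set t" for s t
    proof -
      have ij: "i \<in> set_tree s" "j \<in> set_tree t" using st by auto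
      have False if u: "u \<in> {a,b,c,d}" "i \<in> set_tree u" "j \<in> set_tree u" for u
        using same[OF u(1) st(1) u(2) ij(1)] same[OF u(1) st(2) u(3) ij(2)] st(3) u(2) by simp
      then show ?thesis using Rin[of i j] Rin[of j i] tree_arrows_in[of i j] tree_arrows_in[of j i] by metis
    qed
    have dr: "root_set a \<inter> root_set b = {}" "root_set a \<inter> root_set c = {}" "root_set a \<inter> root_set d = {}"
      "root_set b \<inter> root_set c = {}" "root_set b \<inter> root_set d = {}" "root_set c \<inter> root_set d = {}"
      using D(5-10) root_set_subset[of a] root_set_subset[of b] root_set_subset[of c] root_set_subset[of d]
      by blast+
    have e: "arr (mutate x Q) i j = of_bool ((i,j) \<in> ?A) + of_bool ((i,x) \<in> ?A) * of_bool ((x,j) \<in> ?A)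
       - (of_bool ((j,i) \<in> ?A) + of_bool ((j,x) \<in> ?A) * of_bool ((x,i) \<in> ?A))"
      using False unfolding Q mutate_def by (simp del: tree_arrows.simps)
    show ?thesis
    \<comment> \<open>If \<open>i\<close> and \<open>j\<close> are joined inside one subtree, they
      are not roots of two different subtrees. Then no path through \<open>x\<close> joins them, and
      nothing is added or cancelled.\<close>
    proof (cases "(i, j) \<in> R \<or> (j, i) \<in> R")
      case True
      have nn': "\<not> (i \<in> root_set s \<and> j \<in> root_set t)"
        if "s \<in> {a,b,c,d}" "t \<in> {a,b,c,d}" "set_tree s \<inter> set_tree t = {}" for s t
        using dis[OF that] True by blast
      have nn: "\<not> (i \<in> root_set a \<and> j \<in> root_set b)" "\<not> (i \<in> root_set b \<and> j \<in> root_set a)"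
        "\<not> (i \<in> root_set a \<and> j \<in> root_set d)" "\<not> (i \<in> root_set d \<and> j \<in> root_set a)"
        "\<not> (i \<in> root_set b \<and> j \<in> root_set c)" "\<not> (i \<in> root_set c \<and> j \<in> root_set b)"
        "\<not> (i \<in> root_set c \<and> j \<in> root_set d)" "\<not> (i \<in> root_set d \<and> j \<in> root_set c)"
        by (rule nn'; use D(5-10) in \<open>simp; fail | blast\<close>)+
      have nn1: "((i, j) \<in> R \<or> i \<in> root_set a \<and> j \<in> root_set b \<or> i \<in> root_set c \<and> j \<in> root_set d) = ((i, j) \<in> R)"
        "((j, i) \<in> R \<or> j \<in> root_set a \<and> i \<in> root_set b \<or> j \<in> root_set c \<and> i \<in> root_set d) = ((j, i) \<in> R)"
        "((i, j) \<in> R \<or> i \<in> root_set b \<and> j \<in> root_set c \<or> i \<in> root_set d \<and> j \<in> root_set a) = ((i, j) \<in> R)"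
        using nn by blast+
      have nn2: "((i \<in> root_set b \<or> i \<in> root_set d) \<and> (j \<in> root_set a \<or> j \<in> root_set c)) = False"
        "((j \<in> root_set b \<or> j \<in> root_set d) \<and> (i \<in> root_set a \<or> i \<in> root_set c)) = False"
        using nn by blast+
      show ?thesis
        unfolding e A[OF nx] A[OF nx(2,1)] B[OF nx] X[OF nx(1)] X[OF nx(2)]
        unfolding Un_iff nn1 of_bool_conj[symmetric] nn2 using Ranti[of i j] True by auto
    next
      case F: False
      \<comment> \<open>Each of \<open>i\<close> and \<open>j\<close> is the root of at most one of
        the four subtrees, so the truncated subtraction in \<open>mutate\<close> becomes a finite
        truth table.\<close>
      have excl: "of_bool (ia \<and> jb \<or> ic \<and> jd) + of_bool (ib \<or> id) * of_bool (ja \<or> jc)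
          - (of_bool (ja \<and> ib \<or> jc \<and> id) + of_bool (jb \<or> jd) * of_bool (ia \<or> ic))
          = (of_bool (ib \<and> jc \<or> id \<and> ja) :: nat)"
        if "\<not> (ia \<and> ib)" "\<not> (ia \<and> ic)" "\<not> (ia \<and> id)" "\<not> (ib \<and> ic)" "\<not> (ib \<and> id)" "\<not> (ic \<and> id)"
          "\<not> (ja \<and> jb)" "\<not> (ja \<and> jc)" "\<not> (ja \<and> jd)" "\<not> (jb \<and> jc)" "\<not> (jb \<and> jd)" "\<not> (jc \<and> jd)"
        for ia ib ic id ja jb jc jd
        using that by (cases ia; cases ib; cases ic; cases id; simp; cases ja; cases jb; cases jc; cases jd; simp)
      have n: "(i, j) \<notin> R" "(j, i) \<notin> R" using F by auto
      show ?thesis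
        unfolding e A[OF nx] A[OF nx(2,1)] B[OF nx] X[OF nx(1)] X[OF nx(2)]
        unfolding Un_iff
        by (simp only: n simp_thms, rule excl) (use dr in blast)+
    qed
  qed
  have "mutate x Q = quiver_of (insert x (set_tree b \<union> set_tree c \<union> set_tree d \<union> set_tree a)) ?B"
    by (rule quiver_eqI) (simp_all add: key del: tree_arrows.simps, auto simp: mutate_def Q)
  moreover have "distinct (x # inorder b @ inorder c @ inorder d @ inorder a)"
    using assms by (auto simp: two_trees_def)
  ultimately show ?thesis unfolding two_trees_def by blast
qed

section \<open>From mutation type A to trees\<close>

lemma type_A_mutation_steps:
  assumes "mutation_step\<^sup>*\<^sup>* Q Q'" "type_A Q"
  shows "type_A Q'"
  using assms
proof (induction rule: rtranclp_induct)
  case (step Q1 Q2)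
  then show ?case
    using two_trees_at mutate_two_trees unfolding mutation_step_def by (metis type_A_def)
qed

text \<open>An oriented path is a tree in which every node has at most one child: a left child if
  the arrow leaves the node, a right child if it enters it.\<close>

lemma path_type_A:
  assumes "is_quiver Q" "has_underlying_graph Q k dynkin_A" "k \<ge> 1"
  shows "type_A Q"
proof -
  obtain \<sigma> where \<sigma>: "bij_betw \<sigma> {1..k} (verts Q)"
    "\<And>i j. i \<in> {1..k} \<Longrightarrow> j \<in> {1..k} \<Longrightarrow> edges Q (\<sigma> i) (\<sigma> j) = (if dynkin_A i j then 1 else 0)"
    using assms(2) unfolding has_underlying_graph_def by auto
  have inj: "\<sigma> i = \<sigma> j \<longleftrightarrow> i = j" if "i \<in> {1..k}" "j \<in> {1..k}" for i j
    using inj_on_eq_iff[OF bij_betw_imp_inj_on[OF \<sigma>(1)] that] .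
  \<comment> \<open>The tree is built from the far end \<open>k\<close> of the path downwards, each
    new vertex becoming the root.\<close>
  have "\<exists>t. root_set t = {\<sigma> i} \<and> distinct_tree t \<and> set_tree t = \<sigma> ` {i..k} \<and>
      tree_arrows t = {(u, v). u \<in> \<sigma> ` {i..k} \<and> v \<in> \<sigma> ` {i..k} \<and> arr Q u v > 0}"
    if "i \<in> {1..k}" for i
    using that
  proof (induction "k - i" arbitrary: i)
    case 0
    then have "i = k" by auto
    with assms(1) show ?case
      by (intro exI[of _ "Node Leaf (\<sigma> k) Leaf"]) (auto simp: node_arrows_def is_quiver_def)
  next
    case (Suc n)
    define W where "W = \<sigma> ` {Suc i..k}"
    have "n = k - Suc i" "Suc i \<in> {1..k}" using Suc.hyps(2) Suc.prems by simp_all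
    from Suc.hyps(1)[OF this] obtain t where t: "root_set t = {\<sigma> (Suc i)}" "distinct_tree t" "set_tree t = W"
      "tree_arrows t = {(u, v). u \<in> W \<and> v \<in> W \<and> arr Q u v > 0}"
      unfolding W_def by blast
    have "{i..k} = insert i {Suc i..k}" using Suc.prems by auto
    then have iv: "\<sigma> ` {i..k} = insert (\<sigma> i) W" by (simp add: W_def)
    have n: "\<sigma> i \<notin> W" unfolding W_def using Suc.prems inj by (auto simp: image_iff)
    have ed: "edges Q (\<sigma> i) (\<sigma> (Suc i)) = 1"
      using \<sigma>(2)[of i "Suc i"] Suc.hyps(2) Suc.prems by (auto simp: dynkin_A_def)
    have ne: "arr Q (\<sigma> i) v = 0 \<and> arr Q v (\<sigma> i) = 0" if v: "v \<in> W" "v \<noteq> \<sigma> (Suc i)" for v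
    proof -
      obtain j where "j \<in> {Suc i..k}" "v = \<sigma> j" "j \<noteq> Suc i" using v unfolding W_def by blast
      then show ?thesis using \<sigma>(2)[of i j] Suc.prems by (auto simp: dynkin_A_def edges_def)
    qed
    have ii: "arr Q (\<sigma> i) (\<sigma> i) = 0" using assms(1) by (auto simp: is_quiver_def)
    have si: "\<sigma> (Suc i) \<in> W" unfolding W_def using Suc.hyps(2) by auto
    show ?case
    proof (cases "arr Q (\<sigma> i) (\<sigma> (Suc i)) > 0")
      case True
      then have "arr Q (\<sigma> (Suc i)) (\<sigma> i) = 0" using ed by (auto simp: edges_def)
      then have "arr Q v (\<sigma> i) = 0" "arr Q (\<sigma> i) v > 0 \<longleftrightarrow> v = \<sigma> (Suc i)" if "v \<in> W" for v
        using ne[OF that] True by (cases "v = \<sigma> (Suc i)"; simp)+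
      then have "tree_arrows (Node t (\<sigma> i) Leaf) =
          {(u, v). u \<in> insert (\<sigma> i) W \<and> v \<in> insert (\<sigma> i) W \<and> arr Q u v > 0}"
        using si ii by (auto simp: node_arrows_def t)
      then show ?thesis unfolding iv using t n
        by (intro exI[of _ "Node t (\<sigma> i) Leaf"]) auto
    next
      case False
      then have "arr Q (\<sigma> (Suc i)) (\<sigma> i) > 0" using ed by (auto simp: edges_def)
      then have "arr Q (\<sigma> i) v = 0" "arr Q v (\<sigma> i) > 0 \<longleftrightarrow> v = \<sigma> (Suc i)" if "v \<in> W" for v
        using ne[OF that] False by (cases "v = \<sigma> (Suc i)"; simp)+
      then have "tree_arrows (Node Leaf (\<sigma> i) t) =
          {(u, v). u \<in> insert (\<sigma> i) W \<and> v \<in> insert (\<sigma> i) W \<and> arr Q u v > 0}"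
        using si ii by (auto simp: node_arrows_def t)
      then show ?thesis unfolding iv using t n
        by (intro exI[of _ "Node Leaf (\<sigma> i) t"]) auto
    qed
  qed
  from this[of 1] assms(3) obtain t where t: "root_set t = {\<sigma> 1}" "distinct_tree t" "set_tree t = verts Q"
      "tree_arrows t = {(u, v). u \<in> verts Q \<and> v \<in> verts Q \<and> arr Q u v > 0}"
    using \<sigma>(1) by (auto simp: bij_betw_def)
  \<comment> \<open>\<open>tree_arrows\<close> is a set and cannot record multiplicities, so
    multiple arrows must be ruled out.\<close>
  have le: "arr Q u v \<le> 1" for u v
  proof (cases "arr Q u v = 0")
    case False
    then have "u \<in> \<sigma> ` {1..k}" "v \<in> \<sigma> ` {1..k}"
      using assms(1) \<sigma>(1) by (auto simp: is_quiver_def bij_betw_def)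
    then obtain i j where "i \<in> {1..k}" "j \<in> {1..k}" "u = \<sigma> i" "v = \<sigma> j" by auto
    then have "edges Q u v \<le> 1" using \<sigma>(2) by auto
    then show ?thesis by (simp add: edges_def)
  qed simp
  obtain l x r where lr: "t = Node l x r" using t(1) by (cases t) auto
  have "two_trees Q x l r Leaf Leaf"
    unfolding two_trees_def
  proof
    show "Q = quiver_of (insert x (set_tree l \<union> set_tree r \<union> set_tree Leaf \<union> set_tree Leaf))
     (tree_arrows \<langle>l, x, r\<rangle> \<union> tree_arrows \<langle>\<langle>\<rangle>, x, \<langle>\<rangle>\<rangle>)"
    proof -
      have "(u, v) \<in> tree_arrows t \<longleftrightarrow> arr Q u v > 0" for u v
        using assms(1) unfolding t(4) is_quiver_def by blast
      then have "arr Q u v = of_bool ((u, v) \<in> tree_arrows t)" for u v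
        using le[of u v] by (cases "arr Q u v") auto
      moreover have "tree_arrows t = tree_arrows \<langle>l, x, r\<rangle> \<union> tree_arrows \<langle>\<langle>\<rangle>, x, \<langle>\<rangle>\<rangle>"
        by (simp add: lr node_arrows_def)
      ultimately show ?thesis
        using t(3) by (intro quiver_eqI) (simp_all add: lr del: tree_arrows.simps)
    qed
  qed (use t(2) lr in auto)
  then show ?thesis unfolding type_A_def by blast
qed

lemma verts_mutation_steps: "mutation_step\<^sup>*\<^sup>* Q Q' \<Longrightarrow> verts Q' = verts Q"
proof (induction rule: rtranclp_induct)
  case (step y z)
  then obtain k where "z = mutate k y" unfolding mutation_step_def by blast
  with step.IH show ?case by (simp add: mutate_def)
qed simp

lemma mutation_type_verts:
  assumes "mutation_type n E Q"
  shows "finite (verts Q)" "card (verts Q) = n"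
proof -
  obtain Q0 \<sigma> where \<sigma>: "bij_betw \<sigma> {1..n} (verts Q0)" and steps: "mutation_step\<^sup>*\<^sup>* Q0 Q"
    using assms unfolding mutation_type_def has_underlying_graph_def by blast
  then show "finite (verts Q)" "card (verts Q) = n"
    using bij_betw_same_card[OF \<sigma>] bij_betw_finite[OF \<sigma>] verts_mutation_steps[OF steps] by auto
qed

lemma mutation_type_A_type_A:
  assumes "mutation_type_A k Q" "k \<ge> 1"
  shows "type_A Q"
proof -
  obtain Q0 where Q0: "is_quiver Q0" "has_underlying_graph Q0 k dynkin_A" "mutation_step\<^sup>*\<^sup>* Q0 Q"
    using assms(1) unfolding mutation_type_def by (elim exE conjE)
  show ?thesis by (rule type_A_mutation_steps[OF Q0(3) path_type_A[OF Q0(1,2) assms(2)]])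
qed

section \<open>Adjacency in the quiver of a tree\<close>

definition child :: "'v tree \<Rightarrow> 'v \<Rightarrow> 'v \<Rightarrow> bool" where
  "child t x y \<longleftrightarrow> (\<exists>l r. Node l x r \<in> subtrees t \<and> y \<in> root_set l \<union> root_set r)"

definition adjacent :: "'v tree \<Rightarrow> 'v \<Rightarrow> 'v \<Rightarrow> bool" where
  "adjacent t u v \<longleftrightarrow> (u, v) \<in> tree_arrows t \<or> (v, u) \<in> tree_arrows t"

lemma set_subtree: "s \<in> subtrees t \<Longrightarrow> set_tree s \<subseteq> set_tree t"
  by (induction t) auto

lemma distinct_subtree: "s \<in> subtrees t \<Longrightarrow> distinct_tree t \<Longrightarrow> distinct_tree s"
  by (induction t) auto

lemma subtrees_trans: "u \<in> subtrees s \<Longrightarrow> s \<in> subtrees t \<Longrightarrow> u \<in> subtrees t"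
  by (induction t) auto

lemma self_subtree: "t \<in> subtrees t"
  by (cases t) auto

lemma subtree_children:
  "Node l x r \<in> subtrees t \<Longrightarrow> l \<in> subtrees t \<and> r \<in> subtrees t"
  by (induction t) (auto simp: self_subtree)

lemma subtree_unique:
  "distinct_tree t \<Longrightarrow> Node l x r \<in> subtrees t \<Longrightarrow> Node l' x r' \<in> subtrees t \<Longrightarrow> l = l' \<and> r = r'"
proof (induction t)
  case (Node t1 a t2)
  have D: "a \<notin> set_tree t1" "a \<notin> set_tree t2" "set_tree t1 \<inter> set_tree t2 = {}"
    using Node.prems(1) by auto
  consider "x = a" | "x \<noteq> a" "x \<in> set_tree t1" "x \<notin> set_tree t2" | "x \<noteq> a" "x \<notin> set_tree t1" "x \<in> set_tree t2"
    using in_set_tree_if[OF Node.prems(2)] D by auto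
  then show ?case
    using Node D by cases simp_all
qed auto

lemma subtree_below_root:
  assumes "distinct_tree t" "Node l x r \<in> subtrees t"
  shows "(set_tree l \<union> set_tree r) \<inter> root_set t = {}"
proof (cases t)
  case (Node t1 a t2)
  have D: "a \<notin> set_tree t1" "a \<notin> set_tree t2" using assms(1) Node by auto
  have "set_tree l \<union> set_tree r \<subseteq> set_tree t1 \<union> set_tree t2"
    using assms(2) Node set_subtree[of "Node l x r" t1] set_subtree[of "Node l x r" t2] by auto
  then show ?thesis using D Node by auto
qed (use assms in auto)

lemma parent_unique:
  "distinct_tree t \<Longrightarrow> child t x y \<Longrightarrow> child t x' y \<Longrightarrow> x = x'"
proof (induction t)
  case Leaf
  then show ?case by (simp add: child_def)
next
  case (Node t1 a t2)
  have D: "set_tree t1 \<inter> set_tree t2 = {}" "distinct_tree t1" "distinct_tree t2"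
    using Node.prems(1) by auto
  have c: "u = a \<and> (y \<in> root_set t1 \<or> y \<in> root_set t2) \<or> child t1 u y \<or> child t2 u y"
    if "child (Node t1 a t2) u y" for u
    using that unfolding child_def by auto
  have i: "y \<in> set_tree t \<and> y \<notin> root_set t" if c: "child t u y" and d: "distinct_tree t" for t u
  proof -
    obtain l r where lr: "Node l u r \<in> subtrees t" "y \<in> set_tree l \<union> set_tree r"
      using c unfolding child_def by auto
    then show ?thesis using subtree_below_root[OF d lr(1)] set_subtree[OF lr(1)] by auto
  qed
  show ?case
    using c[OF Node.prems(2)] c[OF Node.prems(3)] Node.IH D i[OF _ D(2)] i[OF _ D(3)]
      root_set_in[of y t1] root_set_in[of y t2] by blast
qed

text \<open>Subtrees are thus full subquivers. This is what allows the recursive calls of the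
  labelling procedure to be treated as calls on subtrees.\<close>

lemma tree_arrows_subtree:
  "distinct_tree t \<Longrightarrow> s \<in> subtrees t \<Longrightarrow> u \<in> set_tree s \<Longrightarrow> v \<in> set_tree s \<Longrightarrow>
    (u, v) \<in> tree_arrows t \<longleftrightarrow> (u, v) \<in> tree_arrows s"
proof (induction t)
  case (Node t1 a t2)
  have D: "a \<notin> set_tree t1" "a \<notin> set_tree t2" "set_tree t1 \<inter> set_tree t2 = {}"
    "distinct_tree t1" "distinct_tree t2"
    using Node.prems(1) by auto
  consider "s = Node t1 a t2" | "s \<in> subtrees t1" | "s \<in> subtrees t2" using Node.prems(2) by auto
  then show ?case
  proof cases
    case 2
    then have uv: "u \<in> set_tree t1" "v \<in> set_tree t1" using Node.prems set_subtree[OF 2] by auto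
    then have "(u, v) \<notin> node_arrows a t1 t2" "(u, v) \<notin> tree_arrows t2"
      using D(1,3) tree_arrows_in[of u v t2] root_set_in[of u t2] root_set_in[of v t2]
      unfolding node_arrows_def by auto
    then show ?thesis using Node.IH(1)[OF D(4) 2 Node.prems(3,4)] by simp
  next
    case 3
    then have uv: "u \<in> set_tree t2" "v \<in> set_tree t2" using Node.prems set_subtree[OF 3] by auto
    then have "(u, v) \<notin> node_arrows a t1 t2" "(u, v) \<notin> tree_arrows t1"
      using D(2,3) tree_arrows_in[of u v t1] root_set_in[of u t1] root_set_in[of v t1]
      unfolding node_arrows_def by auto
    then show ?thesis using Node.IH(2)[OF D(5) 3 Node.prems(3,4)] by simp
  qed simp
qed auto

lemma adjacent_Node:
  "adjacent (Node l x r) u v \<longleftrightarrow> (u, v) \<in> node_arrows x l r \<or> (v, u) \<in> node_arrows x l r \<or>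
     adjacent l u v \<or> adjacent r u v"
  by (auto simp: adjacent_def)

lemma adjacent_in: "adjacent t u v \<Longrightarrow> u \<in> set_tree t \<and> v \<in> set_tree t"
  using tree_arrows_in unfolding adjacent_def by metis

lemma adjacent_sym: "adjacent t u v \<Longrightarrow> adjacent t v u"
  by (auto simp: adjacent_def)

lemma adjacent_subtree:
  "distinct_tree t \<Longrightarrow> s \<in> subtrees t \<Longrightarrow> u \<in> set_tree s \<Longrightarrow> v \<in> set_tree s \<Longrightarrow>
    adjacent t u v \<longleftrightarrow> adjacent s u v"
  by (simp add: adjacent_def tree_arrows_subtree)

lemma edges_tree_quiver:
  "distinct_tree t \<Longrightarrow> edges (tree_quiver t) u v = of_bool (adjacent t u v)"
  using tree_arrows_antisym[of t u v] by (auto simp: edges_def tree_quiver_def adjacent_def)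

lemma node_arrows_in_subtree:
  "Node l x r \<in> subtrees t \<Longrightarrow> node_arrows x l r \<subseteq> tree_arrows t"
  by (induction t) auto

lemma child_adjacent: "child t x y \<Longrightarrow> adjacent t x y"
  using node_arrows_in_subtree unfolding child_def adjacent_def node_arrows_def by fast

text \<open>The sibling branch \<open>s'\<close> is carried along because it is the complementary
  side when a string descends into \<open>s\<close>. Left and right are not distinguished, since
  strings ignore orientation.\<close>

definition branch :: "'v tree \<Rightarrow> 'v \<Rightarrow> 'v tree \<Rightarrow> 'v tree \<Rightarrow> bool" where
  "branch t x s s' \<longleftrightarrow> Node s x s' \<in> subtrees t \<or> Node s' x s \<in> subtrees t"

lemma branch_sym: "branch t x s s' \<Longrightarrow> branch t x s' s"
  by (auto simp: branch_def)

lemma child_branch: "child t x y \<longleftrightarrow> (\<exists>s s'. branch t x s s' \<and> y \<in> root_set s)"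
  by (auto simp: child_def branch_def)

lemma branch_below_root:
  assumes "distinct_tree t" "branch t x s s'"
  shows "set_tree s \<inter> root_set t = {}" "set_tree s \<subseteq> set_tree t" "x \<in> set_tree t"
proof -
  consider "Node s x s' \<in> subtrees t" | "Node s' x s \<in> subtrees t"
    using assms(2) unfolding branch_def by blast
  then have "set_tree s \<inter> root_set t = {} \<and> set_tree s \<subseteq> set_tree t \<and> x \<in> set_tree t"
  proof cases
    case 1
    then show ?thesis using subtree_below_root[OF assms(1) 1] set_subtree[OF 1] by auto
  next
    case 2
    then show ?thesis using subtree_below_root[OF assms(1) 2] set_subtree[OF 2] by auto
  qed
  then show "set_tree s \<inter> root_set t = {}" "set_tree s \<subseteq> set_tree t" "x \<in> set_tree t" by auto
qed

lemma branch_subtree: "branch t x s s' \<Longrightarrow> s \<in> subtrees t"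
  using subtree_children[of s x s' t] subtree_children[of s' x s t] unfolding branch_def by auto

lemma branch_disjoint:
  assumes "distinct_tree t" "branch t x s s'"
  shows "x \<notin> set_tree s" "set_tree s \<inter> set_tree s' = {}" "distinct_tree s"
  using assms distinct_subtree[of "Node s x s'" t] distinct_subtree[of "Node s' x s" t]
  unfolding branch_def by auto

text \<open>A branch can be left only through its root, towards the parent or across the 3-cycle to
  the sibling. The analysis of strings, primary vertices and rooted subquivers rests on
  this.\<close>

lemma adjacent_leaving:
  "distinct_tree t \<Longrightarrow> branch t x s s' \<Longrightarrow> adjacent t u v \<Longrightarrow> u \<in> set_tree s \<Longrightarrow>
    v \<notin> set_tree s \<Longrightarrow> u \<in> root_set s \<and> (v = x \<or> v \<in> root_set s')"
proof (induction t)
  case (Node t1 a t2)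
  have D: "a \<notin> set_tree t1" "a \<notin> set_tree t2" "set_tree t1 \<inter> set_tree t2 = {}"
    "distinct_tree t1" "distinct_tree t2"
    using Node.prems(1) by auto
  consider "x = a" "s = t1" "s' = t2" | "x = a" "s = t2" "s' = t1" | "branch t1 x s s'" | "branch t2 x s s'"
    using Node.prems(2) unfolding branch_def by auto
  then show ?case
  proof cases
    case 1
    then show ?thesis
      using Node.prems(3-5) D adjacent_in[of t1 u v] adjacent_in[of t2 u v] root_set_in[of u t2]
      unfolding adjacent_Node node_arrows_def by auto
  next
    case 2
    then show ?thesis
      using Node.prems(3-5) D adjacent_in[of t1 u v] adjacent_in[of t2 u v] root_set_in[of u t1]
      unfolding adjacent_Node node_arrows_def by auto
  next
    case 3
    \<comment> \<open>Not being the root of \<open>t1\<close>, the vertex \<open>u\<close> is not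
      touched by the arrows at the top node \<open>a\<close>.\<close>
    have "u \<in> set_tree t1" "u \<notin> root_set t1"
      using Node.prems(4) branch_below_root[OF D(4) 3] by auto
    then have "adjacent t1 u v"
      using Node.prems(3) D adjacent_in[of t2 u v] root_set_in[of u t2]
      unfolding adjacent_Node node_arrows_def by auto
    then show ?thesis using Node.IH(1)[OF D(4) 3] Node.prems by simp
  next
    case 4
    have "u \<in> set_tree t2" "u \<notin> root_set t2"
      using Node.prems(4) branch_below_root[OF D(5) 4] by auto
    then have "adjacent t2 u v"
      using Node.prems(3) D adjacent_in[of t1 u v] root_set_in[of u t1]
      unfolding adjacent_Node node_arrows_def by auto
    then show ?thesis using Node.IH(2)[OF D(5) 4] Node.prems by simp
  qed
qed (auto simp: branch_def)

section \<open>Strings and 3-cycles in the quiver of a tree\<close>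

lemma branch_unique:
  assumes "distinct_tree t" "branch t x s s'" "branch t x u u'"
  shows "u = s \<and> u' = s' \<or> u = s' \<and> u' = s"
  using assms(2,3) subtree_unique[OF assms(1)] unfolding branch_def by metis

lemma root_not_Leaf: "y \<in> root_set t \<Longrightarrow> root_set t = {y}"
  by (cases t) auto

lemma child_below_root:
  assumes "distinct_tree t" "child t x y"
  shows "y \<in> set_tree t" "y \<notin> root_set t"
proof -
  obtain s s' where "branch t x s s'" "y \<in> root_set s" using assms(2) child_branch by metis
  then show "y \<in> set_tree t" "y \<notin> root_set t" using branch_below_root[OF assms(1)] by blast+
qed

lemma tree_arrows_cases:
  "(u, v) \<in> tree_arrows t \<Longrightarrow> \<exists>l x r. Node l x r \<in> subtrees t \<and> (u, v) \<in> node_arrows x l r"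
proof (induction t)
  case (Node t1 a t2)
  then consider "(u, v) \<in> node_arrows a t1 t2" | "(u, v) \<in> tree_arrows t1" | "(u, v) \<in> tree_arrows t2"
    by auto
  then show ?case
  proof cases
    case 1
    then show ?thesis by (meson self_subtree)
  next
    case 2
    then show ?thesis using Node.IH(1) by fastforce
  next
    case 3
    then show ?thesis using Node.IH(2) by fastforce
  qed
qed auto

lemma adjacent_cases:
  assumes "adjacent t u v"
  obtains "child t u v" | "child t v u" |
    x s s' where "branch t x s s'" "u \<in> root_set s" "v \<in> root_set s'"
proof -
  obtain l x r where lr: "Node l x r \<in> subtrees t" "(u, v) \<in> node_arrows x l r \<or> (v, u) \<in> node_arrows x l r"
    using assms tree_arrows_cases unfolding adjacent_def by metis
  then consider "u = x" "v \<in> root_set l \<union> root_set r" | "v = x" "u \<in> root_set l \<union> root_set r" |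
      "u \<in> root_set l" "v \<in> root_set r" | "v \<in> root_set l" "u \<in> root_set r"
    unfolding node_arrows_def by auto
  then show thesis
    using that lr(1) unfolding child_def branch_def by cases metis+
qed

lemma three_cycle_adjacent:
  assumes "three_cycle (tree_quiver t) u v w"
  shows "adjacent t u v" "adjacent t v w" "adjacent t u w"
  using assms by (auto simp: three_cycle_def tree_quiver_def adjacent_def)

lemma branch_three_cycle:
  assumes "branch t x s s'" "y \<in> root_set s" "z \<in> root_set s'"
  shows "three_cycle (tree_quiver t) x y z"
proof -
  have *: "three_cycle (tree_quiver t) x y z \<and> three_cycle (tree_quiver t) x z y"
    if "Node s x s' \<in> subtrees t" "y \<in> root_set s" "z \<in> root_set s'" for s s' y z
    using node_arrows_in_subtree[OF that(1)] that(2,3)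
    by (auto simp: three_cycle_def tree_quiver_def node_arrows_def)
  show ?thesis using assms *[of s s' y z] *[of s' s z y] unfolding branch_def by blast
qed

definition descending :: "'v tree \<Rightarrow> 'v list \<Rightarrow> bool" where
  "descending t p \<longleftrightarrow> (\<forall>i. i + 1 < length p \<longrightarrow> child t (p ! i) (p ! (i + 1)))"

text \<open>After a step down, returning to the parent is forbidden because strings are reduced, and
  crossing to the sibling is forbidden because it would use two arrows of one 3-cycle. Only a
  further step down remains.\<close>

lemma string_descending:
  assumes D: "distinct_tree t" and p: "string_in (tree_quiver t) p" and hd: "hd p \<in> root_set t"
  shows "descending t p"
  unfolding descending_def
proof (intro allI impI)
  fix i assume "i + 1 < length p"
  then show "child t (p ! i) (p ! (i + 1))"
  proof (induction i)
    case 0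
    have "adjacent t (p ! 0) (p ! 1)"
      using p 0 edges_tree_quiver[OF D, of "p ! 0" "p ! 1"] by (auto simp: string_in_def split: if_splits)
    moreover have "p ! 0 \<in> root_set t" using hd 0 by (cases p) auto
    \<comment> \<open>The root has no parent, and therefore no sibling either, so the first step
      must lead down.\<close>
    moreover have no: "\<not> child t x (p ! 0)" for x
      using child_below_root(2)[OF D] calculation(2) by blast
    ultimately show ?case
    proof (elim adjacent_cases)
      fix x s s' assume "branch t x s s'" "p ! 0 \<in> root_set s"
      then show ?thesis using no child_branch by metis
    qed auto
  next
    case (Suc i)
    then have c: "child t (p ! i) (p ! (i + 1))" by simp
    have "edges (tree_quiver t) (p ! (i + 1)) (p ! (i + 2)) > 0"
      using p Suc.prems unfolding string_in_def by (metis add.assoc add_Suc one_add_one plus_1_eq_Suc Suc_eq_plus1)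
    then have "adjacent t (p ! (i + 1)) (p ! (i + 2))"
      using edges_tree_quiver[OF D] by (simp split: if_splits)
    moreover have ne: "p ! i \<noteq> p ! (i + 2)" "\<not> three_cycle (tree_quiver t) (p ! i) (p ! (i + 1)) (p ! (i + 2))"
      using p Suc.prems unfolding string_in_def by auto
    ultimately show ?case
    proof (elim adjacent_cases)
      assume "child t (p ! (i + 2)) (p ! (i + 1))"
      then show ?thesis using parent_unique[OF D c] ne by simp
    next
      fix x s s' assume b: "branch t x s s'" "p ! (i + 1) \<in> root_set s" "p ! (i + 2) \<in> root_set s'"
      then have "x = p ! i" using parent_unique[OF D c] child_branch by metis
      then show ?thesis using branch_three_cycle[OF b] ne by simp
    qed simp
  qed
qed

lemma child_in_subtree:
  assumes D: "distinct_tree t" and "s \<in> subtrees t" "a \<in> set_tree s" "child t a b"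
  shows "b \<in> set_tree s"
proof -
  obtain l r where lr: "Node l a r \<in> subtrees s" using set_treeE[OF assms(3)] by blast
  obtain l' r' where lr': "Node l' a r' \<in> subtrees t" "b \<in> root_set l' \<union> root_set r'"
    using assms(4) unfolding child_def by blast
  have "l = l' \<and> r = r'" using subtree_unique[OF D subtrees_trans[OF lr assms(2)] lr'(1)] .
  then show ?thesis using set_subtree[OF lr] lr'(2) by auto
qed

lemma descending_in_subtree:
  assumes D: "distinct_tree t" and "descending t p" "s \<in> subtrees t" "p ! i \<in> set_tree s"
    and "i \<le> j" "j < length p"
  shows "p ! j \<in> set_tree s"
  using assms(5,6)
proof (induction j rule: dec_induct)
  case (step j)
  then have "child t (p ! j) (p ! (j + 1))" using assms(2) unfolding descending_def by simp
  then show ?case using child_in_subtree[OF D assms(3)] step by simp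
qed (use assms(4) in simp)

lemma descending_branch:
  assumes D: "distinct_tree t" and "descending t p" "branch t (p ! i) s s'" "p ! (i + 1) \<in> root_set s"
    and "i < j" "j < length p"
  shows "p ! j \<in> set_tree s"
  using descending_in_subtree[OF D assms(2) branch_subtree[OF assms(3)], of "i + 1" j] assms by auto

lemma descending_next:
  assumes "descending t p" "i + 1 < length p"
  obtains s s' where "branch t (p ! i) s s'" "p ! (i + 1) \<in> root_set s"
  using assms child_branch unfolding descending_def by metis

text \<open>Later vertices lie in the chosen branch \<open>s\<close>. An earlier vertex inside
  \<open>s'\<close> would force \<open>p ! i\<close> into \<open>s'\<close> too, because descending
  paths never leave a subtree.\<close>

lemma descending_avoids:
  assumes D: "distinct_tree t" and "descending t p" "branch t (p ! i) s s'" "p ! (i + 1) \<in> root_set s"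
    "i + 1 < length p"
  shows "set p \<inter> set_tree s' = {}"
proof -
  have "p ! j \<notin> set_tree s'" if "j < length p" for j
  proof (cases "j \<le> i")
    case True
    have "p ! i \<notin> set_tree s'" using branch_disjoint(1)[OF D branch_sym[OF assms(3)]] .
    then show ?thesis
      using descending_in_subtree[OF D assms(2) branch_subtree[OF branch_sym[OF assms(3)]] _ True] assms(5) by auto
  next
    case False
    then show ?thesis using descending_branch[OF assms(1-4), of j] that branch_disjoint(2)[OF D assms(3)] by auto
  qed
  then show ?thesis by (auto simp: in_set_conv_nth)
qed

section \<open>Rooted subquivers and end vertices\<close>

lemma descending_distinct:
  assumes D: "distinct_tree t" and "descending t p" "i < j" "j < length p"
  shows "p ! i \<noteq> p ! j"
proof -
  obtain s s' where b: "branch t (p ! i) s s'" "p ! (i + 1) \<in> root_set s"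
    using descending_next[OF assms(2), of i] assms(3,4) by auto
  then show ?thesis
    using descending_branch[OF D assms(2) b assms(3,4)] branch_disjoint(1)[OF D b(1)] by auto
qed

text \<open>\<open>primary_on\<close> only asks the secondary vertex to occur somewhere later on the
  string. Adjacency to \<open>p ! i\<close> makes it the root of the branch entered, hence the next
  vertex; the third vertex of the 3-cycle is off the string and can only be the root of the sibling
  branch.\<close>

lemma primary_on_descending:
  assumes D: "distinct_tree t" and d: "descending t p" and i: "i + 1 < length p"
    and b: "branch t (p ! i) s s'" "p ! (i + 1) \<in> root_set s"
    and pr: "primary_on (tree_quiver t) p (p ! i) y z"
  shows "y = p ! (i + 1) \<and> z \<in> root_set s'"
proof -
  obtain i' j where ij: "i' < j" "j < length p" "p ! i' = p ! i" "p ! j = y"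
    and z: "z \<notin> set p" and tc: "three_cycle (tree_quiver t) (p ! i) y z"
    using pr unfolding primary_on_def by blast
  have "i' = i"
    using descending_distinct[OF D d, of i i'] descending_distinct[OF D d, of i' i] ij i
    by (metis Suc_eq_plus1 Suc_lessD less_trans linorder_neqE_nat)
  then have y: "y \<in> set_tree s" using descending_branch[OF D d b] ij by auto
  have x: "p ! i \<notin> set_tree s" using branch_disjoint(1)[OF D b(1)] .
  note adj = three_cycle_adjacent[OF tc]
  have yr: "y \<in> root_set s" using adjacent_leaving[OF D b(1) adjacent_sym[OF adj(1)] y x] by blast
  then have yeq: "y = p ! (i + 1)" using b(2) root_set_D by metis
  then have zs: "z \<notin> set_tree s \<or> z \<in> root_set s"
    using adjacent_leaving[OF D b(1) adjacent_sym[OF adj(3)] _ x] by blast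
  have "z \<noteq> y" using z yeq i by auto
  then have zs: "z \<notin> set_tree s" using zs yr root_set_D by metis
  have "z \<noteq> p ! i" using z i by auto
  then have "z \<in> root_set s'" using adjacent_leaving[OF D b(1) adj(2) y zs] by blast
  then show ?thesis using yeq by blast
qed

lemma descending_primary_on:
  assumes D: "distinct_tree t" and d: "descending t p" and i: "i + 1 < length p"
    and b: "branch t (p ! i) s s'" "p ! (i + 1) \<in> root_set s" "z \<in> root_set s'"
  shows "primary_on (tree_quiver t) p (p ! i) (p ! (i + 1)) z"
  unfolding primary_on_def
proof (intro conjI)
  show "\<exists>k j. k < j \<and> j < length p \<and> p ! k = p ! i \<and> p ! j = p ! (i + 1)"
    using i by (intro exI[of _ i] exI[of _ "i + 1"]) simp
  show "z \<notin> set p" using descending_avoids[OF D d b(1,2) i] b(3) root_set_in by fast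
  show "three_cycle (tree_quiver t) (p ! i) (p ! (i + 1)) z" using branch_three_cycle[OF b] .
qed

lemma descending_path_exists:
  assumes "w \<in> set_tree s"
  shows "\<exists>p. p \<noteq> [] \<and> set p \<subseteq> set_tree s \<and> hd p \<in> root_set s \<and> last p = w \<and> descending s p"
  using assms
proof (induction s)
  case (Node t1 a t2)
  have ext: "\<exists>p. p \<noteq> [] \<and> set p \<subseteq> set_tree (Node t1 a t2) \<and> hd p \<in> root_set (Node t1 a t2)
      \<and> last p = w \<and> descending (Node t1 a t2) p"
    if u: "u = t1 \<or> u = t2" and p: "p \<noteq> []" "set p \<subseteq> set_tree u" "hd p \<in> root_set u" "last p = w" "descending u p" for u p
  proof (intro exI conjI)
    show "descending (Node t1 a t2) (a # p)"
      unfolding descending_def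
    proof (intro allI impI)
      fix i assume i: "i + 1 < length (a # p)"
      show "child (Node t1 a t2) ((a # p) ! i) ((a # p) ! (i + 1))"
      proof (cases i)
        case 0
        have "p ! 0 \<in> root_set u" using p by (simp add: hd_conv_nth)
        then have "child (Node t1 a t2) a (p ! 0)" using u unfolding child_def by auto
        then show ?thesis using 0 by simp
      next
        case (Suc k)
        then have "child u (p ! k) (p ! (k + 1))" using p(5) i unfolding descending_def by simp
        then show ?thesis using Suc u unfolding child_def by auto
      qed
    qed
  qed (use u p in auto)
  show ?case
  proof (cases "w = a")
    case True
    then show ?thesis by (intro exI[of _ "[a]"]) (auto simp: descending_def)
  next
    case False
    then have "w \<in> set_tree t1 \<or> w \<in> set_tree t2" using Node.prems by auto
    then show ?thesis using Node.IH ext[OF disjI1[OF refl]] ext[OF disjI2[OF refl]] by metis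
  qed
qed auto

lemma descending_string:
  assumes D: "distinct_tree t" and d: "descending t p" and "p \<noteq> []" "set p \<subseteq> set_tree t"
  shows "string_in (tree_quiver t) p"
  unfolding string_in_def
proof (intro conjI allI impI)
  show "set p \<subseteq> verts (tree_quiver t)" using assms(4) by (simp add: tree_quiver_def)
  fix i
  show "0 < edges (tree_quiver t) (p ! i) (p ! (i + 1))" if "i + 1 < length p"
  proof -
    have "adjacent t (p ! i) (p ! (i + 1))" using d that unfolding descending_def by (intro child_adjacent) simp
    then show ?thesis by (simp add: edges_tree_quiver[OF D])
  qed
  show "p ! i \<noteq> p ! (i + 2)" if "i + 2 < length p"
    using descending_distinct[OF D d, of i "i + 2"] that by simp
  show "\<not> three_cycle (tree_quiver t) (p ! i) (p ! (i + 1)) (p ! (i + 2))" if l: "i + 2 < length p"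
  proof
    assume "three_cycle (tree_quiver t) (p ! i) (p ! (i + 1)) (p ! (i + 2))"
    then have adj: "adjacent t (p ! (i + 2)) (p ! i)" using three_cycle_adjacent adjacent_sym by metis
    obtain s s' where b: "branch t (p ! i) s s'" "p ! (i + 1) \<in> root_set s"
      using descending_next[OF d, of i] l by auto
    have "p ! (i + 2) \<in> set_tree s" using descending_branch[OF D d b] l by auto
    then have "p ! (i + 2) \<in> root_set s"
      using adjacent_leaving[OF D b(1) adj] branch_disjoint(1)[OF D b(1)] by blast
    then have "p ! (i + 2) = p ! (i + 1)" using b(2) root_set_D by metis
    then show False using descending_distinct[OF D d, of "i + 1" "i + 2"] l by simp
  qed
qed (use assms(3) in auto)

text \<open>A string starting in \<open>s'\<close> could leave it only at the root, stepping to
  \<open>x\<close> or \<open>y\<close>, and both are excluded. Conversely, descending paths reach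
  every vertex of \<open>s'\<close>.\<close>

lemma rooted_tree_quiver:
  assumes D: "distinct_tree t" and b: "branch t x s s'" and y: "y \<in> root_set s" and z: "z \<in> root_set s'"
  shows "rooted (tree_quiver t) z x y = tree_quiver s'"
proof -
  let ?W = "{w. \<exists>p. string_from_to (tree_quiver t) p z w \<and> x \<notin> set p \<and> y \<notin> set p}"
  note b' = branch_sym[OF b]
  have sub: "s' \<in> subtrees t" using branch_subtree[OF b'] .
  have avoid: "x \<notin> set_tree s'" "y \<notin> set_tree s'"
    using branch_disjoint[OF D b] branch_disjoint[OF D b'] y by auto
  have "w \<in> set_tree s'" if p: "string_from_to (tree_quiver t) p z w" "x \<notin> set p" "y \<notin> set p" for p w
  proof -
    have "p ! j \<in> set_tree s'" if "j < length p" for j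
      using that
    proof (induction j)
      case 0
      then show ?case using p(1) z by (cases p) (auto simp: string_from_to_def)
    next
      case (Suc j)
      then have "edges (tree_quiver t) (p ! j) (p ! Suc j) > 0"
        using p(1) by (simp add: string_from_to_def string_in_def)
      then have adj: "adjacent t (p ! j) (p ! Suc j)"
        using edges_tree_quiver[OF D] by (simp split: if_splits)
      have "p ! Suc j \<noteq> x" "p ! Suc j \<noteq> y" using p(2,3) Suc.prems nth_mem by metis+
      moreover have "p ! Suc j \<notin> root_set s" using calculation(2) y root_set_D by metis
      ultimately show ?case using adjacent_leaving[OF D b' adj] Suc by auto
    qed
    then show ?thesis using p(1)
      by (metis last_conv_nth diff_less length_greater_0_conv string_from_to_def string_in_def zero_less_one)
  qed
  moreover have "w \<in> ?W" if w: "w \<in> set_tree s'" for w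
  proof -
    obtain p where p: "p \<noteq> []" "set p \<subseteq> set_tree s'" "hd p \<in> root_set s'" "last p = w" "descending s' p"
      using descending_path_exists[OF w] by blast
    have "descending t p"
      using p(5) subtrees_trans[OF _ sub] unfolding descending_def child_def by blast
    moreover have "set p \<subseteq> set_tree t" using p(2) set_subtree[OF sub] by blast
    ultimately have "string_in (tree_quiver t) p" using descending_string[OF D] p(1) by blast
    moreover have "hd p = z" using p(3) z root_set_D by metis
    ultimately have "string_from_to (tree_quiver t) p z w" using p(4) by (simp add: string_from_to_def)
    then show ?thesis using p(2) avoid by blast
  qed
  ultimately have W: "?W = set_tree s'" by blast
  show ?thesis
    unfolding rooted_def W
    by (rule quiver_eqI)
      (use set_subtree[OF sub] tree_arrows_subtree[OF D sub] tree_arrows_in[of _ _ s'] in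
        \<open>auto simp: full_subquiver_def tree_quiver_def\<close>)
qed

text \<open>If \<open>x\<close> had children on both sides, valency at most 2 would leave exactly
  one on each side. An end vertex of valency 2 lies on a 3-cycle, but no arrow joins a vertex of one
  side to a vertex of the other.\<close>

lemma end_vertex_two_trees:
  assumes T: "two_trees Q x a b c d" and e: "end_vertex Q x"
  shows "a = Leaf \<and> b = Leaf \<or> c = Leaf \<and> d = Leaf"
proof (rule ccontr)
  assume n: "\<not> ?thesis"
  define A where "A = tree_arrows (Node a x b) \<union> tree_arrows (Node c x d)"
  let ?V = "insert x (set_tree a \<union> set_tree b \<union> set_tree c \<union> set_tree d)"
  have Q: "Q = quiver_of ?V A" and D: "distinct (x # inorder a @ inorder b @ inorder c @ inorder d)"
    using T by (auto simp: two_trees_def A_def)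
  have nx: "x \<notin> set_tree a" "x \<notin> set_tree b" "x \<notin> set_tree c" "x \<notin> set_tree d" using D by auto
  have xx: "(x, v) \<notin> tree_arrows t" "(v, x) \<notin> tree_arrows t" if "t \<in> {a, b, c, d}" for t v
    using that nx tree_arrows_in[of x v t] tree_arrows_in[of v x t] by auto
  let ?R = "root_set a \<union> root_set b \<union> (root_set c \<union> root_set d)"
  have rx: "x \<notin> ?R" using nx by auto
  have ed: "edges Q x v > 0" if "v \<in> ?R" for v
  proof -
    have "(x, v) \<in> A \<or> (v, x) \<in> A" using that unfolding A_def tree_arrows.simps node_arrows_def by blast
    then show ?thesis unfolding Q edges_def quiver_of_simps by auto
  qed
  have adj: "v \<in> ?R" if "(x, v) \<in> A \<or> (v, x) \<in> A" for v
    using that xx unfolding A_def tree_arrows.simps node_arrows_def by blast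
  have fin: "finite ?V" by simp
  have sub: "?R \<subseteq> ?V" by auto
  \<comment> \<open>The children of \<open>x\<close> are pairwise distinct neighbours, so their
    number bounds the valency from below.\<close>
  have "card ?R = (\<Sum>v\<in>?R. 1)" by simp
  also have "\<dots> \<le> (\<Sum>v\<in>?R. edges Q x v)" using ed by (intro sum_mono) (simp add: Suc_leI)
  also have "\<dots> \<le> valency Q x" unfolding valency_def
    by (rule sum_mono2) (use fin sub Q in auto)
  finally have val: "card ?R \<le> valency Q x" .
  have dj: "(root_set a \<union> root_set b) \<inter> (root_set c \<union> root_set d) = {}" "root_set a \<inter> root_set b = {}"
    "root_set c \<inter> root_set d = {}"
    using D root_set_subset[of a] root_set_subset[of b] root_set_subset[of c] root_set_subset[of d] by auto
  have frs: "finite (root_set t)" "card (root_set t) = (if t = Leaf then 0 else 1)" for t :: "'a tree"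
    by (cases t; simp)+
  have card: "card ?R = card (root_set a) + card (root_set b) + (card (root_set c) + card (root_set d))"
    using dj frs(1) by (simp add: card_Un_disjoint)
  have "card ?R \<le> 2" using val e by (auto simp: end_vertex_def)
  then have one: "a = Leaf \<or> b = Leaf" "c = Leaf \<or> d = Leaf" and "card ?R = 2"
    using n card frs(2) by (auto split: if_splits)
  then have "valency Q x \<ge> 2" using val by simp
  then obtain y z where tc: "three_cycle Q x y z" using e by (auto simp: end_vertex_def)
  have yz: "y \<in> ?R" "z \<in> ?R" "(y, z) \<in> A \<or> (z, y) \<in> A"
    using tc adj[of y] adj[of z] unfolding three_cycle_def Q by auto
  have same: "(u \<in> set_tree a \<union> set_tree b) \<longleftrightarrow> (v \<in> set_tree a \<union> set_tree b)" if "(u, v) \<in> A" "u \<noteq> x" "v \<noteq> x" for u v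
    using that D tree_arrows_in[of u v a] tree_arrows_in[of u v b] tree_arrows_in[of u v c] tree_arrows_in[of u v d]
      root_set_in[of u a] root_set_in[of u b] root_set_in[of u c] root_set_in[of u d]
      root_set_in[of v a] root_set_in[of v b] root_set_in[of v c] root_set_in[of v d]
    unfolding A_def tree_arrows.simps node_arrows_def by auto
  have "y \<noteq> x" "z \<noteq> x" using yz rx by auto
  then have s: "(y \<in> set_tree a \<union> set_tree b) \<longleftrightarrow> (z \<in> set_tree a \<union> set_tree b)" using yz(3) same by metis
  have w: "v \<in> root_set a \<union> root_set b \<longleftrightarrow> v \<in> set_tree a \<union> set_tree b" if "v \<in> ?R" for v
    using that D by auto
  have "y \<in> root_set a \<union> root_set b \<and> z \<in> root_set a \<union> root_set b \<or>
      y \<in> root_set c \<union> root_set d \<and> z \<in> root_set c \<union> root_set d"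
    using s w[OF yz(1)] w[OF yz(2)] yz by blast
  \<comment> \<open>Both lie on the same side, where only one child exists; the 3-cycle would
    contain a loop.\<close>
  then have "y = z" using one root_set_D[of y _ z] by auto
  then show False
    using yz(3) tree_arrows_antisym[of "Node a x b" y y] tree_arrows_antisym[of "Node c x d" y y] D
    unfolding A_def by (auto simp del: tree_arrows.simps)
qed

section \<open>Labellings described by a successor function\<close>

text \<open>
  The labels of \<open>V\<close> are \<open>b + 1, \<dots>, b + card V\<close>, the last one at \<open>f\<close>. Letting the last label
  point to the first label after the block makes the blocks of nested recursive calls fit together:
  the block of a subquiver rooted at a complementary vertex is followed by the secondary vertex.
\<close>

definition successor_labelling ::
  "('v \<Rightarrow> 'v \<Rightarrow> bool) \<Rightarrow> ('v \<Rightarrow> 'v \<Rightarrow> 'v \<Rightarrow> bool) \<Rightarrow> 'v set \<Rightarrow> ('v \<Rightarrow> nat) \<Rightarrow> nat \<Rightarrow> 'v \<Rightarrow> (nat \<Rightarrow> nat) \<Rightarrow> bool"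
where
  "successor_labelling E T V L b f \<sigma> \<longleftrightarrow>
     finite V \<and> f \<in> V \<and> bij_betw L V {b+1..b + card V} \<and> L f = b + card V \<and>
     \<sigma> (b + card V) = b + card V + 1 \<and>
     (\<forall>i. b < i \<and> i < b + card V \<longrightarrow> i < \<sigma> i \<and> \<sigma> i \<le> b + card V) \<and>
     (\<forall>i j. b < i \<and> i < j \<and> j \<le> b + card V \<and> \<sigma> i = \<sigma> j \<longrightarrow> \<sigma> i = j + 1) \<and>
     (\<forall>x\<in>V. \<forall>y\<in>V. L x < L y \<longrightarrow> (E x y \<longleftrightarrow> \<sigma> (L x) = L y \<or> \<sigma> (L x) = \<sigma> (L y))) \<and>
     (\<forall>x\<in>V. \<sigma> (L x) \<noteq> L x + 1 \<longrightarrow>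
        (\<exists>y\<in>V. \<exists>z\<in>V. T x y z \<and> L y + 1 = \<sigma> (L x) \<and> L z = \<sigma> (L x)))"

lemma successor_labellingD:
  assumes "successor_labelling E T V L b f \<sigma>"
  shows "finite V" "f \<in> V" "bij_betw L V {b+1..b + card V}" "L f = b + card V"
    "\<sigma> (b + card V) = b + card V + 1"
    "\<And>i. b < i \<Longrightarrow> i < b + card V \<Longrightarrow> i < \<sigma> i \<and> \<sigma> i \<le> b + card V"
    "\<And>i j. b < i \<Longrightarrow> i < j \<Longrightarrow> j \<le> b + card V \<Longrightarrow> \<sigma> i = \<sigma> j \<Longrightarrow> \<sigma> i = j + 1"
    "\<And>x y. x \<in> V \<Longrightarrow> y \<in> V \<Longrightarrow> L x < L y \<Longrightarrow> E x y \<longleftrightarrow> \<sigma> (L x) = L y \<or> \<sigma> (L x) = \<sigma> (L y)"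
    "\<And>x. x \<in> V \<Longrightarrow> \<sigma> (L x) \<noteq> L x + 1 \<Longrightarrow>
        \<exists>y\<in>V. \<exists>z\<in>V. T x y z \<and> L y + 1 = \<sigma> (L x) \<and> L z = \<sigma> (L x)"
  using assms unfolding successor_labelling_def by auto

section \<open>Combining blocks of labels\<close>

lemma successor_labelling_range:
  assumes "successor_labelling E T V L b f \<sigma>" "x \<in> V"
  shows "b < L x" "L x \<le> b + card V"
  using bij_betwE[OF successor_labellingD(3)[OF assms(1)]] assms(2) by fastforce+

lemma successor_labelling_succ:
  assumes "successor_labelling E T V L b f \<sigma>" "b < i" "i \<le> b + card V"
  shows "i < \<sigma> i" "\<sigma> i \<le> b + card V + 1"
  using successor_labellingD(5,6)[OF assms(1)] assms(2,3)
  by (metis add.commute le_neq_implies_less le_SucI less_add_one plus_1_eq_Suc order_refl)+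

lemma successor_labelling_succ_le:
  assumes "successor_labelling E T V L b f \<sigma>" "x \<in> V" "x \<noteq> f"
  shows "\<sigma> (L x) \<le> b + card V"
proof -
  have "L x \<noteq> L f"
    using assms(2,3) successor_labellingD(2,3)[OF assms(1)] by (auto simp: bij_betw_def inj_on_def)
  then show ?thesis
    using successor_labelling_range[OF assms(1,2)] successor_labellingD(4,6)[OF assms(1)] by simp
qed

lemma successor_labelling_singleton:
  assumes "L x = b + 1"
  shows "successor_labelling E T {x} L b x Suc"
  using assms unfolding successor_labelling_def by (auto simp: bij_betw_def inj_on_def)

text \<open>Carries the labels \<open>1, 2, ...\<close> of a recursive call over to a block of the
  ambient quiver. For \<open>T\<close> one direction suffices, since 3-cycles are only claimed to
  exist.\<close>

lemma successor_labelling_shift: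
  assumes S: "successor_labelling E T V L 0 f \<sigma>"
    and L: "\<And>x. x \<in> V \<Longrightarrow> L' x = L x + b"
    and E: "\<And>x y. x \<in> V \<Longrightarrow> y \<in> V \<Longrightarrow> E' x y \<longleftrightarrow> E x y"
    and T: "\<And>x y z. x \<in> V \<Longrightarrow> y \<in> V \<Longrightarrow> z \<in> V \<Longrightarrow> T x y z \<Longrightarrow> T' x y z"
  shows "successor_labelling E' T' V L' b f (\<lambda>i. \<sigma> (i - b) + b)"
  unfolding successor_labelling_def
proof (intro conjI allI impI ballI)
  note S' = successor_labellingD[OF S]
  show "finite V" "f \<in> V" using S'(1,2) by auto
  have "L' ` V = (\<lambda>i. i + b) ` (L ` V)" using L by (auto simp: image_image)
  also have "\<dots> = {b + 1..b + card V}"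
    using S'(3) image_add_atLeastAtMost[of b 1 "card V"] by (simp add: bij_betw_def add.commute)
  finally show "bij_betw L' V {b + 1..b + card V}"
    using S'(3) L by (auto simp: bij_betw_def inj_on_def)
  show "L' f = b + card V" using S'(2,4) L by simp
  show "\<sigma> (b + card V - b) + b = b + card V + 1" using S'(5) by simp
next
  fix i assume "b < i \<and> i < b + card V"
  then have "i - b < \<sigma> (i - b)" "\<sigma> (i - b) \<le> card V"
    using successor_labellingD(6)[OF S, of "i - b"] by auto
  then show "i < \<sigma> (i - b) + b" "\<sigma> (i - b) + b \<le> b + card V" by arith+
next
  fix i j assume "b < i \<and> i < j \<and> j \<le> b + card V \<and> \<sigma> (i - b) + b = \<sigma> (j - b) + b"
  then show "\<sigma> (i - b) + b = j + 1"
    using successor_labellingD(7)[OF S, of "i - b" "j - b"] by auto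
next
  fix x y assume "x \<in> V" "y \<in> V" "L' x < L' y"
  then show "E' x y \<longleftrightarrow> \<sigma> (L' x - b) + b = L' y \<or> \<sigma> (L' x - b) + b = \<sigma> (L' y - b) + b"
    using successor_labellingD(8)[OF S, of x y] E L by simp
next
  fix x assume x: "x \<in> V" "\<sigma> (L' x - b) + b \<noteq> L' x + 1"
  then obtain y z where "y \<in> V" "z \<in> V" "T x y z" "L y + 1 = \<sigma> (L x)" "L z = \<sigma> (L x)"
    using successor_labellingD(9)[OF S, of x] L by auto
  then show "\<exists>y\<in>V. \<exists>z\<in>V. T' x y z \<and> L' y + 1 = \<sigma> (L' x - b) + b \<and> L' z = \<sigma> (L' x - b) + b"
    using x L T by (intro bexI[of _ y] bexI[of _ z]) auto
qed

text \<open>The step of the procedure at a vertex \<open>x\<close> that is not primary: the block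
  \<open>V\<close> of all later vertices begins at the next vertex \<open>y\<close>.\<close>

lemma successor_labelling_insert:
  assumes S: "successor_labelling E T V L (b + 1) f \<sigma>"
    and y: "y \<in> V" "L y = b + 2" and x: "L x = b + 1"
    and E: "\<And>v. v \<in> V \<Longrightarrow> E x v \<longleftrightarrow> v = y"
  shows "successor_labelling E T (insert x V) L b f (\<sigma>(b + 1 := b + 2))"
  unfolding successor_labelling_def
proof (intro conjI allI impI ballI)
  note S' = successor_labellingD[OF S] and R = successor_labelling_range[OF S]
  have xV: "x \<notin> V" using R x by fastforce
  have c: "card (insert x V) = card V + 1" "card V > 0" using S'(1,2) xV by (auto simp: card_gt_0_iff)
  show "finite (insert x V)" "f \<in> insert x V" using S'(1,2) by auto
  show "bij_betw L (insert x V) {b + 1..b + card (insert x V)}"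
  proof -
    have "{b + 1..b + card (insert x V)} = insert (b + 1) {b + 1 + 1..b + 1 + card V}" using c by auto
    then show ?thesis
      using bij_betw_combine[of L "{x}" "{b + 1}" V, OF _ S'(3)] x by auto
  qed
  show "L f = b + card (insert x V)" using S'(4) c by simp
  show "(\<sigma>(b + 1 := b + 2)) (b + card (insert x V)) = b + card (insert x V) + 1" using S'(5) c by simp
next
  note S' = successor_labellingD[OF S] and R = successor_labelling_range[OF S]
  have xV: "x \<notin> V" using R x by fastforce
  have c: "card (insert x V) = card V + 1" "card V > 0" using S'(1,2) xV by (auto simp: card_gt_0_iff)
  fix i assume "b < i \<and> i < b + card (insert x V)"
  then show "i < (\<sigma>(b + 1 := b + 2)) i" "(\<sigma>(b + 1 := b + 2)) i \<le> b + card (insert x V)"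
    using S'(6)[of i] c by auto
next
  note S' = successor_labellingD[OF S] and R = successor_labelling_range[OF S]
  have xV: "x \<notin> V" using R x by fastforce
  have c: "card (insert x V) = card V + 1" "card V > 0" using S'(1,2) xV by (auto simp: card_gt_0_iff)
  fix i j assume "b < i \<and> i < j \<and> j \<le> b + card (insert x V) \<and> (\<sigma>(b + 1 := b + 2)) i = (\<sigma>(b + 1 := b + 2)) j"
  then show "(\<sigma>(b + 1 := b + 2)) i = j + 1"
    using S'(7)[of i j] successor_labelling_succ[OF S, of j] c by (auto split: if_splits)
next
  note R = successor_labelling_range[OF S]
  fix u v assume uv: "u \<in> insert x V" "v \<in> insert x V" "L u < L v"
  have v: "v \<in> V" "b + 1 < L v" "L v \<le> b + 1 + card V" using uv R x by fastforce+
  have vs: "L v < \<sigma> (L v)" using successor_labelling_succ[OF S v(2,3)] by simp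
  show "E u v \<longleftrightarrow> (\<sigma>(b + 1 := b + 2)) (L u) = L v \<or> (\<sigma>(b + 1 := b + 2)) (L u) = (\<sigma>(b + 1 := b + 2)) (L v)"
  proof (cases "u = x")
    case True
    have "v = y \<longleftrightarrow> L v = b + 2"
      using successor_labellingD(3)[OF S] v y by (auto simp: bij_betw_def inj_on_def)
    then show ?thesis using True E[OF v(1)] x v vs by auto
  next
    case False
    then have "u \<in> V" using uv by simp
    then show ?thesis using successor_labellingD(8)[OF S _ v(1) uv(3)] R[of u] v by simp
  qed
next
  note R = successor_labelling_range[OF S]
  fix u assume "u \<in> insert x V" "(\<sigma>(b + 1 := b + 2)) (L u) \<noteq> L u + 1"
  then show "\<exists>y\<in>insert x V. \<exists>z\<in>insert x V. T u y z \<and> L y + 1 = (\<sigma>(b + 1 := b + 2)) (L u) \<and> L z = (\<sigma>(b + 1 := b + 2)) (L u)"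
    using successor_labellingD(9)[OF S, of u] R[of u] x by fastforce
qed

text \<open>The step at a primary vertex \<open>x\<close>: the block \<open>V1\<close> of the
  complementary branch comes first, then the block \<open>V2\<close> beginning at the secondary
  vertex \<open>y\<close>. The last label of \<open>V1\<close>, at \<open>z\<close>, already points
  to the label of \<open>y\<close>; letting \<open>x\<close> point there too encodes the 3-cycle
  \<open>x\<close>, \<open>z\<close>, \<open>y\<close>.\<close>

lemma successor_labelling_triangle:
  assumes S1: "successor_labelling E T V1 L (b + 1) z \<sigma>1"
    and S2: "successor_labelling E T V2 L (b + 1 + card V1) f \<sigma>2"
    and y: "y \<in> V2" "L y = b + card V1 + 2" and x: "L x = b + 1" and T: "T x z y"
    and Ex: "\<And>v. v \<in> V1 \<union> V2 \<Longrightarrow> E x v \<longleftrightarrow> v = z \<or> v = y"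
    and E12: "\<And>u v. u \<in> V1 \<Longrightarrow> v \<in> V2 \<Longrightarrow> E u v \<longleftrightarrow> u = z \<and> v = y"
  shows "successor_labelling E T (insert x (V1 \<union> V2)) L b f
    (\<lambda>i. if i = b + 1 then b + card V1 + 2 else if i \<le> b + 1 + card V1 then \<sigma>1 i else \<sigma>2 i)"
    (is "successor_labelling E T ?V L b f ?\<sigma>")
proof -
  note A = successor_labellingD[OF S1] and B = successor_labellingD[OF S2]
  note RA = successor_labelling_range[OF S1] and RB = successor_labelling_range[OF S2]
  note SA = successor_labelling_succ[OF S1] and SB = successor_labelling_succ[OF S2]
  have xV: "x \<notin> V1 \<union> V2" using RA(1)[of x] RB(1)[of x] x by auto
  have dj: "V1 \<inter> V2 = {}"
  proof (rule ccontr)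
    assume "V1 \<inter> V2 \<noteq> {}"
    then obtain v where "v \<in> V1" "v \<in> V2" by auto
    then show False using RA(2)[of v] RB(1)[of v] by simp
  qed
  have pos: "card V1 > 0" "card V2 > 0" using A(1,2) B(1,2) by (auto simp: card_gt_0_iff)
  have c: "card ?V = card V1 + card V2 + 1" using A(1) B(1) xV dj by (simp add: card_Un_disjoint)
  have \<sigma>x: "?\<sigma> (b + 1) = b + card V1 + 2" by simp
  have \<sigma>1: "?\<sigma> i = \<sigma>1 i" if "b + 1 < i" "i \<le> b + 1 + card V1" for i using that by simp
  have \<sigma>2: "?\<sigma> i = \<sigma>2 i" if "b + 1 + card V1 < i" for i using that by simp
  have yv: "v = y \<longleftrightarrow> L v = b + card V1 + 2" if "v \<in> V2" for v
    using B(3) that y by (auto simp: bij_betw_def inj_on_def)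
  \<comment> \<open>Only the last vertex of a block points out of it. This matches the fact that
    \<open>z\<close> is the only vertex of \<open>V1\<close> with neighbours in
    \<open>V2\<close>.\<close>
  have \<sigma>z: "\<sigma>1 (L v) = b + card V1 + 2 \<longleftrightarrow> v = z" if "v \<in> V1" for v
    using successor_labelling_succ_le[OF S1 that] A(4,5) by (cases "v = z") auto
  show ?thesis
    unfolding successor_labelling_def
  proof (intro conjI)
    show "finite ?V" "f \<in> ?V" using A(1,2) B(1,2) by auto
    have iv: "{b + 1..b + card ?V} = insert (b + 1) ({b + 1 + 1..b + 1 + card V1} \<union> {b + 1 + card V1 + 1..b + 1 + card V1 + card V2})"
      using c by auto
    have "bij_betw L (V1 \<union> V2) ({b + 1 + 1..b + 1 + card V1} \<union> {b + 1 + card V1 + 1..b + 1 + card V1 + card V2})"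
      by (rule bij_betw_combine[OF A(3) B(3)]) auto
    from bij_betw_combine[OF _ this, of "{x}" "{b + 1}"] show "bij_betw L ?V {b + 1..b + card ?V}"
      unfolding iv by (simp add: x)
    show "L f = b + card ?V" using B(4) c by simp
    show "?\<sigma> (b + card ?V) = b + card ?V + 1" using B(5) c pos by (simp add: add.assoc)
    show "\<forall>i. b < i \<and> i < b + card ?V \<longrightarrow> i < ?\<sigma> i \<and> ?\<sigma> i \<le> b + card ?V"
    proof (intro allI impI)
      fix i assume i: "b < i \<and> i < b + card ?V"
      consider "i = b + 1" | "b + 1 < i" "i \<le> b + 1 + card V1" | "b + 1 + card V1 < i" using i by linarith
      then show "i < ?\<sigma> i \<and> ?\<sigma> i \<le> b + card ?V"
      proof cases
        case 1
        then show ?thesis using pos c by simp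
      next
        case 2
        then show ?thesis using SA[of i] \<sigma>1 c pos by simp
      next
        case 3
        then show ?thesis using B(6)[of i] \<sigma>2 c i by simp
      qed
    qed
    show "\<forall>i j. b < i \<and> i < j \<and> j \<le> b + card ?V \<and> ?\<sigma> i = ?\<sigma> j \<longrightarrow> ?\<sigma> i = j + 1"
    proof (intro allI impI)
      fix i j assume ij: "b < i \<and> i < j \<and> j \<le> b + card ?V \<and> ?\<sigma> i = ?\<sigma> j"
      consider "b + 1 + card V1 < i" | "i \<le> b + 1 + card V1" "b + 1 + card V1 < j" |
          "b + 1 < i" "j \<le> b + 1 + card V1" | "i = b + 1" "j \<le> b + 1 + card V1"
        using ij by linarith
      then show "?\<sigma> i = j + 1"
      proof cases
        case 1
        then show ?thesis using B(7)[of i j] ij \<sigma>2[of i] \<sigma>2[of j] c by simp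
      next
        case 2
        \<comment> \<open>Labels up to the end of \<open>V1\<close> point at most to the first label
          of \<open>V2\<close>, while \<open>j\<close> already lies in \<open>V2\<close> and points
          beyond itself, so the two values cannot agree.\<close>
        have "?\<sigma> i \<le> b + card V1 + 2"
          using 2 SA(2)[of i] ij \<sigma>x \<sigma>1[of i] by (cases "i = b + 1") auto
        moreover have "?\<sigma> j > j" using SB(1)[of j] 2 ij c \<sigma>2[of j] by simp
        ultimately show ?thesis using ij 2 by linarith
      next
        case 3
        then have "?\<sigma> i = \<sigma>1 i" "?\<sigma> j = \<sigma>1 j" using ij by auto
        then have "\<sigma>1 i = \<sigma>1 j" "?\<sigma> i = \<sigma>1 i" using ij by metis+
        then show ?thesis using A(7)[of i j] 3 ij by simp
      next
        case 4
        then have "?\<sigma> j = \<sigma>1 j" using ij by auto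
        then have "\<sigma>1 j = b + card V1 + 2" using ij 4(1) \<sigma>x by metis
        then have "j = b + 1 + card V1" using A(6)[of j] 4 ij by fastforce
        then show ?thesis using 4 \<sigma>x by simp
      qed
    qed
    show "\<forall>u\<in>?V. \<forall>v\<in>?V. L u < L v \<longrightarrow> (E u v \<longleftrightarrow> ?\<sigma> (L u) = L v \<or> ?\<sigma> (L u) = ?\<sigma> (L v))"
    proof (intro ballI impI)
      fix u v assume uv: "u \<in> ?V" "v \<in> ?V" "L u < L v"
      have vx: "v \<in> V1 \<union> V2" using uv x RA[of u] RB[of u] by auto
      have ux: "u = x \<or> u \<in> V1 \<or> u \<in> V2" using uv by auto
      have r1: "L w \<noteq> b + 1" "L w \<le> b + 1 + card V1" "b + 1 < L w" "L w < \<sigma>1 (L w)" "\<sigma>1 (L w) \<le> b + card V1 + 2" if "w \<in> V1" for w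
        using RA[OF that] SA[of "L w"] by auto
      have r2: "b + 1 + card V1 < L w" "L w < \<sigma>2 (L w)" if "w \<in> V2" for w
        using RB[OF that] SB[of "L w"] by auto
      show "E u v \<longleftrightarrow> ?\<sigma> (L u) = L v \<or> ?\<sigma> (L u) = ?\<sigma> (L v)"
      proof (cases "u = x")
        case True
        show ?thesis
        proof (cases "v \<in> V1")
          case T1: True
          then have "v \<noteq> y" using dj y by auto
          then show ?thesis using True Ex[OF vx] x \<sigma>z[OF T1] r1[OF T1] by auto
        next
          case False
          then have v2: "v \<in> V2" "v \<noteq> z" using vx A(2) by auto
          then show ?thesis using True Ex[OF vx] x yv[OF v2(1)] r2[OF v2(1)] by auto
        qed
      next
        case ux': False
        show ?thesis
        proof (cases "u \<in> V1")
          case u1: True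
          show ?thesis
          proof (cases "v \<in> V1")
            case True
            then show ?thesis using A(8)[OF u1 True uv(3)] r1[OF u1] r1[OF True] by simp
          next
            case False
            then have v2: "v \<in> V2" using vx by auto
            then have "?\<sigma> (L u) = L v \<longleftrightarrow> u = z \<and> v = y"
              using r1[OF u1] r2[OF v2] \<sigma>z[OF u1] yv[OF v2] by auto
            moreover have "?\<sigma> (L u) \<noteq> ?\<sigma> (L v)" using r1[OF u1] r2[OF v2] by auto
            ultimately show ?thesis using E12[OF u1 v2] by simp
          qed
        next
          case False
          then have u2: "u \<in> V2" using ux ux' by auto
          then have v2: "v \<in> V2" using vx r1[of v] r2[of u] uv(3) by auto
          show ?thesis using B(8)[OF u2 v2 uv(3)] r2[OF u2] r2[OF v2] by simp
        qed
      qed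
    qed
    show "\<forall>u\<in>?V. ?\<sigma> (L u) \<noteq> L u + 1 \<longrightarrow>
        (\<exists>y\<in>?V. \<exists>z\<in>?V. T u y z \<and> L y + 1 = ?\<sigma> (L u) \<and> L z = ?\<sigma> (L u))"
    proof (intro ballI impI)
      fix u assume u: "u \<in> ?V" "?\<sigma> (L u) \<noteq> L u + 1"
      consider "u = x" | "u \<in> V1" | "u \<in> V2" using u by auto
      then show "\<exists>y\<in>?V. \<exists>z\<in>?V. T u y z \<and> L y + 1 = ?\<sigma> (L u) \<and> L z = ?\<sigma> (L u)"
      proof cases
        case 1
        then show ?thesis using T x y A(2,4) by (intro bexI[of _ z] bexI[of _ y]) auto
      next
        case 2
        then have e: "?\<sigma> (L u) = \<sigma>1 (L u)" using RA[OF 2] by simp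
        then show ?thesis using A(9)[OF 2] u(2) by auto
      next
        case 3
        then have e: "?\<sigma> (L u) = \<sigma>2 (L u)" using RB[OF 3] by simp
        then show ?thesis using B(9)[OF 3] u(2) by auto
      qed
    qed
  qed
qed

section \<open>From the labelling procedure to successor functions\<close>

lemma end_vertex_tree:
  assumes "type_A Q" "end_vertex Q e"
  obtains l r where "distinct_tree (Node l e r)" "Q = tree_quiver (Node l e r)"
proof -
  obtain a b c d where T: "two_trees Q e a b c d"
    using two_trees_at assms unfolding end_vertex_def by metis
  have *: "distinct_tree (Node l e r) \<and> Q = tree_quiver (Node l e r)" if "two_trees Q e l r Leaf Leaf" for l r
  proof -
    have "tree_arrows (Node Leaf e Leaf) = {}" by (simp add: node_arrows_def)
    then show ?thesis
      using that unfolding two_trees_def tree_quiver_def by auto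
  qed
  from end_vertex_two_trees[OF T assms(2)] show thesis
    using * that T two_trees_swap[OF T] by blast
qed

lemma tree_quiver_two_trees:
  assumes "distinct_tree (Node l e r)"
  shows "two_trees (tree_quiver (Node l e r)) e l r Leaf Leaf"
proof -
  have "tree_arrows (Node Leaf e Leaf) = {}" by (simp add: node_arrows_def)
  then show ?thesis using assms unfolding two_trees_def tree_quiver_def by auto
qed

lemma type_A_tree_quiver:
  assumes "distinct_tree t" "t \<noteq> Leaf"
  shows "type_A (tree_quiver t)"
proof -
  obtain l x r where t: "t = Node l x r" using assms(2) by (cases t) auto
  show ?thesis using tree_quiver_two_trees[of l x r] assms(1) unfolding type_A_def t by blast
qed

text \<open>Seen from \<open>f\<close>, the side containing \<open>e\<close> is not empty, so the
  side below \<open>f\<close> must be. Hence no vertices remain below the end of the walk.\<close>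

lemma end_vertex_childless:
  assumes D: "distinct_tree (Node l e r)" and f: "end_vertex (tree_quiver (Node l e r)) f" "f \<noteq> e"
  shows "Node Leaf f Leaf \<in> subtrees (Node l e r)"
proof -
  have "f \<in> set_tree (Node l e r)" using f(1) by (simp add: end_vertex_def tree_quiver_def)
  then have "f \<in> set_tree l \<or> f \<in> set_tree r" using f(2) by auto
  then obtain l' r' where lr: "Node l' f r' \<in> subtrees l \<or> Node l' f r' \<in> subtrees r"
    by (meson set_treeE)
  then obtain c d where T: "two_trees (tree_quiver (Node l e r)) f l' r' c d" "(c, d) \<noteq> (Leaf, Leaf)"
    using two_trees_subtree tree_quiver_two_trees[OF D] by metis
  then have "l' = Leaf" "r' = Leaf" using end_vertex_two_trees[OF T(1) f(1)] by auto
  then show ?thesis using lr by auto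
qed

text \<open>Works backwards from the end of the walk: the vertices below \<open>p ! i\<close>,
  together with it, receive consecutive labels starting at \<open>p ! i\<close>. The hypothesis
  \<open>step\<close> covers both rules of the procedure, because an empty sibling branch
  contributes no vertices and no root.\<close>

lemma walk_successor_labelling:
  assumes D: "distinct_tree t" and d: "descending t p" and f: "Node Leaf (last p) Leaf \<in> subtrees t"
    and step: "\<And>i s s'. i + 1 < length p \<Longrightarrow> branch t (p ! i) s s' \<Longrightarrow> p ! (i + 1) \<in> root_set s \<Longrightarrow>
      L (p ! (i + 1)) = L (p ! i) + card (set_tree s') + 1 \<and>
      (\<forall>z\<in>root_set s'. \<exists>\<sigma>. successor_labelling (adjacent t) (three_cycle (tree_quiver t)) (set_tree s') L (L (p ! i)) z \<sigma>)"
    and "i < length p" "Node l (p ! i) r \<in> subtrees t" "L (p ! i) = b + 1"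
  shows "\<exists>\<sigma>. successor_labelling (adjacent t) (three_cycle (tree_quiver t)) (set_tree (Node l (p ! i) r)) L b (last p) \<sigma>"
  using assms(5-7)
proof (induction "length p - i" arbitrary: i l r b)
  case 0
  then show ?case by simp
next
  case (Suc k)
  show ?case
  proof (cases "i + 1 < length p")
    case False
    then have i: "p ! i = last p" using Suc.prems(1) by (metis Suc_eq_plus1 Suc_lessI diff_Suc_1 last_conv_nth length_0_conv not_less0)
    then have "l = Leaf" "r = Leaf" using subtree_unique[OF D _ f] Suc.prems(2) by auto
    then show ?thesis using successor_labelling_singleton[of L "p ! i"] Suc.prems(3) i by auto
  next
    case True
    obtain s s' where b: "branch t (p ! i) s s'" "p ! (i + 1) \<in> root_set s"
      using descending_next[OF d True] by blast
    have lr: "set_tree (Node l (p ! i) r) = insert (p ! i) (set_tree s' \<union> set_tree s)"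
      using branch_unique[OF D b(1), of l r] Suc.prems(2) unfolding branch_def by auto
    note b' = branch_sym[OF b(1)]
    obtain l2 r2 where s: "s = Node l2 (p ! (i + 1)) r2" using b(2) by (cases s) auto
    have st: "L (p ! (i + 1)) = b + 1 + card (set_tree s') + 1"
      "\<And>z. z \<in> root_set s' \<Longrightarrow> \<exists>\<sigma>. successor_labelling (adjacent t) (three_cycle (tree_quiver t)) (set_tree s') L (b + 1) z \<sigma>"
      using step[OF True b] Suc.prems(3) by auto
    obtain \<sigma>2 where S2: "successor_labelling (adjacent t) (three_cycle (tree_quiver t)) (set_tree s) L
        (b + 1 + card (set_tree s')) (last p) \<sigma>2"
    proof -
      have "k = length p - (i + 1)" using Suc.hyps(2) by simp
      from Suc.hyps(1)[OF this True branch_subtree[OF b(1), unfolded s] st(1), folded s]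
      show thesis using that by blast
    qed
    have y: "p ! (i + 1) \<in> set_tree s" using b(2) by auto
    \<comment> \<open>Within either branch the current vertex is joined to the root alone.\<close>
    have adj: "adjacent t (p ! i) v \<longleftrightarrow> v \<in> root_set u" if "branch t (p ! i) u u'" "v \<in> set_tree u" for u u' v
    proof
      assume "adjacent t (p ! i) v"
      then show "v \<in> root_set u"
        using adjacent_leaving[OF D that(1) adjacent_sym that(2)] branch_disjoint(1)[OF D that(1)] by blast
    next
      assume "v \<in> root_set u"
      then show "adjacent t (p ! i) v" using that(1) child_branch child_adjacent by metis
    qed
    have dj: "set_tree s' \<inter> set_tree s = {}" using branch_disjoint(2)[OF D b'] .
    have rs: "root_set s = {p ! (i + 1)}" using root_not_Leaf[OF b(2)] .
    show ?thesis
    proof (cases s')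
      case Leaf
      then have "successor_labelling (adjacent t) (three_cycle (tree_quiver t)) (insert (p ! i) (set_tree s)) L b (last p) (\<sigma>2(b + 1 := b + 2))"
        using successor_labelling_insert[of _ _ "set_tree s" L b "last p" \<sigma>2 "p ! (i + 1)" "p ! i"]
          S2 y st(1) Suc.prems(3) adj[OF b(1)] rs by simp
      then show ?thesis unfolding lr using Leaf by auto
    next
      case (Node l3 z r3)
      then have rs': "root_set s' = {z}" by simp
      obtain \<sigma>1 where S1: "successor_labelling (adjacent t) (three_cycle (tree_quiver t)) (set_tree s') L (b + 1) z \<sigma>1"
        using st(2)[of z] rs' by auto
      have tc: "three_cycle (tree_quiver t) (p ! i) z (p ! (i + 1))"
        using branch_three_cycle[OF b'] rs' b(2) by simp
      have zy: "adjacent t z (p ! (i + 1))" using three_cycle_adjacent[OF tc] by simp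
      have cross: "adjacent t u v \<longleftrightarrow> u = z \<and> v = p ! (i + 1)" if "u \<in> set_tree s'" "v \<in> set_tree s" for u v
      proof
        assume a: "adjacent t u v"
        have "u \<notin> set_tree s" "v \<notin> set_tree s'" using that dj by auto
        then have "u \<in> root_set s'" "v \<in> root_set s"
          using adjacent_leaving[OF D b' a that(1)] adjacent_leaving[OF D b(1) adjacent_sym[OF a] that(2)] by auto
        then show "u = z \<and> v = p ! (i + 1)" using rs rs' by auto
      qed (use zy in auto)
      have "adjacent t (p ! i) v \<longleftrightarrow> v = z \<or> v = p ! (i + 1)" if "v \<in> set_tree s' \<union> set_tree s" for v
      proof (cases "v \<in> set_tree s")
        case True
        have "z \<in> set_tree s'" using Node by simp
        then have "v \<noteq> z" using True dj by blast
        then show ?thesis using adj[OF b(1) True] rs by auto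
      next
        case False
        then have "v \<in> set_tree s'" "v \<noteq> p ! (i + 1)" using that y by auto
        then show ?thesis using adj[OF b'] rs' by auto
      qed
      from successor_labelling_triangle[OF S1 S2 y _ Suc.prems(3) tc this cross] st(1)
      show ?thesis unfolding lr by auto
    qed
  qed
qed

text \<open>With \<open>e\<close> as the root of the tree the prescribed string descends, its
  complementary vertices are the roots of the sibling branches, and the recursive calls run on these
  branches. Rule induction supplies their successor functions.\<close>

theorem labelling_A_successor_labelling:
  assumes "labelling_A Q e f L" "type_A Q"
  shows "\<exists>\<sigma>. successor_labelling (\<lambda>x y. edges Q x y > 0) (three_cycle Q) (verts Q) L 0 f \<sigma>"
  using assms
proof (induction rule: labelling_A.induct)
  case (single Q x L)
  then show ?case using successor_labelling_singleton[of L x 0] by auto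
next
  case (walk Q e f p L)
  obtain l r where D: "distinct_tree (Node l e r)" and Q: "Q = tree_quiver (Node l e r)"
    using end_vertex_tree[OF walk.prems walk.hyps(2)] .
  define t where "t = Node l e r"
  note D = D[folded t_def] and Q = Q[folded t_def]
  have p: "p \<noteq> []" "string_in Q p" "hd p = e" "last p = f"
    using walk.hyps(5) by (auto simp: string_from_to_def string_in_def)
  have d: "descending t p" using string_descending[OF D] p Q by (simp add: t_def)
  have f: "Node Leaf (last p) Leaf \<in> subtrees t"
    using end_vertex_childless[of l e r f] D Q walk.hyps(3,4) p by (simp add: t_def)
  have step: "L (p ! (i + 1)) = L (p ! i) + card (set_tree s') + 1 \<and>
      (\<forall>z\<in>root_set s'. \<exists>\<sigma>. successor_labelling (adjacent t) (three_cycle (tree_quiver t)) (set_tree s') L (L (p ! i)) z \<sigma>)"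
    if i: "i + 1 < length p" and b: "branch t (p ! i) s s'" "p ! (i + 1) \<in> root_set s" for i s s'
  proof (cases s')
    case Leaf
    \<comment> \<open>Without a sibling there is no complementary vertex, so the rule adding 1
      applies.\<close>
    then have "\<not> primary_on Q p (p ! i) y z" for y z
      using primary_on_descending[OF D d i b] Q by auto
    then show ?thesis using walk.hyps(7) i Leaf by simp
  next
    case (Node l3 z r3)
    then have z: "z \<in> root_set s'" by simp
    have pr: "primary_on Q p (p ! i) (p ! (i + 1)) z" using descending_primary_on[OF D d i b z] Q by simp
    have R: "rooted Q z (p ! i) (p ! (i + 1)) = tree_quiver s'"
      using rooted_tree_quiver[OF D b z] Q by simp
    have Ds: "distinct_tree s'" and sub: "s' \<in> subtrees t"
      using branch_disjoint(3)[OF D branch_sym[OF b(1)]] branch_subtree[OF branch_sym[OF b(1)]] by auto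
    have vs: "verts (tree_quiver s') = set_tree s'" by (simp add: tree_quiver_def)
    obtain L' \<sigma> where L': "successor_labelling (\<lambda>x y. edges (tree_quiver s') x y > 0) (three_cycle (tree_quiver s')) (set_tree s') L' 0 z \<sigma>"
      "\<forall>w\<in>set_tree s'. L w = L' w + L (p ! i)"
      using walk.IH[rule_format, OF i pr] type_A_tree_quiver[OF Ds] Node unfolding R vs by blast
    have "successor_labelling (adjacent t) (three_cycle (tree_quiver t)) (set_tree s') L (L (p ! i)) z (\<lambda>j. \<sigma> (j - L (p ! i)) + L (p ! i))"
    proof (rule successor_labelling_shift[OF L'(1)])
      show "adjacent t x y \<longleftrightarrow> 0 < edges (tree_quiver s') x y" if "x \<in> set_tree s'" "y \<in> set_tree s'" for x y
        using adjacent_subtree[OF D sub that] edges_tree_quiver[OF Ds] by simp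
      show "three_cycle (tree_quiver t) x y w" if "x \<in> set_tree s'" "y \<in> set_tree s'" "w \<in> set_tree s'"
        "three_cycle (tree_quiver s') x y w" for x y w
        using that(4) tree_arrows_subtree[OF D sub] that(1-3) by (simp add: three_cycle_def tree_quiver_def)
    qed (use L'(2) in auto)
    moreover have "L (p ! (i + 1)) = L (p ! i) + card (set_tree s') + 1"
      using walk.IH[rule_format, OF i pr] unfolding R vs by blast
    ultimately show ?thesis using Node by auto
  qed
  have hd: "p ! 0 = e" using p by (simp add: hd_conv_nth)
  have "\<exists>\<sigma>. successor_labelling (adjacent t) (three_cycle (tree_quiver t)) (set_tree (Node l (p ! 0) r)) L 0 (last p) \<sigma>"
    by (rule walk_successor_labelling[OF D d f step]) (use p hd walk.hyps(6) in \<open>auto simp: t_def\<close>)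
  moreover have "(\<lambda>x y. edges Q x y > 0) = adjacent t"
    using edges_tree_quiver[OF D] Q by (auto simp: fun_eq_iff)
  ultimately show ?case using Q hd p by (simp add: t_def tree_quiver_def)
qed

section \<open>The root system of type D\<close>

definition D_frame :: "nat \<Rightarrow> (nat \<Rightarrow> 'a::real_inner) \<Rightarrow> (nat \<Rightarrow> 'a) \<Rightarrow> bool" where
  "D_frame n \<alpha> e \<longleftrightarrow>
     (\<forall>i\<in>{1..n}. \<forall>j\<in>{1..n}. e i \<bullet> e j = of_bool (i = j)) \<and> e (n + 1) = - e 1 \<and>
     (\<forall>i\<in>{1..n-1}. \<alpha> i = e i - e (i + 1)) \<and> \<alpha> n = e (n - 1) + e n"

text \<open>The desired relations are solved for \<open>e\<close>, starting at the fork of the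
  diagram. Orthonormality then follows from the inner products of the simple roots, computed by
  descending induction.\<close>

lemma D_frame_exists:
  fixes \<alpha> :: "nat \<Rightarrow> 'a::euclidean_space"
  assumes n: "n \<ge> 4" and R: "root_system_D n \<Phi> \<alpha>"
  obtains e where "D_frame n \<alpha> e"
proof -
  have in\<Phi>: "\<alpha> i \<in> \<Phi>" if "i \<in> {1..n}" for i
    using R that unfolding root_system_D_def simple_system_def by blast
  have \<alpha>: "\<alpha> i \<bullet> \<alpha> j = (if i = j then 2 else if dynkin_D n i j then -1 else 0)"
    if "i \<in> {1..n}" "j \<in> {1..n}" for i j
    using R in\<Phi> that unfolding root_system_D_def by auto
  \<comment> \<open>Half the sum and half the difference of the last two simple roots give
    \<open>e (n-1)\<close> and \<open>e n\<close>. Earlier coordinates arise by adding simple roots,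
    and index \<open>n + 1\<close> carries the negative of \<open>e 1\<close>.\<close>
  define e where "e j = (if j = n + 1 then - ((\<Sum>k=1..n-2. \<alpha> k) + (1/2) *\<^sub>R (\<alpha> (n-1) + \<alpha> n))
     else if j = n then (1/2) *\<^sub>R (\<alpha> n - \<alpha> (n-1))
     else (\<Sum>k=j..n-2. \<alpha> k) + (1/2) *\<^sub>R (\<alpha> (n-1) + \<alpha> n))" for j
  have en: "e n = (1/2) *\<^sub>R (\<alpha> n - \<alpha> (n-1))" by (simp add: e_def)
  have en1: "e (n - 1) = (1/2) *\<^sub>R (\<alpha> (n-1) + \<alpha> n)"
  proof -
    have "n - 1 \<noteq> n" "n - 1 \<noteq> n + 1" "{n-1..n-2} = {}" using n by auto
    then show ?thesis by (simp only: e_def if_False sum.empty add_0)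
  qed
  have es: "e j = \<alpha> j + e (j + 1)" if "j \<le> n - 2" for j
  proof -
    have "j \<noteq> n" "j \<noteq> n + 1" "j + 1 \<noteq> n" "j + 1 \<noteq> n + 1" using that n by auto
    moreover have "(\<Sum>k=j..n-2. \<alpha> k) = \<alpha> j + (\<Sum>k=j+1..n-2. \<alpha> k)"
      using that by (simp add: sum.atLeast_Suc_atMost)
    ultimately show ?thesis by (simp only: e_def if_False add.assoc)
  qed
  have half: "(1/2::real) *\<^sub>R x + (1/2) *\<^sub>R x = x" for x :: 'a
    by (metis scaleR_half_double scaleR_right_distrib)
  \<comment> \<open>Downward induction with the two base cases \<open>n\<close> and
    \<open>n - 1\<close>, because the recursion \<open>es\<close> starts only at
    \<open>n - 2\<close>.\<close>
  have ind: "P j" if "1 \<le> j" "j \<le> n" and "P n" "P (n - 1)" and step: "\<And>j. 1 \<le> j \<Longrightarrow> j \<le> n - 2 \<Longrightarrow> P (j + 1) \<Longrightarrow> P j" for P and j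
  proof (cases "j = n")
    case False
    then have "j \<le> n - 1" using that(2) by simp
    then show ?thesis
      by (rule inc_induct) (use that n in auto)
  qed (use that in simp)
  have \<alpha>e: "\<alpha> i \<bullet> e j = (if i = n then of_bool (j = n - 1) + of_bool (j = n) else of_bool (i = j) - of_bool (i + 1 = j))"
    if j: "1 \<le> j" "j \<le> n" and i: "i \<in> {1..n}" for i j
  proof (rule ind[OF j])
    show "\<alpha> i \<bullet> e n = (if i = n then of_bool (n = n - 1) + of_bool (n = n) else of_bool (i = n) - of_bool (i + 1 = n))"
      unfolding en using \<alpha>[OF i, of n] \<alpha>[OF i, of "n - 1"] n i
      by (auto simp: inner_diff_right dynkin_D_def)
    show "\<alpha> i \<bullet> e (n - 1) = (if i = n then of_bool (n - 1 = n - 1) + of_bool (n - 1 = n) else of_bool (i = n - 1) - of_bool (i + 1 = n - 1))"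
      unfolding en1 using \<alpha>[OF i, of n] \<alpha>[OF i, of "n - 1"] n i
      by (auto simp: inner_add_right dynkin_D_def)
  next
    fix j assume j: "1 \<le> j" "j \<le> n - 2"
      and IH: "\<alpha> i \<bullet> e (j + 1) = (if i = n then of_bool (j + 1 = n - 1) + of_bool (j + 1 = n) else of_bool (i = j + 1) - of_bool (i + 1 = j + 1))"
    have jn: "j \<in> {1..n}" using j by auto
    have eq: "\<alpha> i \<bullet> e j = \<alpha> i \<bullet> \<alpha> j + \<alpha> i \<bullet> e (j + 1)" using es[OF j(2)] by (simp add: inner_add_right)
    show "\<alpha> i \<bullet> e j = (if i = n then of_bool (j = n - 1) + of_bool (j = n) else of_bool (i = j) - of_bool (i + 1 = j))"
    proof -
      \<comment> \<open>This substitution removes the truncated subtractions from the case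
        analysis.\<close>
      obtain N where N: "n = N + 4" using n by (metis le_iff_add add.commute)
      have D: "dynkin_D n i j \<longleftrightarrow> i \<noteq> n \<and> (j = i + 1 \<or> i = j + 1) \<or> i = n \<and> j = n - 2"
        using j i by (auto simp: dynkin_D_def N)
      consider "i = n" | "i \<noteq> n" "i = j" | "i \<noteq> n" "i = j + 1" | "i \<noteq> n" "j = i + 1" | "i \<noteq> n" "i \<noteq> j" "i \<noteq> j + 1" "j \<noteq> i + 1"
        by blast
      then show ?thesis
        unfolding eq IH \<alpha>[OF i jn] D by cases (use j in \<open>simp_all add: N\<close>)
    qed
  qed
  have ee: "e i \<bullet> e j = of_bool (i = j)" if "1 \<le> i" "i \<le> n" and j: "1 \<le> j" "j \<le> n" for i j
  proof (rule ind[OF that(1,2)])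
    show "e n \<bullet> e j = of_bool (n = j)"
      unfolding en using \<alpha>e[OF j, of n] \<alpha>e[OF j, of "n - 1"] n j by (auto simp: inner_diff_left)
    show "e (n - 1) \<bullet> e j = of_bool (n - 1 = j)"
      unfolding en1 using \<alpha>e[OF j, of n] \<alpha>e[OF j, of "n - 1"] n j by (auto simp: inner_add_left)
  next
    fix i assume i: "1 \<le> i" "i \<le> n - 2" and IH: "e (i + 1) \<bullet> e j = of_bool (i + 1 = j)"
    have i': "i \<in> {1..n}" using i by auto
    have eq: "e i \<bullet> e j = \<alpha> i \<bullet> e j + e (i + 1) \<bullet> e j" using es[OF i(2)] by (simp add: inner_add_left)
    show "e i \<bullet> e j = of_bool (i = j)" unfolding eq IH \<alpha>e[OF j i'] using i n by auto
  qed
  have "D_frame n \<alpha> e"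
    unfolding D_frame_def
  proof (intro conjI ballI)
    show "e i \<bullet> e j = of_bool (i = j)" if "i \<in> {1..n}" "j \<in> {1..n}" for i j using ee that by simp
    show "e (n + 1) = - e 1" using n by (simp add: e_def)
    show "\<alpha> n = e (n - 1) + e n"
      unfolding en en1 by (simp add: scaleR_diff_right scaleR_add_right half)
    fix i assume i: "i \<in> {1..n-1}"
    show "\<alpha> i = e i - e (i + 1)"
    proof (cases "i = n - 1")
      case True
      then show ?thesis using n en en1 by (simp add: scaleR_diff_right scaleR_add_right half)
    next
      case False
      then have "i \<le> n - 2" using i by auto
      then show ?thesis using es[of i] by simp
    qed
  qed
  then show thesis using that by blast
qed

lemma D_frame_inner:
  assumes "D_frame n \<alpha> e" "i \<in> {1..n+1}" "j \<in> {1..n+1}" "n > 0"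
  shows "e i \<bullet> e j = of_bool (i = j) - of_bool (i = 1 \<and> j = n + 1 \<or> i = n + 1 \<and> j = 1)"
proof -
  have o: "e i \<bullet> e j = of_bool (i = j)" if "i \<in> {1..n}" "j \<in> {1..n}" for i j
    using assms(1) that by (simp add: D_frame_def)
  have w: "e (n + 1) = - e 1" using assms(1) by (simp add: D_frame_def)
  consider "i \<le> n" "j \<le> n" | "i = n + 1" "j \<le> n" | "i \<le> n" "j = n + 1" | "i = n + 1" "j = n + 1"
    using assms(2,3) by fastforce
  then show ?thesis
    by cases (use o[of i j] o[of 1 j] o[of i 1] o[of 1 1] w assms(2-4) in auto)
qed

section \<open>Roots as differences of coordinates\<close>

lemma D_frame_sum:
  assumes "D_frame n \<alpha> e" "1 \<le> i" "i \<le> j + 1" "j < n"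
  shows "(\<Sum>k=i..j. \<alpha> k) = e i - e (j + 1)"
proof (cases "i = j + 1")
  case False
  have "(\<Sum>k=i..j. \<alpha> k) = (\<Sum>k=i..j. e k - e (Suc k))"
    using assms by (intro sum.cong) (auto simp: D_frame_def)
  also have "\<dots> = e i - e (j + 1)"
    using sum_Suc_diff[of i j "\<lambda>k. - e k"] assms False by simp
  finally show ?thesis .
qed simp

text \<open>The reflection of \<open>b\<close> in \<open>a\<close> adds \<open>a\<close> once,
  because the roots have square length 2.\<close>

lemma reflection_sum:
  assumes "root_system_D n \<Phi> \<alpha>" "a \<in> \<Phi>" "b \<in> \<Phi>" "b \<bullet> a = -1"
  shows "a + b \<in> \<Phi>"
proof -
  have "a \<bullet> a = 2" using assms(1,2) by (simp add: root_system_D_def)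
  moreover have "b - (2 * (b \<bullet> a) / (a \<bullet> a)) *\<^sub>R a \<in> \<Phi>"
    using assms(1-3) unfolding root_system_D_def root_system_def by blast
  ultimately show ?thesis using assms(4) by (simp add: add.commute)
qed

text \<open>Starting from simple roots, each such difference is reached by adding roots with inner
  product -1. The excluded pair would give twice \<open>e 1\<close>, which is not a root.\<close>

lemma D_frame_roots:
  assumes n: "n \<ge> 4" and R: "root_system_D n \<Phi> \<alpha>" and F: "D_frame n \<alpha> e"
    and ij: "1 \<le> i" "i < j" "j \<le> n + 1" "\<not> (i = 1 \<and> j = n + 1)"
  shows "e i - e j \<in> \<Phi>"
proof -
  have in\<Phi>: "\<alpha> i \<in> \<Phi>" if "i \<in> {1..n}" for i
    using R that unfolding root_system_D_def simple_system_def by blast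
  have \<alpha>: "\<alpha> i = e i - e (i + 1)" if "1 \<le> i" "i < n" for i using F that by (simp add: D_frame_def)
  have \<alpha>n: "\<alpha> n = e (n - 1) + e n" and w: "e (n + 1) = - e 1" using F by (auto simp: D_frame_def)
  have o: "e i \<bullet> e j = of_bool (i = j)" if "i \<in> {1..n}" "j \<in> {1..n}" for i j
    using F that by (simp add: D_frame_def)
  have minus: "e i - e j \<in> \<Phi>" if i: "1 \<le> i" and "i < j" "j \<le> n" for i j
  proof -
    have "Suc i \<le> j" using that by simp
    then show ?thesis using that(3)
    proof (induction j rule: dec_induct)
      case base
      then show ?case using \<alpha>[of i] in\<Phi>[of i] i by simp
    next
      case (step j)
      have "\<alpha> j + (e i - e j) \<in> \<Phi>"
        using step i \<alpha>[of j] by (intro reflection_sum[OF R in\<Phi>]) (auto simp: inner_diff_left inner_diff_right o)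
      then show ?case using \<alpha>[of j] step i by simp
    qed
  qed
  have p1: "e 1 + e n \<in> \<Phi>"
  proof -
    \<comment> \<open>The first root with two plus signs; the remaining sums
      \<open>e 1 + e i\<close> are obtained from it by adding \<open>e i - e n\<close>.\<close>
    have "\<alpha> n + (e 1 - e (n - 1)) \<in> \<Phi>"
      using n \<alpha>n by (intro reflection_sum[OF R in\<Phi> minus]) (auto simp: inner_diff_left inner_add_right o)
    then show ?thesis using \<alpha>n by (simp add: algebra_simps)
  qed
  have plus: "e 1 + e i \<in> \<Phi>" if "1 < i" "i \<le> n" for i
  proof (cases "i = n")
    case False
    then have "(e i - e n) + (e 1 + e n) \<in> \<Phi>"
      using that n by (intro reflection_sum[OF R minus p1]) (auto simp: inner_diff_right inner_add_left o)
    then show ?thesis by (simp add: algebra_simps)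
  qed (use p1 in simp)
  show ?thesis
  proof (cases "j = n + 1")
    case True
    then show ?thesis using plus[of i] ij w by (simp add: add.commute)
  next
    case False
    then show ?thesis using minus ij by simp
  qed
qed

text \<open>The middle term comes from the wrap-around: \<open>e 1\<close> and
  \<open>e (n + 1)\<close> have inner product -1. The inequalities rule out all other coincidences
  of indices.\<close>

lemma D_frame_inner_differences:
  assumes F: "D_frame n \<alpha> e" and ij: "1 \<le> i" "i < j" "j \<le> n" and s: "i < s" "s \<le> n + 1" and t: "j < t" "t \<le> n + 1"
  shows "(e i - e s) \<bullet> (e j - e t) = of_bool (s = t) + of_bool (i = 1 \<and> t = n + 1) - of_bool (s = j)"
  using assms by (auto simp: inner_diff_left inner_diff_right D_frame_inner[OF F])

section \<open>The root lattice and its bases\<close>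

lemma zspan_simple_system:
  assumes "simple_system \<Phi> S" "finite S"
  shows "zmod.span \<Phi> = zmod.span S"
proof
  have nat_comb: "(\<Sum>a\<in>S. real (k a) *\<^sub>R a) \<in> zmod.span S" for k :: "'a \<Rightarrow> nat"
  proof -
    have "(\<Sum>a\<in>S. real (k a) *\<^sub>R a) = (\<Sum>a\<in>S. zscale (int (k a)) a)" by (simp add: zscale_def)
    then show ?thesis by (simp add: zmod.span_sum zmod.span_scale zmod.span_base)
  qed
  have "\<Phi> \<subseteq> zmod.span S"
  proof
    fix b assume "b \<in> \<Phi>"
    then obtain k :: "'a \<Rightarrow> nat" where "b = (\<Sum>a\<in>S. real (k a) *\<^sub>R a) \<or> b = - (\<Sum>a\<in>S. real (k a) *\<^sub>R a)"
      using assms(1) unfolding simple_system_def by blast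
    then show "b \<in> zmod.span S" using nat_comb[of k] zmod.span_neg[OF nat_comb[of k]] by auto
  qed
  then show "zmod.span \<Phi> \<subseteq> zmod.span S" using zmod.span_minimal zmod.subspace_span by blast
  show "zmod.span S \<subseteq> zmod.span \<Phi>" using assms(1) zmod.span_mono unfolding simple_system_def by blast
qed

lemma independent_zindependent:
  fixes B :: "'a::real_vector set"
  assumes "independent B"
  shows "zmod.independent B"
proof
  assume "zmod.dependent B"
  then obtain t u v where t: "finite t" "t \<subseteq> B" "(\<Sum>v\<in>t. zscale (u v) v) = 0" "v \<in> t" "u v \<noteq> 0"
    unfolding zmod.dependent_explicit by blast
  then have "(\<Sum>v\<in>t. real_of_int (u v) *\<^sub>R v) = 0" by (simp add: zscale_def)
  then have "dependent B" unfolding dependent_explicit using t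
    by (intro exI[of _ t] exI[of _ "\<lambda>v. real_of_int (u v)"]) auto
  then show False using assms by simp
qed

lemma zspan_subset_span: "zmod.span B \<subseteq> span (B :: 'a::real_vector set)"
proof (rule zmod.span_minimal[OF span_superset])
  show "zmod.subspace (span B)"
    unfolding zmod.subspace_def by (auto simp: zscale_def span_zero span_add span_scale)
qed

text \<open>Following \<sigma> upwards expresses all differences of coordinates, hence the simple
  roots, by the given \<open>n\<close> vectors. As they span a space of dimension \<open>n\<close>,
  they are linearly independent over the reals and so over the integers. The condition on
  \<open>\<sigma> 1\<close> avoids the vector twice \<open>e 1\<close>.\<close>

lemma D_frame_lattice_basis:
  fixes \<alpha> :: "nat \<Rightarrow> 'a::euclidean_space"
  assumes n: "n \<ge> 4" and R: "root_system_D n \<Phi> \<alpha>" and F: "D_frame n \<alpha> e"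
    and \<sigma>: "\<And>i. i \<in> {1..n} \<Longrightarrow> i < \<sigma> i \<and> \<sigma> i \<le> n + 1" and \<sigma>1: "\<sigma> 1 \<le> n"
  shows "lattice_basis (zmod.span \<Phi>) {1..n} (\<lambda>i. e i - e (\<sigma> i))"
proof -
  let ?b = "\<lambda>i. e i - e (\<sigma> i)"
  let ?B = "?b ` {1..n}"
  let ?S = "\<alpha> ` {1..n}"
  have simple: "simple_system \<Phi> ?S" and inj: "inj_on \<alpha> {1..n}" using R by (auto simp: root_system_D_def)
  have cardS: "card ?S = n" using inj by (simp add: card_image)
  have dim: "DIM('a) = n"
  proof -
    have "independent ?S" "span ?S = UNIV" using simple by (auto simp: simple_system_def)
    then have "card ?S = dim (UNIV :: 'a set)" by (metis dim_eq_card dim_span)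
    then show ?thesis using cardS by simp
  qed
  have diff: "e i - e j \<in> zmod.span ?B" if "i \<le> n + 1" "1 \<le> i" "i \<le> j" "j \<le> n + 1" for i j
    using that
  proof (induction i arbitrary: j rule: measure_induct_rule[where f = "\<lambda>i. n + 1 - i"])
    case (less i)
    show ?case
    proof (cases "i = j")
      case True
      then show ?thesis by (simp add: zmod.span_zero)
    next
      case False
      then have i: "i \<in> {1..n}" using less.prems by auto
      have b: "?b i \<in> zmod.span ?B" using i by (intro zmod.span_base) auto
      note s = \<sigma>[OF i]
      show ?thesis
      \<comment> \<open>The vector of index \<open>i\<close> either stops at or before
        \<open>j\<close> or overshoots it. In both cases the remaining difference has a larger
        smaller index.\<close>
      proof (cases "\<sigma> i \<le> j")
        case True
        have "e (\<sigma> i) - e j \<in> zmod.span ?B" using less.IH[of "\<sigma> i" j] s True less.prems i by auto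
        from zmod.span_add[OF b this] show ?thesis by simp
      next
        case False
        have "e j - e (\<sigma> i) \<in> zmod.span ?B"
          using less.IH[of j "\<sigma> i"] s False less.prems \<open>i \<noteq> j\<close> by auto
        from zmod.span_diff[OF b this] show ?thesis by simp
      qed
    qed
  qed
  have "?S \<subseteq> zmod.span ?B"
  proof clarify
    fix i assume i: "i \<in> {1..n}"
    show "\<alpha> i \<in> zmod.span ?B"
    proof (cases "i = n")
      case True
      \<comment> \<open>Since \<open>e (n + 1) = - e 1\<close>, the two occurrences of
        \<open>e 1\<close> cancel.\<close>
      have "\<alpha> n = (e n - e (n + 1)) - (e 1 - e (n - 1))" using F by (simp add: D_frame_def)
      then show ?thesis using zmod.span_diff[OF diff[of n "n + 1"] diff[of 1 "n - 1"]] n True by simp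
    next
      case False
      then have "i \<in> {1..n-1}" using i by auto
      then have "\<alpha> i = e i - e (i + 1)" using F by (simp add: D_frame_def)
      then show ?thesis using diff[of i "i + 1"] i by simp
    qed
  qed
  then have sub1: "zmod.span \<Phi> \<subseteq> zmod.span ?B"
    unfolding zspan_simple_system[OF simple finite_imageI[OF finite_atLeastAtMost]]
    using zmod.span_minimal zmod.subspace_span by blast
  have "?b i \<in> \<Phi>" if i: "i \<in> {1..n}" for i
    using \<sigma>[OF i] \<sigma>1 i n by (intro D_frame_roots[OF n R F]) auto
  then have sub2: "zmod.span ?B \<subseteq> zmod.span \<Phi>" by (intro zmod.span_mono) auto
  have "?S \<subseteq> span ?B"
    using \<open>?S \<subseteq> zmod.span ?B\<close> zspan_subset_span by blast
  then have sp: "span ?B = UNIV"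
    using simple span_minimal[OF _ subspace_span] unfolding simple_system_def by blast
  have "card ?B \<le> n" using card_image_le[of "{1..n}" ?b] by simp
  moreover have "DIM('a) \<le> card ?B"
    using sp dim_le_card'[of ?B] dim_span[of ?B] by simp
  ultimately have card: "card ?B = n" using dim by simp
  have "independent ?B"
    by (rule card_le_dim_spanning[of _ UNIV]) (use sp card dim in auto)
  moreover have "inj_on ?b {1..n}" by (rule eq_card_imp_inj_on) (use card in auto)
  ultimately show ?thesis
    unfolding lattice_basis_def using independent_zindependent sub1 sub2 by auto
qed

section \<open>Type IV quivers with all spikes\<close>

text \<open>What remains of the pieces \<open>G t\<close> once their labellings are understood:
  single edges inside the vertex set, and a successor function \<sigma> \<open>t\<close> on the
  block of labels following \<open>p t\<close>.\<close>

locale labelled_spikes =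
  fixes m :: nat and P c :: "nat \<Rightarrow> 'v" and G :: "nat \<Rightarrow> 'v quiver" and L :: "'v \<Rightarrow> nat"
    and a p :: "nat \<Rightarrow> nat" and \<sigma> :: "nat \<Rightarrow> nat \<Rightarrow> nat"
  assumes m: "m \<ge> 3"
    and a_def: "a = (\<lambda>j. card (verts (G j)))"
    and p_def: "p = central_label a"
    and inj_P: "inj_on P {1..m}" and inj_c: "inj_on c {1..m}"
    and P_c: "P ` {1..m} \<inter> c ` {1..m} = {}"
    and G_skeleton: "\<And>t. t \<in> {1..m} \<Longrightarrow> verts (G t) \<inter> verts (skeleton m P c) = {c t}"
    and G_disjoint: "\<And>t u. t \<in> {1..m} \<Longrightarrow> u \<in> {1..m} \<Longrightarrow> t \<noteq> u \<Longrightarrow> verts (G t) \<inter> verts (G u) = {}"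
    and L_P: "\<And>t. t \<in> {1..m} \<Longrightarrow> L (P t) = p t"
    and edges_le_1: "\<And>t x y. t \<in> {1..m} \<Longrightarrow> edges (G t) x y \<le> 1"
    and edges_in: "\<And>t x y. t \<in> {1..m} \<Longrightarrow> edges (G t) x y > 0 \<Longrightarrow> x \<in> verts (G t) \<and> y \<in> verts (G t)"
    and succ: "\<And>t. t \<in> {1..m} \<Longrightarrow>
      successor_labelling (\<lambda>x y. edges (G t) x y > 0) (three_cycle (G t)) (verts (G t)) L (p t) (c t) (\<sigma> t)"
begin

definition \<Gamma> :: "'v quiver" where
  "\<Gamma> = \<lparr>verts = verts (skeleton m P c) \<union> (\<Union>i\<in>{1..m}. verts (G i)),
         arr = (\<lambda>x y. arr (skeleton m P c) x y + (\<Sum>i=1..m. arr (G i) x y))\<rparr>"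

definition n :: nat where "n = m + (\<Sum>i=1..m. a i)"

section \<open>The blocks of labels on the central cycle\<close>

lemma p_Suc: "1 \<le> t \<Longrightarrow> p (t + 1) = p t + a t + 1"
  by (simp add: p_def central_label_def)

lemma p_1: "p 1 = 1"
  by (simp add: p_def central_label_def)

text \<open>The index after the last block takes the place of the first central vertex, just as
  \<open>e (n + 1)\<close> takes the place of \<open>e 1\<close> up to sign.\<close>

lemma p_last: "p (m + 1) = n + 1"
proof -
  have "{1..<m + 1} = {1..m}" by auto
  then show ?thesis by (simp add: p_def central_label_def n_def)
qed

lemma p_mono: "1 \<le> t \<Longrightarrow> t < u \<Longrightarrow> p (t + 1) \<le> p u"
proof -
  assume t: "1 \<le> t" and "t < u"
  then have "t + 1 \<le> u" by simp
  then show "p (t + 1) \<le> p u"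
  proof (induction u rule: dec_induct)
    case (step u)
    then show ?case using p_Suc[of u] t by simp
  qed simp
qed

lemma p_strict: "1 \<le> t \<Longrightarrow> t < u \<Longrightarrow> p t + a t < p u"
  using p_mono[of t u] p_Suc[of t] by simp

lemma c_in: "t \<in> {1..m} \<Longrightarrow> c t \<in> verts (G t)"
  using successor_labellingD(2)[OF succ] .

lemma a_pos: "t \<in> {1..m} \<Longrightarrow> a t > 0"
  using c_in successor_labellingD(1)[OF succ] by (auto simp: a_def card_gt_0_iff)

lemma L_c: "t \<in> {1..m} \<Longrightarrow> L (c t) = p t + a t"
  using successor_labellingD(4)[OF succ] by (simp add: a_def)

lemma L_G: "t \<in> {1..m} \<Longrightarrow> x \<in> verts (G t) \<Longrightarrow> p t < L x \<and> L x < p (t + 1)"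
  using successor_labelling_range[OF succ] p_Suc[of t] by (fastforce simp: a_def)

lemma interval_unique:
  assumes "t \<in> {1..m}" "u \<in> {1..m}" "p t \<le> i" "i < p (t + 1)" "p u \<le> i" "i < p (u + 1)"
  shows "t = u"
  using p_mono[of t u] p_mono[of u t] assms by (cases t u rule: linorder_cases) auto

lemma P_notin_G: "t \<in> {1..m} \<Longrightarrow> u \<in> {1..m} \<Longrightarrow> P t \<notin> verts (G u)"
  using G_skeleton[of u] P_c by (fastforce simp: skeleton_def)

lemma verts_cases:
  assumes "x \<in> verts \<Gamma>"
  obtains t where "t \<in> {1..m}" "x = P t" | t where "t \<in> {1..m}" "x \<in> verts (G t)"
  using assms c_in that unfolding \<Gamma>_def skeleton_def by auto

definition piece :: "nat \<Rightarrow> nat" where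
  "piece i = (THE t. t \<in> {1..m} \<and> p t \<le> i \<and> i < p (t + 1))"

text \<open>The global successor function. By the convention for last labels, the spike vertex
  \<open>c t\<close> points to \<open>p (t + 1)\<close> just as \<open>p t\<close> does, which
  encodes the spike as a 3-cycle.\<close>

definition next_label :: "nat \<Rightarrow> nat" where
  "next_label i = (if i = p (piece i) then p (piece i + 1) else \<sigma> (piece i) i)"

lemma piece_eq: "t \<in> {1..m} \<Longrightarrow> p t \<le> i \<Longrightarrow> i < p (t + 1) \<Longrightarrow> piece i = t"
  unfolding piece_def using interval_unique by (intro the_equality) auto

lemma next_label_p: "t \<in> {1..m} \<Longrightarrow> next_label (p t) = p (t + 1)"
  using piece_eq[of t "p t"] p_Suc[of t] by (simp add: next_label_def)

lemma next_label_inner: "t \<in> {1..m} \<Longrightarrow> p t < i \<Longrightarrow> i < p (t + 1) \<Longrightarrow> next_label i = \<sigma> t i"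
  using piece_eq[of t i] by (simp add: next_label_def)

lemma next_label_G: "t \<in> {1..m} \<Longrightarrow> x \<in> verts (G t) \<Longrightarrow> next_label (L x) = \<sigma> t (L x)"
  using next_label_inner L_G by blast

lemma next_label_c: "t \<in> {1..m} \<Longrightarrow> next_label (L (c t)) = p (t + 1)"
  using next_label_G[of t "c t"] c_in[of t] successor_labellingD(5)[OF succ, of t] L_c[of t] p_Suc[of t]
  by (simp add: a_def)

lemma next_label_less: "t \<in> {1..m} \<Longrightarrow> x \<in> verts (G t) \<Longrightarrow> x \<noteq> c t \<Longrightarrow> next_label (L x) < p (t + 1)"
  using next_label_G[of t x] successor_labelling_succ_le[OF succ, of t x] p_Suc[of t] by (simp add: a_def)

text \<open>Within a piece the spike vertex alone points out of the block, as it alone is attached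
  to the central cycle.\<close>

lemma next_label_eq_iff: "t \<in> {1..m} \<Longrightarrow> x \<in> verts (G t) \<Longrightarrow> next_label (L x) = p (t + 1) \<longleftrightarrow> x = c t"
  using next_label_less[of t x] next_label_c by fastforce

lemma next_label_G_bounds:
  "t \<in> {1..m} \<Longrightarrow> x \<in> verts (G t) \<Longrightarrow> L x < next_label (L x) \<and> next_label (L x) \<le> p (t + 1)"
  using next_label_G[of t x] successor_labelling_succ[OF succ, of t "L x"] L_G[of t x] p_Suc[of t]
  by (simp add: a_def)

section \<open>Labels as a bijection onto the index set\<close>

lemma label_bounds: "x \<in> verts \<Gamma> \<Longrightarrow> 1 \<le> L x \<and> L x \<le> n"
proof (erule verts_cases)
  fix t assume t: "t \<in> {1..m}" "x = P t"
  then show "1 \<le> L x \<and> L x \<le> n"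
    using L_P[of t] p_strict[of t "m + 1"] p_strict[of 1 t] p_1 p_last a_pos[of 1] m by (cases "t = 1") auto
next
  fix t assume t: "t \<in> {1..m}" "x \<in> verts (G t)"
  then show "1 \<le> L x \<and> L x \<le> n"
    using L_G[OF t] p_mono[of t "m + 1"] p_last by auto
qed

lemma next_label_bounds: "x \<in> verts \<Gamma> \<Longrightarrow> L x < next_label (L x) \<and> next_label (L x) \<le> n + 1"
proof (erule verts_cases)
  fix t assume t: "t \<in> {1..m}" "x = P t"
  then show "L x < next_label (L x) \<and> next_label (L x) \<le> n + 1"
    using L_P[of t] next_label_p[of t] p_Suc[of t] p_mono[of t "m + 1"] p_last by auto
next
  fix t assume t: "t \<in> {1..m}" "x \<in> verts (G t)"
  then show "L x < next_label (L x) \<and> next_label (L x) \<le> n + 1"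
    using next_label_G_bounds[OF t] p_mono[of t "m + 1"] p_last by auto
qed

lemma inj_L: "inj_on L (verts \<Gamma>)"
proof (rule inj_onI)
  have loc: "\<exists>t\<in>{1..m}. p t \<le> L x \<and> L x < p (t + 1) \<and> (x = P t \<and> L x = p t \<or> x \<in> verts (G t) \<and> L x \<noteq> p t)"
    if "x \<in> verts \<Gamma>" for x
    using that
  proof (rule verts_cases)
    fix t assume "t \<in> {1..m}" "x = P t"
    then show ?thesis using L_P[of t] p_Suc[of t] by (intro bexI[of _ t]) auto
  next
    fix t assume "t \<in> {1..m}" "x \<in> verts (G t)"
    then show ?thesis using L_G[of t x] by (intro bexI[of _ t]) auto
  qed
  fix x y assume x: "x \<in> verts \<Gamma>" and y: "y \<in> verts \<Gamma>" and xy: "L x = L y"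
  obtain t where t: "t \<in> {1..m}" "p t \<le> L x" "L x < p (t + 1)" "x = P t \<and> L x = p t \<or> x \<in> verts (G t) \<and> L x \<noteq> p t"
    using loc[OF x] by blast
  obtain u where u: "u \<in> {1..m}" "p u \<le> L y" "L y < p (u + 1)" "y = P u \<and> L y = p u \<or> y \<in> verts (G u) \<and> L y \<noteq> p u"
    using loc[OF y] by blast
  have "t = u" using interval_unique[OF t(1) u(1) t(2,3)] u(2,3) xy by simp
  then show "x = y"
    using t(4) u(4) xy successor_labellingD(3)[OF succ[OF t(1)]] by (auto simp: bij_betw_def inj_on_def)
qed

lemma card_verts: "card (verts \<Gamma>) = n"
proof -
  have fin: "finite (verts (G t))" if "t \<in> {1..m}" for t using successor_labellingD(1)[OF succ[OF that]] .
  have "verts \<Gamma> = P ` {1..m} \<union> (\<Union>i\<in>{1..m}. verts (G i))"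
    using c_in by (auto simp: \<Gamma>_def skeleton_def)
  moreover have "P ` {1..m} \<inter> (\<Union>i\<in>{1..m}. verts (G i)) = {}" using P_notin_G by blast
  moreover have "card (\<Union>i\<in>{1..m}. verts (G i)) = (\<Sum>i=1..m. a i)"
    unfolding a_def using fin G_disjoint by (intro card_UN_disjoint) auto
  moreover have "card (P ` {1..m}) = m" using inj_P by (simp add: card_image)
  ultimately show ?thesis using fin by (simp add: card_Un_disjoint n_def)
qed

lemma bij_L: "bij_betw L (verts \<Gamma>) {1..n}"
proof -
  have "L ` verts \<Gamma> \<subseteq> {1..n}" using label_bounds by auto
  moreover have "card (L ` verts \<Gamma>) = n" using card_image[OF inj_L] card_verts by simp
  ultimately have "L ` verts \<Gamma> = {1..n}" by (intro card_subset_eq) auto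
  then show ?thesis using inj_L by (simp add: bij_betw_def)
qed

text \<open>The first central vertex points to the second one, which is not the wrap-around index.
  Hence its root is not the excluded difference of \<open>e 1\<close> and
  \<open>e (n + 1)\<close>.\<close>

lemma next_label_1: "next_label 1 \<le> n"
proof -
  have "p (1 + 1) \<le> p m" "p m < p (m + 1)" using p_mono[of 1 m] p_Suc[of m] m by auto
  then show ?thesis using next_label_p[of 1] p_1 p_last m by simp
qed

section \<open>Edges of the skeleton and of the whole quiver\<close>

definition nx :: "nat \<Rightarrow> nat" where "nx t = (if t = m then 1 else t + 1)"

lemma nx_in: "t \<in> {1..m} \<Longrightarrow> nx t \<in> {1..m}"
  using m by (auto simp: nx_def)

lemma P_eq: "t \<in> {1..m} \<Longrightarrow> u \<in> {1..m} \<Longrightarrow> P t = P u \<longleftrightarrow> t = u"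
  by (rule inj_on_eq_iff[OF inj_P])

lemma c_eq: "t \<in> {1..m} \<Longrightarrow> u \<in> {1..m} \<Longrightarrow> c t = c u \<longleftrightarrow> t = u"
  by (rule inj_on_eq_iff[OF inj_c])

lemma P_neq_c: "t \<in> {1..m} \<Longrightarrow> u \<in> {1..m} \<Longrightarrow> P t \<noteq> c u"
  using P_c by blast

lemma arr_skeleton:
  "arr (skeleton m P c) x y = of_bool (\<exists>i\<in>{1..m}. x = P i \<and> y = P (nx i) \<or> x = P (nx i) \<and> y = c i \<or> x = c i \<and> y = P i)"
proof -
  have "succ_on_cycle m P i = P (nx i)" for i by (simp add: succ_on_cycle_def nx_def)
  then show ?thesis by (simp add: skeleton_def of_bool_def)
qed

lemma arr_skeleton_P_P:
  assumes "t \<in> {1..m}" "u \<in> {1..m}"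
  shows "arr (skeleton m P c) (P t) (P u) = of_bool (u = nx t)"
proof -
  have "(\<exists>i\<in>{1..m}. P t = P i \<and> P u = P (nx i) \<or> P t = P (nx i) \<and> P u = c i \<or> P t = c i \<and> P u = P i) \<longleftrightarrow> u = nx t"
    using assms nx_in P_eq P_neq_c by metis
  then show ?thesis by (simp only: arr_skeleton)
qed

lemma arr_skeleton_P_c:
  assumes "t \<in> {1..m}" "u \<in> {1..m}"
  shows "arr (skeleton m P c) (P t) (c u) = of_bool (t = nx u)"
proof -
  have "(\<exists>i\<in>{1..m}. P t = P i \<and> c u = P (nx i) \<or> P t = P (nx i) \<and> c u = c i \<or> P t = c i \<and> c u = P i) \<longleftrightarrow> t = nx u"
    using assms nx_in P_eq c_eq P_neq_c by metis
  then show ?thesis by (simp only: arr_skeleton)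
qed

lemma arr_skeleton_c_P:
  assumes "t \<in> {1..m}" "u \<in> {1..m}"
  shows "arr (skeleton m P c) (c t) (P u) = of_bool (t = u)"
proof -
  have "(\<exists>i\<in>{1..m}. c t = P i \<and> P u = P (nx i) \<or> c t = P (nx i) \<and> P u = c i \<or> c t = c i \<and> P u = P i) \<longleftrightarrow> t = u"
    using assms nx_in P_eq c_eq P_neq_c by metis
  then show ?thesis by (simp only: arr_skeleton)
qed

lemma arr_skeleton_c_c:
  assumes "t \<in> {1..m}" "u \<in> {1..m}"
  shows "arr (skeleton m P c) (c t) (c u) = 0"
proof -
  have "\<not> (\<exists>i\<in>{1..m}. c t = P i \<and> c u = P (nx i) \<or> c t = P (nx i) \<and> c u = c i \<or> c t = c i \<and> c u = P i)"
    using assms nx_in P_neq_c by metis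
  then show ?thesis unfolding arr_skeleton by simp
qed

lemma arr_skeleton_in: "arr (skeleton m P c) x y > 0 \<Longrightarrow> x \<in> verts (skeleton m P c) \<and> y \<in> verts (skeleton m P c)"
  unfolding arr_skeleton using nx_in by (auto simp: skeleton_def split: if_splits)

lemma edges_skeleton_not_c:
  assumes "t \<in> {1..m}" "x \<in> verts (G t)" "x \<noteq> c t"
  shows "edges (skeleton m P c) x y = 0" "edges (skeleton m P c) y x = 0"
proof -
  have "x \<notin> verts (skeleton m P c)" using assms G_skeleton by blast
  then show "edges (skeleton m P c) x y = 0" "edges (skeleton m P c) y x = 0"
    using arr_skeleton_in[of x y] arr_skeleton_in[of y x] by (auto simp: edges_def)
qed

lemma edges_\<Gamma>: "edges \<Gamma> x y = edges (skeleton m P c) x y + (\<Sum>i=1..m. edges (G i) x y)"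
  by (simp add: edges_def \<Gamma>_def sum.distrib)

lemma edges_G_sum_zero:
  assumes "\<And>t. t \<in> {1..m} \<Longrightarrow> x \<notin> verts (G t) \<or> y \<notin> verts (G t)"
  shows "(\<Sum>i=1..m. edges (G i) x y) = 0"
  using assms edges_in by (intro sum.neutral) (metis gr0I)

text \<open>The third alternative is the wrap-around: \<open>P m\<close> and \<open>c m\<close> both
  point to \<open>n + 1\<close>, which stands for \<open>P 1\<close>, and both are joined to
  \<open>P 1\<close>. Pairs are compared according to whether each vertex is central or lies in a
  piece.\<close>

lemma edges_\<Gamma>_next_label:
  assumes "x \<in> verts \<Gamma>" "y \<in> verts \<Gamma>" and xy: "L x < L y"
  shows "edges \<Gamma> x y = of_bool (next_label (L x) = L y \<or> next_label (L x) = next_label (L y) \<or>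
     L x = 1 \<and> next_label (L y) = n + 1)"
  using assms(1)
proof (cases rule: verts_cases)
  case x: (1 t)
  have Lx: "L x = p t" and nlx: "next_label (L x) = p (t + 1)" using x L_P next_label_p by auto
  have one: "L x = 1 \<longleftrightarrow> t = 1"
    using p_1 p_strict[of 1 t] x(1) a_pos[of 1] m by (cases "t = 1") (auto simp: Lx)
  show ?thesis
    using assms(2)
  proof (cases rule: verts_cases)
    case y: (1 u)
    have Ly: "L y = p u" and nly: "next_label (p u) = p (u + 1)" using y L_P next_label_p by auto
    have tu: "t < u"
      using xy p_strict[of u t] x(1) y(1) by (cases t u rule: linorder_cases) (auto simp: Lx Ly)
    have "(\<Sum>i=1..m. edges (G i) x y) = 0" using P_notin_G x by (intro edges_G_sum_zero) auto
    moreover have "edges (skeleton m P c) x y = of_bool (u = nx t) + of_bool (t = nx u)"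
      using x y arr_skeleton_P_P by (simp add: edges_def)
    moreover have "p (t + 1) = p u \<longleftrightarrow> u = t + 1"
      using p_strict[of "t + 1" u] tu x(1) by (cases "u = t + 1") auto
    moreover have "p (t + 1) \<noteq> p (u + 1)" using p_strict[of "t + 1" "u + 1"] tu by simp
    moreover have "p (u + 1) = n + 1 \<longleftrightarrow> u = m"
      using p_strict[of "u + 1" "m + 1"] y(1) p_last by (cases "u = m") auto
    moreover have "u = nx t \<longleftrightarrow> u = t + 1" "t = nx u \<longleftrightarrow> u = m \<and> t = 1"
      using tu x(1) y(1) by (auto simp: nx_def)
    \<comment> \<open>With at least three central vertices, the closing edge differs from the edges
      to the next vertex, so no edge is counted twice.\<close>
    moreover have "\<not> (u = t + 1 \<and> u = m \<and> t = 1)" using m by auto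
    ultimately show ?thesis unfolding edges_\<Gamma> nlx Ly nly one by (auto simp: of_bool_def)
  next
    case y: (2 u)
    have tu: "t \<le> u" using xy L_G[OF y] p_mono[of u t] x(1) y(1) Lx by (cases "t \<le> u") auto
    have "(\<Sum>i=1..m. edges (G i) x y) = 0" using P_notin_G x by (intro edges_G_sum_zero) auto
    \<comment> \<open>A central vertex meets a later piece only at its spike vertex: either it has
      the same index, so that both point to \<open>p (u + 1)\<close>, or it is \<open>P 1\<close>
      and the piece is the last one.\<close>
    moreover have "edges (skeleton m P c) x y = of_bool (y = c u \<and> (t = u \<or> t = nx u))"
    proof (cases "y = c u")
      case True
      then have "edges (skeleton m P c) x y = of_bool (t = nx u) + of_bool (u = t)"
        using x y(1) arr_skeleton_P_c arr_skeleton_c_P by (simp add: edges_def)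
      moreover have "\<not> (t = nx u \<and> u = t)" using m by (auto simp: nx_def split: if_splits)
      ultimately show ?thesis using True by auto
    qed (use edges_skeleton_not_c[OF y] in simp)
    moreover have "p (t + 1) \<noteq> L y"
      using L_G[OF y] p_mono[of t u] tu x(1) by (cases "t = u") auto
    moreover have "p (t + 1) = next_label (L y) \<longleftrightarrow> t = u \<and> y = c u"
    proof (cases "t = u")
      case True
      then show ?thesis using next_label_eq_iff[OF y] by auto
    next
      case False
      then have "p (t + 1) \<le> p u" using p_mono tu x(1) by simp
      then show ?thesis using False next_label_G_bounds[OF y] L_G[OF y] by auto
    qed
    moreover have "next_label (L y) = n + 1 \<longleftrightarrow> u = m \<and> y = c u"
    proof (cases "u = m")
      case True
      then show ?thesis using next_label_eq_iff[OF y] p_last by auto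
    next
      case False
      then have "p (u + 1) < n + 1" using p_strict[of "u + 1" "m + 1"] y(1) p_last by auto
      then show ?thesis using False next_label_G_bounds[OF y] by auto
    qed
    moreover have "t = nx u \<longleftrightarrow> u = m \<and> t = 1" using tu x(1) y(1) by (auto simp: nx_def)
    ultimately show ?thesis unfolding edges_\<Gamma> nlx one by (auto simp: of_bool_def)
  qed
next
  case x: (2 t)
  have one: "L x \<noteq> 1" using L_G[OF x] p_strict[of 1 t] p_1 x(1) by (cases "t = 1") auto
  show ?thesis
    using assms(2)
  proof (cases rule: verts_cases)
    case y: (1 u)
    have Ly: "L y = p u" and nly: "next_label (p u) = p (u + 1)" using y L_P next_label_p by auto
    have tu: "t < u" using xy L_G[OF x] p_mono[of u t] p_Suc[of u] x(1) y(1) Ly by (cases t u rule: linorder_cases) auto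
    have "(\<Sum>i=1..m. edges (G i) x y) = 0" using P_notin_G y by (intro edges_G_sum_zero) auto
    moreover have "edges (skeleton m P c) x y = of_bool (x = c t \<and> u = t + 1)"
    proof (cases "x = c t")
      case True
      then show ?thesis using x(1) y tu arr_skeleton_c_P[of t u] arr_skeleton_P_c[of u t]
        by (auto simp: edges_def nx_def)
    qed (use edges_skeleton_not_c[OF x] in simp)
    \<comment> \<open>A piece meets a later central vertex only through its spike vertex, which
      points to the start of the next block.\<close>
    moreover have "next_label (L x) = p u \<longleftrightarrow> x = c t \<and> u = t + 1"
    proof (cases "u = t + 1")
      case True
      then show ?thesis using next_label_eq_iff[OF x] by auto
    next
      case False
      then have "p (t + 1) < p u" using p_strict[of "t + 1" u] tu by auto
      then show ?thesis using False next_label_G_bounds[OF x] by auto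
    qed
    moreover have "next_label (L x) \<noteq> p (u + 1)"
      using next_label_G_bounds[OF x] p_strict[of "t + 1" "u + 1"] tu by auto
    ultimately show ?thesis using one by (auto simp: edges_\<Gamma> Ly nly)
  next
    case y: (2 u)
    show ?thesis
    proof (cases "t = u")
      case True
      have "x \<noteq> c t \<or> y \<noteq> c t" using xy by auto
      then have "edges (skeleton m P c) x y = 0"
        using edges_skeleton_not_c[OF x] edges_skeleton_not_c[OF y] True by auto
      moreover have "(\<Sum>i=1..m. edges (G i) x y) = edges (G t) x y"
      proof -
        have "edges (G i) x y = 0" if "i \<in> {1..m} - {t}" for i
          using that edges_in[of i x y] G_disjoint[of i t] x by fastforce
        then show ?thesis using x(1) sum.remove[of "{1..m}" t "\<lambda>i. edges (G i) x y"] by simp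
      qed
      moreover have "edges (G t) x y = of_bool (edges (G t) x y > 0)"
        using edges_le_1[OF x(1), of x y] by (cases "edges (G t) x y") auto
      moreover have "edges (G t) x y > 0 \<longleftrightarrow> next_label (L x) = L y \<or> next_label (L x) = next_label (L y)"
        using successor_labellingD(8)[OF succ[OF x(1)] x(2) _ xy] y True next_label_G[OF x] next_label_G[OF y] by simp
      ultimately show ?thesis using one by (simp add: edges_\<Gamma>)
    next
      case False
      then have tu: "t < u" using xy L_G[OF x] L_G[OF y] p_mono[of u t] p_Suc[of u] x(1) y(1) by (cases t u rule: linorder_cases) auto
      have "edges (skeleton m P c) x y = 0"
      proof (cases "x = c t \<and> y = c u")
        case True
        then show ?thesis using arr_skeleton_c_c x(1) y(1) by (simp add: edges_def)
      qed (use edges_skeleton_not_c[OF x] edges_skeleton_not_c[OF y] in auto)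
      moreover have "(\<Sum>i=1..m. edges (G i) x y) = 0"
        using G_disjoint[OF _ x(1)] G_disjoint[OF _ y(1)] x y False by (intro edges_G_sum_zero) blast
      \<comment> \<open>Different pieces have no common edge; correspondingly \<open>x\<close>
        points no further than the start of the next block, strictly below
        \<open>L y\<close>.\<close>
      moreover have "next_label (L x) < L y" "L y < next_label (L y)"
        using next_label_G_bounds[OF x] next_label_G_bounds[OF y] L_G[OF y] p_mono[OF _ tu] x(1) by auto
      ultimately show ?thesis using one by (simp add: edges_\<Gamma>)
    qed
  qed
qed

text \<open>The edge from \<open>x\<close> to \<open>z\<close> prevents \<open>x\<close> from
  pointing to \<open>y\<close>, so \<open>x\<close> and \<open>y\<close> point to the same label,
  which is then \<open>L y + 1\<close>. As \<open>y\<close> and \<open>z\<close> cannot share their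
  successor as well, this label is that of \<open>z\<close>. A primary vertex therefore determines
  its complementary label.\<close>

lemma three_cycle_labels:
  assumes t: "t \<in> {1..m}" and tc: "three_cycle (G t) x y z" and "L x < L y" "L y < L z"
  shows "x \<in> verts (G t)" "\<sigma> t (L x) = L y + 1" "L z = L y + 1"
proof -
  have e: "edges (G t) x y > 0" "edges (G t) y z > 0" "edges (G t) x z > 0"
    using tc by (auto simp: three_cycle_def edges_def)
  then have V: "x \<in> verts (G t)" "y \<in> verts (G t)" "z \<in> verts (G t)" using edges_in[OF t] by blast+
  note S = succ[OF t]
  note E = successor_labellingD(8)[OF S]
  note R = successor_labelling_range[OF S]
  have sz: "L z < \<sigma> t (L z)" "L y < \<sigma> t (L y)" using successor_labelling_succ[OF S] R V by blast+
  have xy: "\<sigma> t (L x) = L y \<or> \<sigma> t (L x) = \<sigma> t (L y)" using E[OF V(1,2)] assms(3) e by simp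
  have yz: "\<sigma> t (L y) = L z \<or> \<sigma> t (L y) = \<sigma> t (L z)" using E[OF V(2,3)] assms(4) e by simp
  have xz: "\<sigma> t (L x) = L z \<or> \<sigma> t (L x) = \<sigma> t (L z)" using E[OF V(1,3)] assms(3,4) e by simp
  have same: "\<sigma> t (L x) = \<sigma> t (L y)" using xy xz sz assms(4) by auto
  have s1: "\<sigma> t (L x) = L y + 1"
    using successor_labellingD(7)[OF S _ assms(3) _ same] R V by blast
  have "\<sigma> t (L y) \<noteq> \<sigma> t (L z)"
    using successor_labellingD(7)[OF S _ assms(4)] R V same s1 assms(4) by fastforce
  then show "x \<in> verts (G t)" "\<sigma> t (L x) = L y + 1" "L z = L y + 1" using V s1 yz same by auto
qed

text \<open>Primary vertices are exactly those whose successor skips labels, and the complementary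
  label is one below the successor. This gives uniqueness for the description in
  \<open>beta\<close>.\<close>

lemma complementary_to_inner:
  assumes x: "t \<in> {1..m}" "x \<in> verts (G t)"
  shows "complementary_to m G L (L x) j \<longleftrightarrow> next_label (L x) \<noteq> L x + 1 \<and> next_label (L x) = j + 1"
proof
  assume "complementary_to m G L (L x) j"
  then obtain u x' y' z' where u: "u \<in> {1..m}" "three_cycle (G u) x' y' z'" "L x' = L x" "L y' = j" "L x < j" "j < L z'"
    unfolding complementary_to_def by blast
  note T = three_cycle_labels[OF u(1,2)]
  have x': "x' \<in> verts (G u)" "\<sigma> u (L x) = j + 1" using T u by auto
  have "u = t" using interval_unique[OF u(1) x(1), of "L x"] L_G[OF x] L_G[OF u(1) x'(1)] u(3) by auto
  then show "next_label (L x) \<noteq> L x + 1 \<and> next_label (L x) = j + 1" using next_label_G[OF x] x' u(5) by simp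
next
  assume j: "next_label (L x) \<noteq> L x + 1 \<and> next_label (L x) = j + 1"
  then have "\<sigma> t (L x) \<noteq> L x + 1" using next_label_G[OF x] by simp
  then obtain y z where "three_cycle (G t) x y z" "L y + 1 = \<sigma> t (L x)" "L z = \<sigma> t (L x)"
    using successor_labellingD(9)[OF succ[OF x(1)] x(2)] by blast
  moreover have "L x < j" using j next_label_G_bounds[OF x] by auto
  ultimately show "complementary_to m G L (L x) j"
    unfolding complementary_to_def using j next_label_G[OF x] x(1)
    by (intro bexI[of _ t] exI[of _ x] exI[of _ y] exI[of _ z]) auto
qed

lemma not_complementary_to_p:
  assumes "t \<in> {1..m}"
  shows "\<not> complementary_to m G L (p t) j"
proof
  assume "complementary_to m G L (p t) j"
  then obtain u x' y' z' where u: "u \<in> {1..m}" "three_cycle (G u) x' y' z'" "L x' = p t" "L y' = j" "p t < j" "j < L z'"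
    unfolding complementary_to_def by blast
  have "x' \<in> verts (G u)" using three_cycle_labels(1)[OF u(1,2)] u by simp
  then have "p u < p t" "p t < p (u + 1)" using L_G[OF u(1)] u(3) by metis+
  then show False using interval_unique[OF assms u(1), of "p t"] p_Suc[of t] assms by auto
qed

section \<open>The roots attached to the vertices\<close>

lemma p_m_less: "p m \<le> n - 1"
  using p_Suc[of m] p_last a_pos[of m] m by auto

text \<open>Sums of consecutive simple roots below index \<open>n\<close> telescope. The two special
  formulas, for \<open>p m\<close> and for \<open>n\<close>, produce the successor
  \<open>n + 1\<close> through \<open>e (n + 1) = - e 1\<close>.\<close>

lemma beta_eq:
  assumes n4: "n \<ge> 4" and F: "D_frame n \<alpha> e" and "x \<in> verts \<Gamma>"
  shows "beta n \<alpha> m a (complementary_to m G L) (L x) = e (L x) - e (next_label (L x))"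
  using assms(3)
proof (cases rule: verts_cases)
  case x: (1 t)
  have Lx: "L x = p t" and nl: "next_label (L x) = p (t + 1)" using x L_P next_label_p by auto
  have nC: "\<not> (\<exists>j. complementary_to m G L (p t) j)" using not_complementary_to_p x(1) by blast
  have p_eq: "central_label a j = p j" for j by (simp add: p_def)
  have p_inj: "p t = p j \<longleftrightarrow> t = j" if "j \<in> {1..m}" for j
    using p_strict[of t j] p_strict[of j t] that x(1) by (cases t j rule: linorder_cases) auto
  show ?thesis
  proof (cases "t = m")
    case False
    then have t: "t \<in> {1..m-1}" using x(1) by auto
    have tm: "t < m" using t by auto
    have the: "(THE j. j \<in> {1..m-1} \<and> p t = p j) = t"
    proof (rule the_equality)
      show "j = t" if "j \<in> {1..m-1} \<and> p t = p j" for j using that p_inj[of j] by auto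
    qed (use t in simp)
    have "\<exists>j\<in>{1..m-1}. p t = p j" using t by blast
    then have "beta n \<alpha> m a (complementary_to m G L) (L x) = (\<Sum>k=p t..p t + a t. \<alpha> k)"
      using nC by (simp only: beta_def Lx p_eq the if_True if_False)
    also have "\<dots> = e (p t) - e (p t + a t + 1)"
      using p_strict[of t m] p_m_less t tm label_bounds[OF assms(3)] Lx n4 by (intro D_frame_sum[OF F]) auto
    finally show ?thesis using p_Suc[of t] x(1) Lx nl by simp
  next
    case True
    have "p t \<noteq> p j" if "j \<in> {1..m-1}" for j
    proof -
      have "j \<in> {1..m}" "j \<noteq> m" using that m by auto
      then show ?thesis using p_inj[of j] True by auto
    qed
    then have "\<not> (\<exists>j\<in>{1..m-1}. p t = p j)" by blast
    then have "beta n \<alpha> m a (complementary_to m G L) (L x) =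
        (\<Sum>k=1..p m-1. \<alpha> k) + (\<Sum>k=p m..n-2. 2 *\<^sub>R \<alpha> k) + \<alpha> (n-1) + \<alpha> n"
      using nC True by (simp only: beta_def Lx p_eq if_True if_False simp_thms)
    also have "(\<Sum>k=1..p m-1. \<alpha> k) = e 1 - e (p m)"
      using D_frame_sum[OF F, of 1 "p m - 1"] label_bounds[OF assms(3)] Lx True p_m_less n4 by simp
    \<comment> \<open>For \<open>p m = n - 1\<close> the sum is empty and the right-hand side
      vanishes as well.\<close>
    also have "(\<Sum>k=p m..n-2. 2 *\<^sub>R \<alpha> k) = 2 *\<^sub>R (e (p m) - e (n - 1))"
      using D_frame_sum[OF F, of "p m" "n - 2"] label_bounds[OF assms(3)] Lx True p_m_less n4
      by (simp add: scaleR_sum_right[symmetric] Suc_diff_Suc numeral_2_eq_2)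
    also have "\<alpha> n = e (n - 1) + e n" using F by (simp add: D_frame_def)
    also have "\<alpha> (n - 1) = e (n - 1) - e n"
    proof -
      have "n - 1 \<in> {1..n-1}" "n - 1 + 1 = n" using n4 by auto
      then show ?thesis using F unfolding D_frame_def by metis
    qed
    also have "e 1 - e (p m) + 2 *\<^sub>R (e (p m) - e (n - 1)) + (e (n - 1) - e n) + (e (n - 1) + e n) = e (p m) - (- e 1)"
      by (simp add: scaleR_2 algebra_simps)
    also have "- e 1 = e (n + 1)" using F by (simp add: D_frame_def)
    finally show ?thesis using True Lx nl p_last by simp
  qed
next
  case x: (2 t)
  note C = complementary_to_inner[OF x]
  show ?thesis
  proof (cases "next_label (L x) = L x + 1")
    case False
    then have the: "(THE j. complementary_to m G L (L x) j) = next_label (L x) - 1"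
      using C next_label_G_bounds[OF x] by (intro the_equality) auto
    have ex: "\<exists>j. complementary_to m G L (L x) j"
      using C False next_label_G_bounds[OF x] by (intro exI[of _ "next_label (L x) - 1"]) auto
    \<comment> \<open>The last vertex of a piece points to the next label, so a primary vertex is
      not last. Its successor is then at most \<open>n\<close>, and the sum stops before \<alpha>
      \<open>n\<close>, where telescoping would fail.\<close>
    have "x \<noteq> c t" using False next_label_c[OF x(1)] L_c[OF x(1)] p_Suc[of t] x(1) by auto
    then have "next_label (L x) \<le> n"
      using next_label_less[OF x] p_mono[of t "m + 1"] p_last x(1) by auto
    moreover have "beta n \<alpha> m a (complementary_to m G L) (L x) = (\<Sum>k=L x..next_label (L x) - 1. \<alpha> k)"
      using ex by (simp add: beta_def the)
    ultimately show ?thesis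
      using D_frame_sum[OF F, of "L x" "next_label (L x) - 1"] next_label_G_bounds[OF x] label_bounds[OF assms(3)] by auto
  next
    case True
    then have nC: "\<not> (\<exists>j. complementary_to m G L (L x) j)" using C by simp
    have nP: "L x \<noteq> central_label a j" if "j \<in> {1..m}" for j
    proof
      assume "L x = central_label a j"
      then have "L x = p j" by (simp add: p_def)
      then show False using interval_unique[OF that x(1), of "L x"] L_G[OF x] p_Suc[of j] that by auto
    qed
    have "{1..m-1} \<subseteq> {1..m}" by auto
    then have nP': "\<not> (\<exists>j\<in>{1..m-1}. L x = central_label a j)" "L x \<noteq> central_label a m"
      using nP nP[of m] m by (blast, simp)
    show ?thesis
    proof (cases "L x = n")
      case n: True
      have "beta n \<alpha> m a (complementary_to m G L) (L x) = (\<Sum>k=1..n-2. \<alpha> k) + \<alpha> n"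
        using nC nP' n by (simp add: beta_def)
      also have "(\<Sum>k=1..n-2. \<alpha> k) = e 1 - e (n - 1)"
        using D_frame_sum[OF F, of 1 "n - 2"] n4 by (simp add: Suc_diff_Suc numeral_2_eq_2)
      also have "\<alpha> n = e (n - 1) + e n" using F by (simp add: D_frame_def)
      finally show ?thesis using F n True by (simp add: D_frame_def)
    next
      case False
      then have "L x \<in> {1..n-1}" using label_bounds[OF assms(3)] by auto
      then show ?thesis using nC nP' False True F by (simp add: beta_def D_frame_def)
    qed
  qed
qed

theorem companion_basis_beta:
  fixes \<alpha> :: "nat \<Rightarrow> 'a::euclidean_space"
  assumes n4: "n \<ge> 4" and R: "root_system_D n \<Phi> \<alpha>"
  shows "companion_basis \<Phi> \<Gamma> (\<lambda>x. beta n \<alpha> m a (complementary_to m G L) (L x))"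
proof -
  obtain e where F: "D_frame n \<alpha> e" using D_frame_exists[OF n4 R] .
  let ?b = "\<lambda>i. e i - e (next_label i)"
  note beta = beta_eq[OF n4 F]
  have nb: "i < next_label i \<and> next_label i \<le> n + 1" if "i \<in> {1..n}" for i
  proof -
    have "i \<in> L ` verts \<Gamma>" using bij_betw_imp_surj_on[OF bij_L] that by simp
    then obtain x where "x \<in> verts \<Gamma>" "L x = i" by (elim imageE) simp
    then show ?thesis using next_label_bounds by auto
  qed
  have lat: "lattice_basis (zmod.span \<Phi>) {1..n} ?b"
    using D_frame_lattice_basis[OF n4 R F nb next_label_1] by simp
  have "lattice_basis (zmod.span \<Phi>) (verts \<Gamma>) (\<lambda>x. ?b (L x))"
  proof -
    have "(\<lambda>x. ?b (L x)) ` verts \<Gamma> = ?b ` {1..n}"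
      unfolding bij_betw_imp_surj_on[OF bij_L, symmetric] image_image ..
    moreover have "inj_on (\<lambda>x. ?b (L x)) (verts \<Gamma>)"
      using lat bij_L comp_inj_on[of L "verts \<Gamma>" ?b] by (simp add: lattice_basis_def bij_betw_def comp_def)
    ultimately show ?thesis using lat by (simp add: lattice_basis_def)
  qed
  moreover have "inj_on (\<lambda>x. beta n \<alpha> m a (complementary_to m G L) (L x)) (verts \<Gamma>) \<longleftrightarrow> inj_on (\<lambda>x. ?b (L x)) (verts \<Gamma>)"
    by (intro inj_on_cong beta)
  moreover have "(\<lambda>x. beta n \<alpha> m a (complementary_to m G L) (L x)) ` verts \<Gamma> = (\<lambda>x. ?b (L x)) ` verts \<Gamma>"
    by (intro image_cong refl beta)
  ultimately have "lattice_basis (zmod.span \<Phi>) (verts \<Gamma>) (\<lambda>x. beta n \<alpha> m a (complementary_to m G L) (L x))"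
    by (simp add: lattice_basis_def)
  moreover have "beta n \<alpha> m a (complementary_to m G L) (L x) \<in> \<Phi>" if "x \<in> verts \<Gamma>" for x
    unfolding beta[OF that]
    using label_bounds[OF that] next_label_bounds[OF that] next_label_1 by (intro D_frame_roots[OF n4 R F]) auto
  moreover have ordered: "\<bar>?b (L x) \<bullet> ?b (L y)\<bar> = real (edges \<Gamma> x y)"
    if xy: "x \<in> verts \<Gamma>" "y \<in> verts \<Gamma>" "L x < L y" for x y
  proof -
    have "?b (L x) \<bullet> ?b (L y) = of_bool (next_label (L x) = next_label (L y)) +
        of_bool (L x = 1 \<and> next_label (L y) = n + 1) - of_bool (next_label (L x) = L y)"
      using label_bounds[OF xy(1)] label_bounds[OF xy(2)] next_label_bounds[OF xy(1)] next_label_bounds[OF xy(2)] xy(3)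
      by (intro D_frame_inner_differences[OF F]) auto
    moreover have "L y < next_label (L y)" using next_label_bounds[OF xy(2)] by simp
    \<comment> \<open>Otherwise the wrap-around term and the direct term would cancel to 0 at an
      existing edge. It would mean that the cycle closes after two central vertices.\<close>
    moreover have "\<not> (next_label 1 = L y \<and> next_label (L y) = n + 1)"
    proof
      assume *: "next_label 1 = L y \<and> next_label (L y) = n + 1"
      then have "L y = p 2" using next_label_p[of 1] p_1 m by (simp add: numeral_2_eq_2)
      then have "p 3 = p (m + 1)" using * next_label_p[of 2] p_last m by simp
      then show False using p_strict[of 3 "m + 1"] m by auto
    qed
    ultimately show ?thesis
      unfolding edges_\<Gamma>_next_label[OF xy] using next_label_1 by auto
  qed
  have "\<bar>beta n \<alpha> m a (complementary_to m G L) (L x) \<bullet> beta n \<alpha> m a (complementary_to m G L) (L y)\<bar> = real (edges \<Gamma> x y)"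
    if xy: "x \<in> verts \<Gamma>" "y \<in> verts \<Gamma>" "x \<noteq> y" for x y
  proof -
    \<comment> \<open>Both sides of the claim are symmetric in \<open>x\<close> and
      \<open>y\<close>, so the ordered case suffices.\<close>
    have "L x < L y \<or> L y < L x" using inj_L xy by (metis inj_onD linorder_neqE_nat)
    then show ?thesis
      unfolding beta[OF xy(1)] beta[OF xy(2)]
      using ordered[OF xy(1,2)] ordered[OF xy(2,1)] by (auto simp: inner_commute edges_def add.commute)
  qed
  ultimately show ?thesis unfolding companion_basis_def by blast
qed

end

section \<open>Reduction of the theorem to the locale of labelled spikes\<close>

theorem theorem4p6:
  fixes n m :: nat
    and \<Gamma> :: "'v quiver"
    and P c :: "nat \<Rightarrow> 'v"
    and G :: "nat \<Rightarrow> 'v quiver"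
    and L :: "'v \<Rightarrow> nat"
    and \<Phi> :: "'a::euclidean_space set"
    and \<alpha> :: "nat \<Rightarrow> 'a"
  assumes "n \<ge> 4"
    and "mutation_type_D n \<Gamma>"
    and "type_IV_full \<Gamma> m P c G"
    and "labelling_IV_full m P c G L"
    and "root_system_D n \<Phi> \<alpha>"
  shows "companion_basis \<Phi> \<Gamma>
           (\<lambda>x. beta n \<alpha> m (\<lambda>j. card (verts (G j))) (complementary_to m G L) (L x))"
proof -
  let ?a = "\<lambda>j. card (verts (G j))"
  let ?p = "central_label ?a"
  note T = assms(3)[unfolded type_IV_full_def] and lab = assms(4)[unfolded labelling_IV_full_def]
  have G: "mutation_type_A (?a t) (G t)" "end_vertex (G t) (c t)" if "t \<in> {1..m}" for t
    using T that by blast+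
  have type_A: "type_A (G t)" if t: "t \<in> {1..m}" for t
  proof (rule mutation_type_A_type_A[OF G(1)[OF t]])
    \<comment> \<open>The spike vertex makes the piece nonempty, so that it can be seen from a
      vertex as \<open>type_A\<close> requires.\<close>
    have "c t \<in> verts (G t)" using G(2)[OF t] by (simp add: end_vertex_def)
    then show "1 \<le> ?a t" using mutation_type_verts(1)[OF G(1)[OF t]] by (simp add: Suc_le_eq card_gt_0_iff) blast
  qed
  have "\<exists>s. successor_labelling (\<lambda>x y. edges (G t) x y > 0) (three_cycle (G t)) (verts (G t)) L (?p t) (c t) s"
    if t: "t \<in> {1..m}" for t
  proof -
    obtain e L' where L': "labelling_A (G t) e (c t) L'" "\<And>x. x \<in> verts (G t) \<Longrightarrow> L x = L' x + ?p t"
      using lab t by blast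
    obtain s where s: "successor_labelling (\<lambda>x y. edges (G t) x y > 0) (three_cycle (G t)) (verts (G t)) L' 0 (c t) s"
      using labelling_A_successor_labelling[OF L'(1) type_A[OF t]] by blast
    \<comment> \<open>The type A labels of the piece are shifted by the label of the central vertex
      preceding the block.\<close>
    show ?thesis by (rule exI, rule successor_labelling_shift[OF s L'(2)]) auto
  qed
  then obtain \<sigma> where \<sigma>: "\<And>t. t \<in> {1..m} \<Longrightarrow>
      successor_labelling (\<lambda>x y. edges (G t) x y > 0) (three_cycle (G t)) (verts (G t)) L (?p t) (c t) (\<sigma> t)"
    by metis
  have E: "edges (G t) x y \<le> 1 \<and> (edges (G t) x y > 0 \<longrightarrow> x \<in> verts (G t) \<and> y \<in> verts (G t))"
    if t: "t \<in> {1..m}" for t x y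
  proof -
    obtain l r where D: "distinct_tree (Node l (c t) r)" "G t = tree_quiver (Node l (c t) r)"
      using end_vertex_tree[OF type_A[OF t] G(2)[OF t]] .
    then show ?thesis
      using edges_tree_quiver[OF D(1), of x y] adjacent_in[of "Node l (c t) r" x y]
      by (auto simp: tree_quiver_def)
  qed
  interpret S: labelled_spikes m P c G L ?a ?p \<sigma>
  proof
    show "L (P t) = ?p t" if "t \<in> {1..m}" for t using lab that by blast
  qed (use T E \<sigma> in auto)
  have \<Gamma>: "\<Gamma> = S.\<Gamma>" using T unfolding S.\<Gamma>_def by blast
  \<comment> \<open>Both numbers count the vertices of \<Gamma>: mutation preserves the vertex set,
    and the pieces together with the central cycle exhaust it.\<close>
  then have "n = S.n" using mutation_type_verts(2)[OF assms(2)] S.card_verts by simp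
  then show ?thesis using S.companion_basis_beta assms(1,5) \<Gamma> by simp
qed

end
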